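(* Let $A$ be a $2\times 2$ real symmetric positive-semidefinite matrix and let $f:\mathbb{R}^2\to\mathbb{R}$ be Lipschitz. Let $u\in C(\mathbb{H}\times[0,\infty))$ be the unique viscosity solution of $$u_t-\operatorname{tr}\left(A(\nabla_H^2u)^\ast\right)+f(\nabla_Hu)=0\quad\text{in }\mathbb{H}\times(0,\infty)$$ with $u(\cdot,0)=u_0$ satisfying the growth condition (G) for any $T>0$ there exist $k>0$ and $C_T>0$ such that $|u(p,t)|\le C_Te^{k\langle p\rangle}$ for all $(p,t)\in\mathbb{H}\times[0,T]$. Assume in addition that $f$ is concave in $\mathbb{R}^2$, i.e. $f(\xi)+f(\eta)\le2f\left(\tfrac12(\xi+\eta)\right)$ for all $\xi,\eta\in\mathbb{R}^2$. If $u_0$ is right invariant h-convex in $\mathbb{H}$, that is, $$u_0(h^{-1}\cdot p)+u_0(h\cdot p)\ge2u_0(p)\quad\text{for all }p\in\mathbb{H}\text{ and }h\in\mathbb{H}_0,$$ then so is $u(\cdot,t)$ for all $t\ge0$.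
   Context: The Heisenberg group $\mathbb{H}$ is $\mathbb{R}^3$ with the group law $(x_p,y_p,z_p)\cdot(x_q,y_q,z_q)=\left(x_p+x_q,\,y_p+y_q,\,z_p+z_q+\tfrac12(x_py_q-x_qy_p)\right)$; the inverse of $p=(x,y,z)$ is $p^{-1}=(-x,-y,-z)$. Set $\mathbb{H}_0=\{(h_1,h_2,0):h_1,h_2\in\mathbb{R}\}\subset\mathbb{H}$ and $\langle p\rangle=(1+x^4+y^4+16z^2)^{1/4}$ for $p=(x,y,z)$. Left-invariant vector fields: $X_1=\partial_x-\tfrac y2\partial_z$, $X_2=\partial_y+\tfrac x2\partial_z$. The horizontal gradient is $\nabla_Hu=(X_1u,X_2u)$, and the symmetrized horizontal Hessian $(\nabla_H^2u)^\ast$ is the symmetric $2\times2$ matrix with diagonal entries $X_1^2u$, $X_2^2u$ and off-diagonal entries $\tfrac12(X_1X_2u+X_2X_1u)$ (derivatives in the space variable only). Viscosity notions: an upper semicontinuous (resp. lower semicontinuous) function $u$ is a viscosity subsolution (resp. supersolution) of the equation in $\mathbb{H}\times(0,\infty)$ if, whenever $\phi$ is $C^2$ near $(p_0,t_0)\in\mathbb{H}\times(0,\infty)$ and $u-\phi$ has a local maximum (resp. minimum) at $(p_0,t_0)$, one has $\phi_t-\operatorname{tr}(A(\nabla_H^2\phi)^\ast)+f(\nabla_H\phi)\le0$ (resp. $\ge0$) at $(p_0,t_0)$. A continuous function is a viscosity solution if it is both. *)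

theory Defs
  imports "HOL-Analysis.Analysis"
begin

section \<open>The Heisenberg group\<close>

type_synonym heis = "real \<times> real \<times> real"

fun hmul :: "heis \<Rightarrow> heis \<Rightarrow> heis" (infixl "\<cdot>\<^sub>H" 70) where
  "(x, y, z) \<cdot>\<^sub>H (x', y', z') = (x + x', y + y', z + z' + (x * y' - x' * y) / 2)"

fun hinv :: "heis \<Rightarrow> heis" where
  "hinv (x, y, z) = (- x, - y, - z)"

definition H0 :: "heis set" where
  "H0 = {(a, b, 0) | a b. True}"

fun hgauge :: "heis \<Rightarrow> real" where
  "hgauge (x, y, z) = (1 + x ^ 4 + y ^ 4 + 16 * z ^ 2) powr (1 / 4)"

definition right_inv_h_convex :: "(heis \<Rightarrow> real) \<Rightarrow> bool" where
  "right_inv_h_convex v \<longleftrightarrow>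
     (\<forall>p. \<forall>h\<in>H0. v (hinv h \<cdot>\<^sub>H p) + v (h \<cdot>\<^sub>H p) \<ge> 2 * v p)"

section \<open>Horizontal derivatives\<close>

fun X1 :: "(heis \<Rightarrow> real) \<Rightarrow> heis \<Rightarrow> real" where
  "X1 v (x, y, z) = deriv (\<lambda>s. v (s, y, z)) x - y / 2 * deriv (\<lambda>s. v (x, y, s)) z"

fun X2 :: "(heis \<Rightarrow> real) \<Rightarrow> heis \<Rightarrow> real" where
  "X2 v (x, y, z) = deriv (\<lambda>s. v (x, s, z)) y + x / 2 * deriv (\<lambda>s. v (x, y, s)) z"

definition hgrad :: "(heis \<Rightarrow> real) \<Rightarrow> heis \<Rightarrow> real ^ 2" where
  "hgrad v p = vector [X1 v p, X2 v p]"

definition hhess_sym :: "(heis \<Rightarrow> real) \<Rightarrow> heis \<Rightarrow> real ^ 2 ^ 2" where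
  "hhess_sym v p =
     (let m = (X1 (X2 v) p + X2 (X1 v) p) / 2
      in vector [vector [X1 (X1 v) p, m], vector [m, X2 (X2 v) p]])"

section \<open>Viscosity solutions\<close>

definition C2_on :: "'a::real_normed_vector set \<Rightarrow> ('a \<Rightarrow> real) \<Rightarrow> bool" where
  "C2_on U \<phi> \<longleftrightarrow>
     (\<exists>(D :: 'a \<Rightarrow> 'a \<Rightarrow>\<^sub>L real) (D2 :: 'a \<Rightarrow> 'a \<Rightarrow>\<^sub>L 'a \<Rightarrow>\<^sub>L real).
        (\<forall>x\<in>U. (\<phi> has_derivative blinfun_apply (D x)) (at x)) \<and>
        (\<forall>x\<in>U. (D has_derivative blinfun_apply (D2 x)) (at x)) \<and>
        continuous_on U D2)"

definition C2_near :: "'a::real_normed_vector \<Rightarrow> ('a \<Rightarrow> real) \<Rightarrow> bool" where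
  "C2_near x \<phi> \<longleftrightarrow> (\<exists>U. open U \<and> x \<in> U \<and> C2_on U \<phi>)"

definition local_max_at :: "('a::topological_space \<Rightarrow> real) \<Rightarrow> 'a \<Rightarrow> bool" where
  "local_max_at g x \<longleftrightarrow> (\<forall>\<^sub>F y in nhds x. g y \<le> g x)"

definition local_min_at :: "('a::topological_space \<Rightarrow> real) \<Rightarrow> 'a \<Rightarrow> bool" where
  "local_min_at g x \<longleftrightarrow> (\<forall>\<^sub>F y in nhds x. g x \<le> g y)"

definition usc_on :: "'a::topological_space set \<Rightarrow> ('a \<Rightarrow> real) \<Rightarrow> bool" where
  "usc_on S u \<longleftrightarrow> (\<forall>x\<in>S. \<forall>e>0. \<forall>\<^sub>F y in at x within S. u y < u x + e)"

definition lsc_on :: "'a::topological_space set \<Rightarrow> ('a \<Rightarrow> real) \<Rightarrow> bool" where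
  "lsc_on S u \<longleftrightarrow> (\<forall>x\<in>S. \<forall>e>0. \<forall>\<^sub>F y in at x within S. u x - e < u y)"

text \<open>Functions on space-time are total on \<open>heis \<times> real\<close>; only their values at
  nonnegative times matter, since local extrema are tested at positive times only.\<close>

definition parab_op ::
  "real ^ 2 ^ 2 \<Rightarrow> (real ^ 2 \<Rightarrow> real) \<Rightarrow> (heis \<times> real \<Rightarrow> real) \<Rightarrow> heis \<Rightarrow> real \<Rightarrow> real" where
  "parab_op A f \<phi> p t =
     deriv (\<lambda>s. \<phi> (p, s)) t
     - trace (A ** hhess_sym (\<lambda>q. \<phi> (q, t)) p)
     + f (hgrad (\<lambda>q. \<phi> (q, t)) p)"

definition viscosity_subsolution ::
  "real ^ 2 ^ 2 \<Rightarrow> (real ^ 2 \<Rightarrow> real) \<Rightarrow> (heis \<times> real \<Rightarrow> real) \<Rightarrow> bool" where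
  "viscosity_subsolution A f u \<longleftrightarrow>
     usc_on (UNIV \<times> {0<..}) u \<and>
     (\<forall>\<phi> p t. t > 0 \<and> C2_near (p, t) \<phi> \<and> local_max_at (\<lambda>q. u q - \<phi> q) (p, t)
        \<longrightarrow> parab_op A f \<phi> p t \<le> 0)"

definition viscosity_supersolution ::
  "real ^ 2 ^ 2 \<Rightarrow> (real ^ 2 \<Rightarrow> real) \<Rightarrow> (heis \<times> real \<Rightarrow> real) \<Rightarrow> bool" where
  "viscosity_supersolution A f u \<longleftrightarrow>
     lsc_on (UNIV \<times> {0<..}) u \<and>
     (\<forall>\<phi> p t. t > 0 \<and> C2_near (p, t) \<phi> \<and> local_min_at (\<lambda>q. u q - \<phi> q) (p, t)
        \<longrightarrow> parab_op A f \<phi> p t \<ge> 0)"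

definition viscosity_solution ::
  "real ^ 2 ^ 2 \<Rightarrow> (real ^ 2 \<Rightarrow> real) \<Rightarrow> (heis \<times> real \<Rightarrow> real) \<Rightarrow> bool" where
  "viscosity_solution A f u \<longleftrightarrow>
     continuous_on (UNIV \<times> {0<..}) u \<and>
     viscosity_subsolution A f u \<and> viscosity_supersolution A f u"

definition exp_growth :: "(heis \<times> real \<Rightarrow> real) \<Rightarrow> bool" where
  "exp_growth u \<longleftrightarrow>
     (\<forall>T>0. \<exists>k>0. \<exists>C>0. \<forall>p. \<forall>t\<in>{0..T}. \<bar>u (p, t)\<bar> \<le> C * exp (k * hgauge p))"

end

theory Submission
  imports Defs
begin

text \<open>
  A concave \<open>f\<close> is the infimum of its affine majorants \<open>b \<bullet> \<xi> + c\<close>, so a viscosity supersolution \<open>u\<close>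
  of the equation is one of every linear equation \<open>u\<^sub>t = \<L> u - c\<close> with
  \<open>\<L> = (s\<^sub>1 \<bullet> X)\<^sup>2 + (s\<^sub>2 \<bullet> X)\<^sup>2 - b \<bullet> X\<close> and \<open>A = s\<^sub>1 s\<^sub>1\<^sup>T + s\<^sub>2 s\<^sub>2\<^sup>T\<close>. The semigroup of \<open>\<L>\<close> is
  approximated by iterates of an explicit average \<open>P\<close> of right translations. Since \<open>P\<close> commutes with left
  convolution, the iterates of mollified data keep uniform bounds on derivatives, and comparing \<open>u\<close> on short
  time strips with the smooth strict subsolutions \<open>g + r \<L> g - \<dots>\<close> gives
  \<open>u(t + s) \<ge> P\<^sup>n u(t) - c s - o(1)\<close>. This inequality is linear and left invariant, hence it passes to the
  average \<open>w\<close> of \<open>u(h\<^sup>-\<^sup>1 p)\<close> and \<open>u(h p)\<close> and to its mollification \<open>W\<close>, for which \<open>s \<rightarrow> 0\<close> yields the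
  classical inequality \<open>W\<^sub>t \<ge> \<L> W - c\<close> for every majorant; choosing the majorant that touches \<open>f\<close> at the
  horizontal gradient, \<open>W\<close> is a classical supersolution of the nonlinear equation. It can therefore be used as a
  test function against the subsolution \<open>u\<close>, which gives \<open>u \<le> w\<close>. No theorem on sums is needed.
\<close>

section \<open>Functions of class C^k\<close>

text \<open>The obstacle: a viscosity inequality lives only at touching points. It can neither be
  integrated against a kernel nor averaged over translates, because a touching point of the average
  \<open>w\<close> says nothing about its two translates separately. The inequality for the random
  walk holds at every point and involves \<open>u\<close> only through its values, so it survives
  both operations.

  Concavity puts the affine functions on the right side: in the inequality of a supersolution,
  \<open>f\<close> may be replaced by anything larger.

  Left translations occur in both roles. The equation is invariant under them, its fields being left
  invariant, and right invariant h-convexity compares \<open>u\<close> with its left translates by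
  \<open>h\<close> and \<open>hinv h\<close>.

  Growth is measured by weights \<open>exp (k * sgauge p)\<close>. Jumps of the walk, being right
  translations, multiply a weight by a constant, whereas left translations and convolutions raise
  the rate \<open>k\<close>. Hence each argument runs through a short chain of rates, which is
  affordable because every rate has a finite growth constant (\<open>growth_rate_exists\<close>).
  Order four recurs because the consistency error of one step of the walk is controlled by fourth
  derivatives.\<close>

abbreviation fd :: "('a::real_normed_vector \<Rightarrow> real) \<Rightarrow> 'a \<Rightarrow> 'a \<Rightarrow> real" where
  "fd f x \<equiv> frechet_derivative f (at x)"

text \<open>Derivatives enter in a fixed direction only, hence stay real-valued, and induction on
  the order needs no spaces of multilinear maps. \<open>Ck_imp_C2_on\<close> converts the result to
  the class of admissible test functions.\<close>

fun Ck :: "nat \<Rightarrow> ('a::euclidean_space \<Rightarrow> real) \<Rightarrow> bool" where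
  Ck_0: "Ck 0 f \<longleftrightarrow> continuous_on UNIV f"
| Ck_Suc: "Ck (Suc n) f \<longleftrightarrow> (\<forall>x. f differentiable at x) \<and> (\<forall>h. Ck n (\<lambda>x. fd f x h))"

declare Ck_Suc [simp del]

lemma fd_eq: "(f has_derivative F) (at x) \<Longrightarrow> fd f x = F"
  using frechet_derivative_at by metis

lemma Ck_SucI:
  assumes F: "\<And>x. (f has_derivative F x) (at x)" and "\<And>h. Ck n (\<lambda>x. F x h)"
  shows "Ck (Suc n) f"
  using assms(2) F unfolding Ck_Suc fd_eq[OF F] differentiable_def by blast

lemma Ck_deriv: "Ck (Suc n) f \<Longrightarrow> (f has_derivative fd f x) (at x)"
  unfolding Ck_Suc using frechet_derivative_works by blast

lemma Ck_fd: "Ck (Suc n) f \<Longrightarrow> Ck n (\<lambda>x. fd f x h)"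
  by (simp add: Ck_Suc)

lemma Ck_mono_Suc: "Ck (Suc n) f \<Longrightarrow> Ck n f"
proof (induction n arbitrary: f)
  case 0
  have "continuous_on UNIV f"
    using Ck_deriv[OF 0] by (rule has_derivative_continuous_on[OF has_derivative_at_withinI])
  then show ?case by simp
next
  case (Suc n)
  show ?case by (rule Ck_SucI[OF Ck_deriv[OF Suc.prems] Suc.IH[OF Ck_fd[OF Suc.prems]]])
qed

lemma Ck_mono: "Ck n f \<Longrightarrow> m \<le> n \<Longrightarrow> Ck m f"
proof (induction n)
  case (Suc n)
  then show ?case by (cases "m = Suc n") (simp_all add: Ck_mono_Suc)
qed simp

lemma Ck_continuous: "Ck n f \<Longrightarrow> continuous_on UNIV f"
  using Ck_mono[of n f 0] by simp

lemma Ck_const: "Ck n (\<lambda>x. c)"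
proof (induction n arbitrary: c)
  case (Suc n)
  show ?case by (rule Ck_SucI[OF has_derivative_const Suc])
qed simp

lemma Ck_linear: 
  assumes "bounded_linear f" 
  shows "Ck n f"
proof (cases n)
  case 0
  then show ?thesis using assms by (simp add: linear_continuous_on)
next
  case (Suc m)
  show ?thesis
    unfolding Suc by (rule Ck_SucI[OF bounded_linear_imp_has_derivative[OF assms] Ck_const])
qed

lemma Ck_add: "Ck n f \<Longrightarrow> Ck n g \<Longrightarrow> Ck n (\<lambda>x. f x + g x)"
proof (induction n arbitrary: f g)
  case 0 then show ?case by (simp add: continuous_on_add)
next
  case (Suc n)
  show ?case
    by (rule Ck_SucI[OF has_derivative_add[OF Suc.prems[THEN Ck_deriv]]])
      (rule Suc.IH[OF Suc.prems[THEN Ck_fd]])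
qed

lemma Ck_mult: "Ck n f \<Longrightarrow> Ck n g \<Longrightarrow> Ck n (\<lambda>x. f x * g x)"
proof (induction n arbitrary: f g)
  case 0 then show ?case by (simp add: continuous_on_mult)
next
  case (Suc n)
  show ?case
    by (rule Ck_SucI[OF has_derivative_mult[OF Suc.prems[THEN Ck_deriv]]])
      (intro Ck_add Suc.IH Suc.prems[THEN Ck_fd] Suc.prems[THEN Ck_mono_Suc])
qed

lemma Ck_cmult: "Ck n f \<Longrightarrow> Ck n (\<lambda>x. c * f x)"
  by (intro Ck_mult Ck_const)

lemma Ck_minus: "Ck n f \<Longrightarrow> Ck n (\<lambda>x. - f x)"
  using Ck_cmult[of n f "-1"] by simp

lemma Ck_diff: "Ck n f \<Longrightarrow> Ck n g \<Longrightarrow> Ck n (\<lambda>x. f x - g x)"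
  using Ck_add[of n f "\<lambda>x. - g x"] Ck_minus[of n g] by simp

lemma Ck_power: "Ck n f \<Longrightarrow> Ck n (\<lambda>x. f x ^ m)"
proof (induction m)
  case 0 then show ?case by (simp add: Ck_const)
next
  case (Suc m) then show ?case by (simp add: Ck_mult)
qed

lemma Ck_affine:
  assumes T: "bounded_linear T" and "Ck n f"
  shows "Ck n (\<lambda>x. f (T x + c))"
  using assms(2)
proof (induction n arbitrary: f)
  case 0
  have "continuous_on UNIV (\<lambda>x. T x + c)"
    by (intro continuous_intros linear_continuous_on T)
  then show ?case using 0 continuous_on_compose2[of UNIV f UNIV "\<lambda>x. T x + c"] by simp
next
  case (Suc n)
  have "((\<lambda>x. T x + c) has_derivative T) (at x)" for x
    using bounded_linear_imp_has_derivative[OF T] by (simp add: has_derivative_add_const)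
  from has_derivative_compose[OF this Ck_deriv[OF Suc.prems]]
  show ?case by (rule Ck_SucI) (rule Suc.IH[OF Ck_fd[OF Suc.prems]])
qed

lemma Ck_exp: "Ck n f \<Longrightarrow> Ck n (\<lambda>x. exp (f x))"
proof (induction n arbitrary: f)
  case 0 then show ?case by (simp add: continuous_on_exp)
next
  case (Suc n)
  have "((\<lambda>x. exp (f x)) has_derivative (\<lambda>h. exp (f x) * fd f x h)) (at x)" for x
    using has_derivative_exp[OF Ck_deriv[OF Suc.prems]] by (simp add: mult.commute)
  then show ?case
    by (rule Ck_SucI) (intro Ck_mult Suc.IH Ck_fd[OF Suc.prems] Ck_mono_Suc[OF Suc.prems])
qed

lemma Ck_powr: "Ck n f \<Longrightarrow> (\<And>x. f x > 0) \<Longrightarrow> Ck n (\<lambda>x. f x powr a)"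
proof (induction n arbitrary: a)
  case 0 then show ?case by (simp add: continuous_on_powr less_imp_neq[symmetric] continuous_on_const)
next
  case (Suc n)
  have "((\<lambda>y. y powr a) has_real_derivative a * f x powr (a - 1)) (at (f x))" for x
    using has_real_derivative_powr Suc.prems(2) by blast
  from has_derivative_compose[OF Ck_deriv[OF Suc.prems(1)] this[unfolded has_field_derivative_def]]
  show ?case
    by (rule Ck_SucI)
      (intro Ck_mult Ck_const Suc.IH[OF Ck_mono_Suc[OF Suc.prems(1)] Suc.prems(2)] Ck_fd[OF Suc.prems(1)])
qed

text \<open>Powers of the positive part are the source of compactly supported kernels. An exponent
  of at least two makes the difference quotient tend to zero at the corner
  \<open>x = 0\<close>.\<close>

lemma max_power_deriv:
  "((\<lambda>y::real. max 0 y ^ (Suc (Suc n))) has_real_derivative of_nat (Suc (Suc n)) * max 0 x ^ Suc n) (at x)"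
proof -
  consider "x > 0" | "x < 0" | "x = 0" by linarith
  then show ?thesis
  proof cases
    case 1
    have "((\<lambda>y::real. max 0 y ^ (Suc (Suc n))) has_real_derivative of_nat (Suc (Suc n)) * x ^ Suc n) (at x)"
    proof (rule has_field_derivative_transform_within_open[where S="{0<..}" and f="\<lambda>y. y ^ Suc (Suc n)"])
      show "((\<lambda>y::real. y ^ (Suc (Suc n))) has_real_derivative of_nat (Suc (Suc n)) * x ^ Suc n) (at x)"
        using DERIV_pow[of "Suc (Suc n)" x UNIV] by simp
    qed (use 1 in \<open>auto simp: max_def\<close>)
    then show ?thesis using 1 by (simp add: max_def)
  next
    case 2
    have "((\<lambda>y::real. max 0 y ^ (Suc (Suc n))) has_real_derivative 0) (at x)"
    proof (rule has_field_derivative_transform_within_open[where S="{..<0}" and f="\<lambda>_. 0"])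
      fix y :: real assume "y \<in> {..<0}"
      then have "max 0 y = 0" by simp
      then show "0 = max 0 y ^ (Suc (Suc n))" by (simp only: power_0_Suc)
    qed (use 2 in auto)
    then show ?thesis using 2 by (simp add: max_def)
  next
    case 3
    have "(\<lambda>h::real. max 0 h ^ Suc n) \<midarrow>0\<rightarrow> max 0 0 ^ Suc n"
      by (intro tendsto_intros)
    moreover have "max 0 h ^ Suc n = max 0 h ^ Suc (Suc n) / h" if "h \<noteq> 0" for h :: real
      using that by (cases "h < 0") (auto simp: max_def)
    then have "\<forall>\<^sub>F h::real in at 0. max 0 h ^ Suc n = max 0 h ^ Suc (Suc n) / h"
      by (simp only: eventually_at_filter) auto
    ultimately have *: "(\<lambda>h::real. max 0 h ^ Suc (Suc n) / h) \<midarrow>0\<rightarrow> 0"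
      unfolding max.idem power_0_Suc by (rule Lim_transform_eventually)
    have "(max 0 (0 + h) ^ Suc (Suc n) - max 0 0 ^ Suc (Suc n)) / h = max 0 h ^ Suc (Suc n) / h" for h :: real
      unfolding max.idem power_0_Suc by simp
    then show ?thesis
      using * unfolding 3 DERIV_def max.idem power_0_Suc mult_zero_right by (simp only:)
  qed
qed

text \<open>Each differentiation lowers the exponent by one and the last derivative must still be
  continuous, hence the bound \<open>n < m\<close>.\<close>

lemma Ck_max_power:
  assumes "\<And>n. Ck n f"
  shows "n < m \<Longrightarrow> Ck n (\<lambda>x. max 0 (f x) ^ m)"
proof (induction n arbitrary: m)
  case 0
  have "continuous_on UNIV f" using assms[of 0] by simp
  then show ?case by (simp add: continuous_on_power continuous_on_max continuous_on_const)
next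
  case (Suc n)
  define k where "k = m - 2"
  have k: "m = Suc (Suc k)" "n < Suc k" using Suc.prems unfolding k_def by arith+
  from has_derivative_compose[OF Ck_deriv[OF assms] max_power_deriv[unfolded has_field_derivative_def]]
  show ?case unfolding k
    by (rule Ck_SucI) (intro Ck_mult Ck_const Suc.IH[OF k(2)] Ck_fd assms)
qed

lemma bounded_linear_sum_Basis:
  fixes F :: "'a::euclidean_space \<Rightarrow> real"
  assumes "bounded_linear F"
  shows "Blinfun F = (\<Sum>i\<in>Basis. F i *\<^sub>R blinfun_inner_left i)"
  by (rule blinfun_euclidean_eqI)
     (auto simp: bounded_linear_Blinfun_apply assms blinfun.sum_left blinfun.scaleR_left
       inner_Basis if_distrib cong: if_cong)

text \<open>The operator-valued derivatives \<open>D\<close> and \<open>D2\<close> are assembled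
  from their finitely many coordinates on \<open>Basis\<close>; their differentiability and
  continuity can then be checked coordinatewise.\<close>

lemma Ck_imp_C2_on:
  fixes f :: "'a::euclidean_space \<Rightarrow> real"
  assumes "Ck 2 f"
  shows "C2_on UNIV f"
proof -
  have f: "Ck (Suc 1) f" using assms by (simp add: numeral_2_eq_2)
  define F where "F = fd f"
  define H where "H h = fd (\<lambda>x. F x h)" for h
  have F: "(f has_derivative F x) (at x)" for x
    unfolding F_def by (rule Ck_deriv[OF f])
  have F1: "Ck (Suc 0) (\<lambda>x. F x h)" for h
    unfolding F_def using Ck_fd[OF f] by simp
  have H: "((\<lambda>x. F x h) has_derivative H h x) (at x)" for h x
    unfolding H_def by (rule Ck_deriv[OF F1])
  have Hc: "continuous_on UNIV (\<lambda>x. H h x k)" for h k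
    unfolding H_def using Ck_fd[OF F1] by simp
  have bF: "bounded_linear (F x)" for x by (rule has_derivative_bounded_linear[OF F])
  have bH: "bounded_linear (H h x)" for h x by (rule has_derivative_bounded_linear[OF H])
  define D where "D x = Blinfun (F x)" for x
  define D2 where "D2 x = (\<Sum>i\<in>Basis. (blinfun_scaleR_left (blinfun_inner_left i :: 'a \<Rightarrow>\<^sub>L real)) o\<^sub>L Blinfun (H i x))" for x
  have De: "D x = (\<Sum>i\<in>Basis. F x i *\<^sub>R blinfun_inner_left i)" for x
    unfolding D_def using bounded_linear_sum_Basis[OF bF] .
  show ?thesis unfolding C2_on_def
  proof (intro exI[of _ D] exI[of _ D2] conjI ballI)
    fix x
    show "(f has_derivative blinfun_apply (D x)) (at x)"
      using F bF by (simp add: D_def bounded_linear_Blinfun_apply)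
    have "((\<lambda>x. \<Sum>i\<in>Basis. F x i *\<^sub>R (blinfun_inner_left i :: 'a \<Rightarrow>\<^sub>L real)) has_derivative
            (\<lambda>h. \<Sum>i\<in>Basis. H i x h *\<^sub>R blinfun_inner_left i)) (at x)"
      by (intro has_derivative_sum has_derivative_scaleR_left H)
    moreover have "(\<lambda>h. \<Sum>i\<in>Basis. H i x h *\<^sub>R (blinfun_inner_left i :: 'a \<Rightarrow>\<^sub>L real)) = blinfun_apply (D2 x)"
      by (rule ext) (simp add: D2_def blinfun.sum_left bounded_linear_Blinfun_apply bH)
    ultimately show "(D has_derivative blinfun_apply (D2 x)) (at x)"
      unfolding De[abs_def] by simp
  next
    have "continuous_on UNIV (\<lambda>x. blinfun_apply (Blinfun (H i x)) j)" for i j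
      using Hc by (simp add: bounded_linear_Blinfun_apply bH)
    then have "continuous_on UNIV (\<lambda>x. Blinfun (H i x))" for i
      by (intro continuous_on_blinfun_componentwise) auto
    then show "continuous_on UNIV D2" unfolding D2_def by (intro continuous_intros) auto
  qed
qed

lemmas Ck_intros = Ck_const Ck_add Ck_diff Ck_minus Ck_mult Ck_power Ck_exp

section \<open>Horizontal derivatives along flows\<close>

lemma hmul_eq: "p \<cdot>\<^sub>H q = (fst p + fst q, fst (snd p) + fst (snd q),
    snd (snd p) + snd (snd q) + (fst p * fst (snd q) - fst q * fst (snd p)) / 2)"
  by (cases p; cases q) auto

lemma hinv_eq: "hinv p = - p"
  by (cases p) auto

lemma hmul_assoc: "p \<cdot>\<^sub>H q \<cdot>\<^sub>H r = p \<cdot>\<^sub>H (q \<cdot>\<^sub>H r)"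
  by (simp add: hmul_eq field_simps)

lemma hmul_zero [simp]: "p \<cdot>\<^sub>H 0 = p" "p \<cdot>\<^sub>H (0, 0, 0) = p"
  by (simp_all add: hmul_eq)

lemma continuous_on_hmul [continuous_intros]:
  assumes "continuous_on S f" "continuous_on S g"
  shows "continuous_on S (\<lambda>x. f x \<cdot>\<^sub>H g x)"
  unfolding hmul_eq by (intro continuous_intros assms) simp

lemma continuous_on_hinv [continuous_intros]:
  "continuous_on S f \<Longrightarrow> continuous_on S (\<lambda>x. hinv (f x))"
  unfolding hinv_eq by (rule continuous_on_minus)

text \<open>The one-parameter subgroup in the horizontal direction \<open>v\<close>. Right
  multiplication by it is the flow of the left-invariant field with coefficients \<open>v\<close>,
  and in coordinates it runs along a straight line (\<open>hmul_flow\<close>), which reduces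
  horizontal calculus to functions of one variable.\<close>

definition flow :: "real \<times> real \<Rightarrow> real \<Rightarrow> heis" where
  "flow v a = (a * fst v, a * snd v, 0)"

definition DX :: "real \<times> real \<Rightarrow> (heis \<Rightarrow> real) \<Rightarrow> heis \<Rightarrow> real" where
  "DX v g p = fst v * X1 g p + snd v * X2 g p"

lemma flow_0 [simp]: "flow v 0 = 0"
  by (simp add: flow_def zero_prod_def)

lemma hmul_flow: "p \<cdot>\<^sub>H flow v a =
   p + a *\<^sub>R (fst v, snd v, (fst p * snd v - fst (snd p) * fst v) / 2)"
  by (cases p) (simp add: hmul_eq flow_def field_simps)

lemma deriv_along_line:
  fixes g :: "'a::real_normed_vector \<Rightarrow> real"
  assumes "(g has_derivative F) (at (c + a *\<^sub>R w))"
  shows "((\<lambda>s. g (c + s *\<^sub>R w)) has_real_derivative F w) (at a)"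
proof -
  have "((\<lambda>s. c + s *\<^sub>R w) has_derivative (\<lambda>h. h *\<^sub>R w)) (at a)"
    by (auto intro!: derivative_eq_intros)
  from has_derivative_compose[OF this assms]
  have *: "((\<lambda>s. g (c + s *\<^sub>R w)) has_derivative (\<lambda>h. F (h *\<^sub>R w))) (at a)" .
  have "linear F" using assms has_derivative_linear by blast
  then have "(\<lambda>h. F (h *\<^sub>R w)) = (*) (F w)" by (auto simp: linear_cmul)
  with * show ?thesis unfolding has_field_derivative_def by simp
qed

lemma linear_coords:
  fixes F :: "real \<times> real \<times> real \<Rightarrow> real"
  assumes "linear F"
  shows "F (a, b, c) = a * F (1, 0, 0) + b * F (0, 1, 0) + c * F (0, 0, 1)"
proof -
  have "(a, b, c) = a *\<^sub>R (1, 0, 0) + b *\<^sub>R (0, 1, 0) + c *\<^sub>R (0, 0, 1 :: real)" by simp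
  then have "F (a, b, c) = F (a *\<^sub>R (1, 0, 0) + b *\<^sub>R (0, 1, 0) + c *\<^sub>R (0, 0, 1))" by simp
  then show ?thesis by (simp only: linear_add[OF assms] linear_cmul[OF assms] real_scaleR_def)
qed

lemma X_fd:
  assumes "(g has_derivative F) (at p)"
  shows "X1 g p = F (1, 0, - fst (snd p) / 2)" "X2 g p = F (0, 1, fst p / 2)"
proof -
  obtain x y z where p: "p = (x, y, z)" by (cases p) auto
  have lin: "linear F" using assms has_derivative_linear by blast
  have "((\<lambda>s. g ((0, y, z) + s *\<^sub>R (1, 0, 0))) has_real_derivative F (1, 0, 0)) (at x)"
    by (rule deriv_along_line) (use assms p in simp)
  then have 1: "deriv (\<lambda>s. g (s, y, z)) x = F (1, 0, 0)" by (simp add: DERIV_imp_deriv)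
  have "((\<lambda>s. g ((x, 0, z) + s *\<^sub>R (0, 1, 0))) has_real_derivative F (0, 1, 0)) (at y)"
    by (rule deriv_along_line) (use assms p in simp)
  then have 2: "deriv (\<lambda>s. g (x, s, z)) y = F (0, 1, 0)" by (simp add: DERIV_imp_deriv)
  have "((\<lambda>s. g ((x, y, 0) + s *\<^sub>R (0, 0, 1))) has_real_derivative F (0, 0, 1)) (at z)"
    by (rule deriv_along_line) (use assms p in simp)
  then have 3: "deriv (\<lambda>s. g (x, y, s)) z = F (0, 0, 1)" by (simp add: DERIV_imp_deriv)
  have "F (1, 0, - y / 2) = F (1, 0, 0) + (- y / 2) * F (0, 0, 1)"
      "F (0, 1, x / 2) = F (0, 1, 0) + (x / 2) * F (0, 0, 1)"
    using linear_coords[OF lin, of 1 0 "- y / 2"] linear_coords[OF lin, of 0 1 "x / 2"] by simp_all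
  then show "X1 g p = F (1, 0, - fst (snd p) / 2)" "X2 g p = F (0, 1, fst p / 2)"
    unfolding p by (simp_all add: 1 2 3)
qed

lemma DX_fd:
  assumes "(g has_derivative F) (at p)"
  shows "DX v g p = F (fst v, snd v, (fst p * snd v - fst (snd p) * fst v) / 2)"
proof -
  have lin: "linear F" using assms has_derivative_linear by blast
  have "(fst v, snd v, (fst p * snd v - fst (snd p) * fst v) / 2) =
      fst v *\<^sub>R (1, 0, - fst (snd p) / 2) + snd v *\<^sub>R (0, 1, fst p / 2)"
    by (simp add: field_simps)
  then show ?thesis
    unfolding DX_def X_fd[OF assms] using lin by (simp only: linear_add linear_cmul real_scaleR_def)
qed

lemma DX_flow:
  assumes "Ck (Suc n) g"
  shows "((\<lambda>a. g (p \<cdot>\<^sub>H flow v a)) has_real_derivative DX v g (p \<cdot>\<^sub>H flow v a)) (at a)"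
proof -
  let ?w = "(fst v, snd v, (fst p * snd v - fst (snd p) * fst v) / 2)"
  have "((\<lambda>a. g (p + a *\<^sub>R ?w)) has_real_derivative fd g (p + a *\<^sub>R ?w) ?w) (at a)"
    by (rule deriv_along_line[OF Ck_deriv[OF assms]])
  moreover have "DX v g (p + a *\<^sub>R ?w) = fd g (p + a *\<^sub>R ?w) ?w"
    unfolding DX_fd[OF Ck_deriv[OF assms]] by (simp add: field_simps)
  ultimately show ?thesis unfolding hmul_flow by simp
qed

lemma DX_eqI:
  assumes "Ck (Suc n) g" "((\<lambda>a. g (p \<cdot>\<^sub>H flow v a)) has_real_derivative d) (at 0)"
  shows "DX v g p = d"
  using DERIV_unique[OF assms(2) DX_flow[OF assms(1)]] by simp

lemma DX_flow0:
  assumes "Ck (Suc n) g"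
  shows "((\<lambda>a. g (p \<cdot>\<^sub>H flow v a)) has_real_derivative DX v g p) (at 0)"
  using DX_flow[OF assms, of p v 0] by simp

lemma bounded_linear_coords:
  "bounded_linear (\<lambda>p::heis. fst (snd p))" "bounded_linear (\<lambda>p::heis. snd (snd p))"
  "bounded_linear (\<lambda>p::heis. fst p)"
  by (auto intro: bounded_linear_compose[OF bounded_linear_fst bounded_linear_snd]
    bounded_linear_compose[OF bounded_linear_snd bounded_linear_snd] bounded_linear_fst)

lemmas Ck_coords = bounded_linear_coords[THEN Ck_linear]

lemma Ck_X:
  assumes "Ck (Suc n) g"
  shows "Ck n (X1 g)" "Ck n (X2 g)"
proof -
  have lin: "linear (fd g p)" for p
    using Ck_deriv[OF assms] has_derivative_linear by blast
  have 1: "X1 g = (\<lambda>p. fd g p (1, 0, 0) + (- (1/2)) * fst (snd p) * fd g p (0, 0, 1))"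
  proof
    fix p
    show "X1 g p = fd g p (1, 0, 0) + (- (1/2)) * fst (snd p) * fd g p (0, 0, 1)"
      unfolding X_fd[OF Ck_deriv[OF assms]]
      using linear_coords[OF lin, of p 1 0 "- fst (snd p) / 2"] by simp
  qed
  have 2: "X2 g = (\<lambda>p. fd g p (0, 1, 0) + (1/2) * fst p * fd g p (0, 0, 1))"
  proof
    fix p :: heis
    show "X2 g p = fd g p (0, 1, 0) + (1/2) * fst p * fd g p (0, 0, 1)"
      unfolding X_fd[OF Ck_deriv[OF assms]]
      using linear_coords[OF lin, of p 0 1 "fst p / 2"] by simp
  qed
  show "Ck n (X1 g)" "Ck n (X2 g)" unfolding 1 2
    by (intro Ck_intros Ck_coords Ck_fd assms)+
qed

lemma Ck_DX:
  assumes "Ck (Suc n) g"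
  shows "Ck n (DX v g)"
  unfolding DX_def[abs_def] by (intro Ck_intros Ck_X assms)

lemma X_linear:
  assumes "Ck (Suc n) g" "Ck (Suc m) h"
  shows "X1 (\<lambda>p. c * g p + d * h p) p = c * X1 g p + d * X1 h p"
    "X2 (\<lambda>p. c * g p + d * h p) p = c * X2 g p + d * X2 h p"
proof -
  have "((\<lambda>p. c * g p + d * h p) has_derivative (\<lambda>k. c * fd g p k + d * fd h p k)) (at p)"
    by (intro has_derivative_add has_derivative_mult_right Ck_deriv[OF assms(1)] Ck_deriv[OF assms(2)])
  from X_fd[OF this] X_fd[OF Ck_deriv[OF assms(1)]] X_fd[OF Ck_deriv[OF assms(2)]]
  show "X1 (\<lambda>p. c * g p + d * h p) p = c * X1 g p + d * X1 h p"
    "X2 (\<lambda>p. c * g p + d * h p) p = c * X2 g p + d * X2 h p" by simp_all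
qed

lemma DX_linear:
  assumes "Ck (Suc n) g" "Ck (Suc m) h"
  shows "DX v (\<lambda>p. c * g p + d * h p) p = c * DX v g p + d * DX v h p"
  unfolding DX_def X_linear[OF assms] by (simp add: algebra_simps)

text \<open>The mixed derivatives enter only through their sum, so second derivatives along
  horizontal directions see precisely the symmetrized Hessian.\<close>

lemma DX_DX:
  assumes "Ck (Suc (Suc n)) g"
  shows "DX v (DX v g) p = (fst v)\<^sup>2 * X1 (X1 g) p + fst v * snd v * (X1 (X2 g) p + X2 (X1 g) p)
     + (snd v)\<^sup>2 * X2 (X2 g) p"
proof -
  note X = Ck_X[OF assms]
  have "DX v (DX v g) p = fst v * X1 (\<lambda>p. fst v * X1 g p + snd v * X2 g p) p
      + snd v * X2 (\<lambda>p. fst v * X1 g p + snd v * X2 g p) p"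
    by (simp add: DX_def[abs_def])
  then show ?thesis
    unfolding X_linear[OF X] by (simp add: algebra_simps power2_eq_square)
qed

lemma Ck_DX_iter:
  assumes "Ck (n + m) g"
  shows "Ck n ((DX v ^^ m) g)"
  using assms
proof (induction m arbitrary: n)
  case (Suc m)
  then have "Ck (Suc n + m) g" by simp
  from Ck_DX[OF Suc.IH[OF this]] show ?case by simp
qed simp

text \<open>Maclaurin expansion along the flow: by \<open>DX_flow\<close>, differentiating in the
  flow parameter is taking a horizontal derivative at the moved point.\<close>

lemma flow_taylor:
  assumes "Ck n g" "n > 0"
  obtains t where "\<bar>t\<bar> \<le> \<bar>a\<bar>"
    "g (p \<cdot>\<^sub>H flow v a) = (\<Sum>m<n. (DX v ^^ m) g p / fact m * a ^ m)
       + (DX v ^^ n) g (p \<cdot>\<^sub>H flow v t) / fact n * a ^ n"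
proof -
  let ?d = "\<lambda>m a. (DX v ^^ m) g (p \<cdot>\<^sub>H flow v a)"
  have "\<forall>m t. m < n \<and> \<bar>t\<bar> \<le> \<bar>a\<bar> \<longrightarrow> DERIV (?d m) t :> ?d (Suc m) t"
  proof (intro allI impI)
    fix m t assume mt: "m < n \<and> \<bar>t\<bar> \<le> \<bar>a\<bar>"
    have "Ck (Suc (n - Suc m)) ((DX v ^^ m) g)"
      by (rule Ck_DX_iter) (use mt assms in simp)
    from DX_flow[OF this] show "DERIV (?d m) t :> ?d (Suc m) t" by simp
  qed
  from Maclaurin_bi_le[OF _ this, of "\<lambda>a. g (p \<cdot>\<^sub>H flow v a)"] that show ?thesis by auto
qed

section \<open>Gauge and barrier\<close>

lemma power2_le_of_abs_le: "\<bar>a\<bar> \<le> b \<Longrightarrow> a\<^sup>2 \<le> b\<^sup>2" for a b :: real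
  using power_mono[of "\<bar>a\<bar>" b 2] by simp

lemma DX_chain:
  assumes "Ck (Suc n) g" "Ck (Suc m) (\<lambda>p. \<phi> (g p))" "(\<phi> has_real_derivative d) (at (g p))"
  shows "DX v (\<lambda>p. \<phi> (g p)) p = d * DX v g p"
proof (rule DX_eqI[OF assms(2)])
  have "(\<phi> has_real_derivative d) (at (g (p \<cdot>\<^sub>H flow v 0)))" using assms(3) by simp
  from DERIV_chain2[OF this DX_flow0[OF assms(1)]]
  show "((\<lambda>a. \<phi> (g (p \<cdot>\<^sub>H flow v a))) has_real_derivative d * DX v g p) (at 0)" .
qed

lemma DX_mult:
  assumes "Ck (Suc n) g" "Ck (Suc n) h"
  shows "DX v (\<lambda>p. g p * h p) p = DX v g p * h p + DX v h p * g p"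
proof (rule DX_eqI)
  show "Ck (Suc n) (\<lambda>p. g p * h p)" by (intro Ck_mult assms)
  show "((\<lambda>a. g (p \<cdot>\<^sub>H flow v a) * h (p \<cdot>\<^sub>H flow v a)) has_real_derivative
      DX v g p * h p + DX v h p * g p) (at 0)"
    using DERIV_mult[OF DX_flow0[OF assms(1), of p v] DX_flow0[OF assms(2), of p v]] by simp
qed

text \<open>Unlike the expression under the root in \<^const>\<open>hgauge\<close>, this one has the symmetrized horizontal Hessian
  \<open>12 (x\<^sup>2 + y\<^sup>2) I\<close>.\<close>

definition quart :: "heis \<Rightarrow> real" where
  "quart p = 1 + ((fst p)\<^sup>2 + (fst (snd p))\<^sup>2)\<^sup>2 + 16 * (snd (snd p))\<^sup>2"

definition sgauge :: "heis \<Rightarrow> real" where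
  "sgauge p = quart p powr (1 / 4)"

text \<open>The weight of all error estimates. Horizontal derivatives and jumps of the random walk
  reproduce it up to a constant factor, and it outgrows every weight of smaller rate, so it also
  confines comparison arguments to bounded sets.\<close>

definition barrier :: "real \<Rightarrow> heis \<Rightarrow> real" where
  "barrier k p = exp (k * sgauge p)"

lemma quart_ge_1: "quart p \<ge> 1"
  by (simp add: quart_def)

lemma quart_pos: "quart p > 0"
  using quart_ge_1[of p] by simp

lemma sgauge_ge_1: "sgauge p \<ge> 1"
  unfolding sgauge_def using quart_ge_1[of p] by (simp add: ge_one_powr_ge_zero)

lemma sgauge_pow4: "sgauge p ^ 4 = quart p"
proof -
  have "sgauge p ^ 4 = sgauge p powr 4"
    using sgauge_ge_1[of p] powr_realpow[of "sgauge p" 4] by simp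
  then show ?thesis using quart_pos[of p] by (simp add: sgauge_def powr_powr)
qed

lemma Ck_quart: "Ck n quart"
  unfolding quart_def[abs_def] by (intro Ck_intros Ck_coords)

lemma Ck_sgauge: "Ck n sgauge"
  unfolding sgauge_def[abs_def] by (intro Ck_powr Ck_quart quart_pos)

lemma Ck_barrier: "Ck n (barrier k)"
  unfolding barrier_def[abs_def] by (intro Ck_intros Ck_sgauge)

lemma sgauge_bounds:
  "(fst p)\<^sup>2 + (fst (snd p))\<^sup>2 \<le> (sgauge p)\<^sup>2"
  "\<bar>fst p\<bar> \<le> sgauge p" "\<bar>fst (snd p)\<bar> \<le> sgauge p" "\<bar>snd (snd p)\<bar> \<le> (sgauge p)\<^sup>2"
proof -
  have 4: "((sgauge p)\<^sup>2)\<^sup>2 = quart p"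
    using sgauge_pow4[of p] by (simp flip: power_mult)
  have "((fst p)\<^sup>2 + (fst (snd p))\<^sup>2)\<^sup>2 \<le> ((sgauge p)\<^sup>2)\<^sup>2"
    unfolding 4 by (simp add: quart_def)
  then show 1: "(fst p)\<^sup>2 + (fst (snd p))\<^sup>2 \<le> (sgauge p)\<^sup>2"
    by (rule power2_le_imp_le) simp
  have "(fst p)\<^sup>2 \<le> (sgauge p)\<^sup>2" "(fst (snd p))\<^sup>2 \<le> (sgauge p)\<^sup>2"
    using 1 zero_le_power2[of "fst p"] zero_le_power2[of "fst (snd p)"] by linarith+
  then have "\<bar>fst p\<bar> \<le> \<bar>sgauge p\<bar>" "\<bar>fst (snd p)\<bar> \<le> \<bar>sgauge p\<bar>"
    by (simp_all only: abs_le_square_iff)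
  then show "\<bar>fst p\<bar> \<le> sgauge p" "\<bar>fst (snd p)\<bar> \<le> sgauge p"
    using sgauge_ge_1[of p] by simp_all
  have "(snd (snd p))\<^sup>2 \<le> 1 + 16 * (snd (snd p))\<^sup>2" by simp
  also have "\<dots> \<le> ((sgauge p)\<^sup>2)\<^sup>2" unfolding 4 by (simp add: quart_def)
  finally have "\<bar>snd (snd p)\<bar>\<^sup>2 \<le> ((sgauge p)\<^sup>2)\<^sup>2" by simp
  then show "\<bar>snd (snd p)\<bar> \<le> (sgauge p)\<^sup>2" by (rule power2_le_imp_le) simp
qed

text \<open>Transfers the growth condition to the modified gauge; the point is that x^4 + y^4 <=
  (x^2 + y^2)^2.\<close>

lemma hgauge_le_sgauge: "hgauge p \<le> sgauge p"
proof -
  obtain x y z where p: "p = (x, y, z)" by (cases p) auto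
  have "x ^ 4 + y ^ 4 \<le> (x\<^sup>2 + y\<^sup>2)\<^sup>2"
    by (simp add: power2_sum flip: power_mult)
  then show ?thesis unfolding p sgauge_def quart_def
    by (simp, intro powr_mono2) (auto intro!: add_nonneg_nonneg)
qed

lemma DX_quart: "DX v quart p =
   4 * (fst v * (fst p * ((fst p)\<^sup>2 + (fst (snd p))\<^sup>2) - 4 * fst (snd p) * snd (snd p))
      + snd v * (fst (snd p) * ((fst p)\<^sup>2 + (fst (snd p))\<^sup>2) + 4 * fst p * snd (snd p)))"
proof (rule DX_eqI[OF Ck_quart])
  obtain x y z where p: "p = (x, y, z)" by (cases p) auto
  obtain a b where v: "v = (a, b)" by (cases v) auto
  show "((\<lambda>s. quart (p \<cdot>\<^sub>H flow v s)) has_real_derivative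
   4 * (fst v * (fst p * ((fst p)\<^sup>2 + (fst (snd p))\<^sup>2) - 4 * fst (snd p) * snd (snd p))
      + snd v * (fst (snd p) * ((fst p)\<^sup>2 + (fst (snd p))\<^sup>2) + 4 * fst p * snd (snd p)))) (at 0)"
    unfolding p v quart_def flow_def hmul.simps fst_conv snd_conv power2_eq_square
    by (auto intro!: derivative_eq_intros simp: field_simps)
qed

lemma DX_DX_quart: "DX v (DX v quart) p = 12 * (norm v)\<^sup>2 * ((fst p)\<^sup>2 + (fst (snd p))\<^sup>2)"
proof (rule DX_eqI[OF Ck_DX[OF Ck_quart]])
  obtain x y z where p: "p = (x, y, z)" by (cases p) auto
  obtain a b where v: "v = (a, b)" by (cases v) auto
  show "((\<lambda>s. DX v quart (p \<cdot>\<^sub>H flow v s)) has_real_derivative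
     12 * (norm v)\<^sup>2 * ((fst p)\<^sup>2 + (fst (snd p))\<^sup>2)) (at 0)"
    unfolding p v DX_quart flow_def hmul.simps fst_conv snd_conv norm_prod_def power2_eq_square
    by (auto intro!: derivative_eq_intros simp: field_simps)
qed

lemma DX_quart_le: "\<bar>DX v quart p\<bar> \<le> 4 * norm v * sgauge p ^ 3"
proof -
  obtain x y z where p: "p = (x, y, z)" by (cases p) auto
  obtain a b where v: "v = (a, b)" by (cases v) auto
  define r where "r = x\<^sup>2 + y\<^sup>2"
  define A where "A = x * r - 4 * y * z"
  define B where "B = y * r + 4 * x * z"
  \<comment> \<open>The pair \<open>4 * A\<close>, \<open>4 * B\<close> is the horizontal gradient
    of \<open>quart\<close>. Its squared length is 16 r (\<open>quart p\<close> - 1), hence at most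
    16 times the sixth power of \<open>sgauge p\<close>.\<close>
  have AB: "A\<^sup>2 + B\<^sup>2 = r * (r\<^sup>2 + 16 * z\<^sup>2)"
    unfolding A_def B_def r_def by (simp add: power2_eq_square algebra_simps)
  have "r \<ge> 0" unfolding r_def by simp
  have r: "r \<le> (sgauge p)\<^sup>2" using sgauge_bounds(1)[of p] by (simp add: p r_def)
  have r4: "r\<^sup>2 + 16 * z\<^sup>2 \<le> sgauge p ^ 4" unfolding sgauge_pow4 by (simp add: p quart_def r_def)
  have "(a * A + b * B)\<^sup>2 \<le> (a\<^sup>2 + b\<^sup>2) * (A\<^sup>2 + B\<^sup>2)"
    using zero_le_power2[of "a * B - b * A"] by (simp add: power2_eq_square algebra_simps)
  also have "\<dots> \<le> (a\<^sup>2 + b\<^sup>2) * ((sgauge p)\<^sup>2 * sgauge p ^ 4)"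
    unfolding AB using r r4 \<open>r \<ge> 0\<close> by (intro mult_left_mono mult_mono) auto
  also have "\<dots> = (norm v * sgauge p ^ 3)\<^sup>2"
    unfolding v by (simp add: norm_prod_def power_mult_distrib flip: power_mult power_add)
  finally have "\<bar>a * A + b * B\<bar>\<^sup>2 \<le> (norm v * sgauge p ^ 3)\<^sup>2" by (simp only: power2_abs)
  then have "\<bar>a * A + b * B\<bar> \<le> norm v * sgauge p ^ 3"
    by (rule power2_le_imp_le) (use sgauge_ge_1[of p] in simp)
  moreover have "DX v quart p = 4 * (a * A + b * B)"
    unfolding DX_quart by (simp add: p v A_def B_def r_def)
  ultimately show ?thesis by (simp add: abs_mult)
qed

lemma sgauge_powr: "quart p powr (- (real n / 4)) = 1 / sgauge p ^ n"
proof -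
  have "sgauge p ^ n = sgauge p powr real n"
    using sgauge_ge_1[of p] by (intro powr_realpow[symmetric]) simp
  then have "sgauge p ^ n = quart p powr (real n / 4)"
    by (simp add: sgauge_def powr_powr)
  then show ?thesis by (simp add: powr_minus_divide)
qed

lemma DX_sgauge: "DX v sgauge p = 1/4 * quart p powr (- 3/4) * DX v quart p"
proof -
  have "((\<lambda>y. y powr (1/4)) has_real_derivative 1/4 * quart p powr (- 3/4)) (at (quart p))"
    using has_real_derivative_powr[OF quart_pos[of p], where r="1/4"] by simp
  from DX_chain[where n=0 and m=0 and v=v, OF Ck_quart _ this] show ?thesis
    using Ck_sgauge[of 1] by (simp add: sgauge_def[abs_def])
qed

text \<open>The exponent 1/4 exactly balances the cubic growth in \<open>DX_quart_le\<close>. As a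
  consequence the gauge grows at most linearly along horizontal flows
  (\<open>sgauge_flow\<close>).\<close>

lemma DX_sgauge_le: "\<bar>DX v sgauge p\<bar> \<le> norm v"
proof -
  have "\<bar>DX v sgauge p\<bar> = 1/4 * (1 / sgauge p ^ 3) * \<bar>DX v quart p\<bar>"
    unfolding DX_sgauge using sgauge_powr[of p 3] sgauge_ge_1[of p] by (simp add: abs_mult)
  also have "\<dots> \<le> 1/4 * (1 / sgauge p ^ 3) * (4 * norm v * sgauge p ^ 3)"
    using sgauge_ge_1[of p] by (intro mult_left_mono DX_quart_le) auto
  also have "\<dots> = norm v" using sgauge_ge_1[of p] by simp
  finally show ?thesis .
qed

text \<open>The chain and product rules leave two terms, each at most three times the square of
  \<open>norm v\<close>: the constants are 3/16 * 4^2 from the squared first derivative of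
  \<open>quart\<close> and 12/4 from its second derivative.\<close>

lemma DX_DX_sgauge_le: "\<bar>DX v (DX v sgauge) p\<bar> \<le> 6 * (norm v)\<^sup>2"
proof -
  let ?s = "sgauge p"
  have s1: "?s \<ge> 1" by (rule sgauge_ge_1)
  have "((\<lambda>y. 1/4 * y powr (- 3/4)) has_real_derivative 1/4 * (- 3/4 * quart p powr (- 7/4))) (at (quart p))"
    using has_real_derivative_powr[OF quart_pos[of p], where r="- 3/4"] by (intro DERIV_cmult) simp
  from DX_chain[where n=0 and m=0 and v=v, OF Ck_quart _ this]
  have 1: "DX v (\<lambda>p. 1/4 * quart p powr (- 3/4)) p = - 3/16 * quart p powr (- 7/4) * DX v quart p"
    using Ck_cmult[OF Ck_powr[OF Ck_quart quart_pos], of "Suc 0" "1/4" "-3/4"] by simp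
  have "DX v (DX v sgauge) p =
      DX v (\<lambda>p. 1/4 * quart p powr (- 3/4)) p * DX v quart p + DX v (DX v quart) p * (1/4 * quart p powr (- 3/4))"
    unfolding DX_sgauge[abs_def]
    by (rule DX_mult) (intro Ck_cmult Ck_powr Ck_quart quart_pos Ck_DX)+
  also have "\<dots> = - 3/16 * (1 / ?s ^ 7) * (DX v quart p)\<^sup>2
       + 3 * (norm v)\<^sup>2 * ((fst p)\<^sup>2 + (fst (snd p))\<^sup>2) * (1 / ?s ^ 3)"
    unfolding 1 DX_DX_quart using sgauge_powr[of p 7] sgauge_powr[of p 3]
    by (simp add: power2_eq_square)
  finally have eq: "DX v (DX v sgauge) p = - 3/16 * (1 / ?s ^ 7) * (DX v quart p)\<^sup>2
       + 3 * (norm v)\<^sup>2 * ((fst p)\<^sup>2 + (fst (snd p))\<^sup>2) * (1 / ?s ^ 3)" .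
  have "(DX v quart p)\<^sup>2 \<le> (4 * norm v * ?s ^ 3)\<^sup>2"
    by (rule power2_le_of_abs_le[OF DX_quart_le])
  then have "3/16 * (1 / ?s ^ 7) * (DX v quart p)\<^sup>2 \<le> 3/16 * (1 / ?s ^ 7) * (4 * norm v * ?s ^ 3)\<^sup>2"
    using s1 by (intro mult_left_mono) auto
  also have "\<dots> = 3 * (norm v)\<^sup>2 / ?s"
    using s1 by (simp add: power_mult_distrib field_simps eval_nat_numeral)
  also have "\<dots> \<le> 3 * (norm v)\<^sup>2 / 1" using s1 by (intro divide_left_mono) auto
  finally have a: "3/16 * (1 / ?s ^ 7) * (DX v quart p)\<^sup>2 \<le> 3 * (norm v)\<^sup>2" by simp
  have "3 * (norm v)\<^sup>2 * ((fst p)\<^sup>2 + (fst (snd p))\<^sup>2) * (1 / ?s ^ 3) \<le> 3 * (norm v)\<^sup>2 * ?s\<^sup>2 * (1 / ?s ^ 3)"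
    using s1 by (intro mult_right_mono mult_left_mono sgauge_bounds) auto
  also have "\<dots> = 3 * (norm v)\<^sup>2 / ?s" using s1 by (simp add: field_simps eval_nat_numeral)
  also have "\<dots> \<le> 3 * (norm v)\<^sup>2 / 1" using s1 by (intro divide_left_mono) auto
  finally have b: "3 * (norm v)\<^sup>2 * ((fst p)\<^sup>2 + (fst (snd p))\<^sup>2) * (1 / ?s ^ 3) \<le> 3 * (norm v)\<^sup>2" by simp
  have c: "0 \<le> 3/16 * (1 / ?s ^ 7) * (DX v quart p)\<^sup>2"
     "0 \<le> 3 * (norm v)\<^sup>2 * ((fst p)\<^sup>2 + (fst (snd p))\<^sup>2) * (1 / ?s ^ 3)"
    using s1 by auto
  show ?thesis unfolding eq using a b c by linarith
qed

lemma barrier_pos [simp]: "barrier k p > 0"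
  by (simp add: barrier_def)

lemma barrier_nonneg [simp]: "barrier k p \<ge> 0"
  by (simp add: barrier_def)

lemma DX_barrier: "DX v (barrier k) p = k * barrier k p * DX v sgauge p"
proof -
  have "((\<lambda>y. exp (k * y)) has_real_derivative k * exp (k * sgauge p)) (at (sgauge p))"
    by (auto intro!: derivative_eq_intros)
  from DX_chain[where n=0 and m=0 and v=v, OF Ck_sgauge _ this] show ?thesis
    using Ck_barrier[of 1 k] by (simp add: barrier_def[abs_def])
qed

lemma DX_barrier_le: "k \<ge> 0 \<Longrightarrow> \<bar>DX v (barrier k) p\<bar> \<le> k * norm v * barrier k p"
  using DX_sgauge_le[of v p] by (simp add: DX_barrier abs_mult mult_left_mono mult.commute mult.left_commute)

text \<open>The summand \<open>k\<^sup>2\<close> comes from differentiating the exponential twice,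
  \<open>6 * k\<close> from the second derivative of the gauge.\<close>

lemma DX_DX_barrier_le:
  assumes "k \<ge> 0"
  shows "\<bar>DX v (DX v (barrier k)) p\<bar> \<le> (k\<^sup>2 + 6 * k) * (norm v)\<^sup>2 * barrier k p"
proof -
  have "DX v (barrier k) = (\<lambda>p. k * barrier k p * DX v sgauge p)"
    by (rule ext) (rule DX_barrier)
  then have "DX v (DX v (barrier k)) p = DX v (\<lambda>p. k * barrier k p * DX v sgauge p) p"
    by (simp only:)
  also have "\<dots> = DX v (\<lambda>p. k * barrier k p) p * DX v sgauge p + DX v (DX v sgauge) p * (k * barrier k p)"
    by (rule DX_mult) (intro Ck_cmult Ck_barrier Ck_DX Ck_sgauge)+
  also have "DX v (\<lambda>p. k * barrier k p) p = k * DX v (barrier k) p"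
    using DX_linear[OF Ck_barrier Ck_barrier, where d=0] by simp
  also have "k * DX v (barrier k) p * DX v sgauge p + DX v (DX v sgauge) p * (k * barrier k p)
      = barrier k p * (k\<^sup>2 * (DX v sgauge p)\<^sup>2 + k * DX v (DX v sgauge) p)"
    unfolding DX_barrier by (simp add: power2_eq_square algebra_simps)
  finally have "DX v (DX v (barrier k)) p
      = barrier k p * (k\<^sup>2 * (DX v sgauge p)\<^sup>2 + k * DX v (DX v sgauge) p)" .
  moreover have "\<bar>k\<^sup>2 * (DX v sgauge p)\<^sup>2 + k * DX v (DX v sgauge) p\<bar>
      \<le> k\<^sup>2 * (norm v)\<^sup>2 + k * (6 * (norm v)\<^sup>2)"
  proof -
    have "(DX v sgauge p)\<^sup>2 \<le> (norm v)\<^sup>2"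
      by (rule power2_le_of_abs_le[OF DX_sgauge_le])
    then have "\<bar>k\<^sup>2 * (DX v sgauge p)\<^sup>2\<bar> \<le> k\<^sup>2 * (norm v)\<^sup>2"
      by (simp add: abs_mult mult_left_mono)
    moreover have "\<bar>k * DX v (DX v sgauge) p\<bar> \<le> k * (6 * (norm v)\<^sup>2)"
      using DX_DX_sgauge_le[of v p] assms by (simp add: abs_mult mult_left_mono)
    ultimately show ?thesis by linarith
  qed
  then have "barrier k p * \<bar>k\<^sup>2 * (DX v sgauge p)\<^sup>2 + k * DX v (DX v sgauge) p\<bar>
      \<le> barrier k p * (k\<^sup>2 * (norm v)\<^sup>2 + k * (6 * (norm v)\<^sup>2))"
    by (rule mult_left_mono) simp
  ultimately show ?thesis
    by (simp add: abs_mult) (simp add: algebra_simps)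
qed

lemma barrier_mono: "k \<le> l \<Longrightarrow> barrier k p \<le> barrier l p"
  using sgauge_ge_1[of p] by (simp add: barrier_def mult_right_mono)

lemma barrier_ge_1: "k \<ge> 0 \<Longrightarrow> barrier k p \<ge> 1"
  using sgauge_ge_1[of p] by (simp add: barrier_def)

lemma sgauge_flow: "sgauge (p \<cdot>\<^sub>H flow v a) \<le> sgauge p + \<bar>a\<bar> * norm v"
proof -
  obtain t where t: "\<bar>t\<bar> \<le> \<bar>a\<bar>"
    "sgauge (p \<cdot>\<^sub>H flow v a) = sgauge p + DX v sgauge (p \<cdot>\<^sub>H flow v t) * a"
    using flow_taylor[where n=1 and g=sgauge and p=p and v=v and a=a, OF Ck_sgauge] by auto
  have "DX v sgauge (p \<cdot>\<^sub>H flow v t) * a \<le> \<bar>DX v sgauge (p \<cdot>\<^sub>H flow v t)\<bar> * \<bar>a\<bar>"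
    by (metis abs_ge_self abs_mult)
  also have "\<dots> \<le> norm v * \<bar>a\<bar>" by (intro mult_right_mono DX_sgauge_le) simp
  finally show ?thesis using t(2) by (simp add: mult.commute)
qed

lemma barrier_flow:
  assumes "k \<ge> 0"
  shows "barrier k (p \<cdot>\<^sub>H flow v a) \<le> exp (k * \<bar>a\<bar> * norm v) * barrier k p"
proof -
  have "k * sgauge (p \<cdot>\<^sub>H flow v a) \<le> k * (sgauge p + \<bar>a\<bar> * norm v)"
    by (intro mult_left_mono sgauge_flow assms)
  then show ?thesis
    by (simp add: barrier_def flip: exp_add) (simp add: algebra_simps)
qed

text \<open>A left translation does not follow a horizontal flow, so \<open>DX_sgauge_le\<close>
  gives nothing here. Fourth powers are compared instead: as m >= 1, every coefficient that arises
  is at most 4^4 m^4. The factor multiplies the gauge, so left translations change the rate of a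
  barrier and not only its size.\<close>

lemma sgauge_translate:
  assumes m: "m \<ge> 1" "\<bar>fst h\<bar> \<le> m" "\<bar>fst (snd h)\<bar> \<le> m" "\<bar>snd (snd h)\<bar> \<le> m"
  shows "sgauge (h \<cdot>\<^sub>H p) \<le> 4 * m * sgauge p"
proof -
  obtain x y z where p: "p = (x, y, z)" by (cases p) auto
  obtain a b c where h: "h = (a, b, c)" by (cases h) auto
  have abc: "a\<^sup>2 \<le> m\<^sup>2" "b\<^sup>2 \<le> m\<^sup>2" "c\<^sup>2 \<le> m\<^sup>2"
    using m h by (auto simp: abs_le_square_iff[symmetric])
  have m2: "1 \<le> m\<^sup>2" using m by simp
  then have m4: "m\<^sup>2 \<le> m ^ 4" "1 \<le> m ^ 4" using m by (simp_all add: power_increasing)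
  define r where "r = x\<^sup>2 + y\<^sup>2"
  have r0: "r \<ge> 0" by (simp add: r_def)
  have sq2: "(s + t)\<^sup>2 \<le> 2 * s\<^sup>2 + 2 * t\<^sup>2" for s t :: real
    using zero_le_power2[of "s - t"] by (simp add: power2_eq_square algebra_simps)
  have "(a + x)\<^sup>2 + (b + y)\<^sup>2 \<le> 2 * r + 4 * m\<^sup>2"
    using sq2[of a x] sq2[of b y] abc by (simp add: r_def)
  then have "((a + x)\<^sup>2 + (b + y)\<^sup>2)\<^sup>2 \<le> (2 * r + 4 * m\<^sup>2)\<^sup>2" by (intro power_mono) auto
  also have "\<dots> \<le> 8 * r\<^sup>2 + 32 * m ^ 4"
    using sq2[of "2 * r" "4 * m\<^sup>2"] by (simp add: power_mult_distrib flip: power_mult)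
  finally have 1: "((a + x)\<^sup>2 + (b + y)\<^sup>2)\<^sup>2 \<le> 8 * r\<^sup>2 + 32 * m ^ 4" .
  define w where "w = (a * y - x * b) / 2"
  \<comment> \<open>The twist of the group law is linear in x and y, so its square is of order r
    only, and 2 r <= 1 + r^2 absorbs it.\<close>
  have "(a * y - x * b)\<^sup>2 \<le> (a\<^sup>2 + b\<^sup>2) * r"
    using zero_le_power2[of "a * x + b * y"] by (simp add: r_def power2_eq_square algebra_simps)
  also have "\<dots> \<le> (2 * m\<^sup>2) * r" using abc r0 by (intro mult_right_mono) auto
  also have "\<dots> \<le> m\<^sup>2 * (1 + r\<^sup>2)"
    using mult_left_mono[OF sum_squares_bound[of 1 r], of "m\<^sup>2"] by (simp add: mult_ac)
  also have "\<dots> \<le> m ^ 4 * (1 + r\<^sup>2)" using m4 by (intro mult_right_mono) auto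
  finally have "4 * w\<^sup>2 \<le> m ^ 4 + m ^ 4 * r\<^sup>2" by (simp add: w_def power_divide algebra_simps)
  moreover define t where "t = m ^ 4 * r\<^sup>2"
  ultimately have w: "4 * w\<^sup>2 \<le> m ^ 4 + t" by simp
  have "(c + z + w)\<^sup>2 \<le> 2 * (c + z)\<^sup>2 + 2 * w\<^sup>2" by (rule sq2)
  also have "\<dots> \<le> 4 * c\<^sup>2 + 4 * z\<^sup>2 + 2 * w\<^sup>2" using sq2[of c z] by linarith
  finally have "(c + z + w)\<^sup>2 \<le> 4 * c\<^sup>2 + 4 * z\<^sup>2 + 2 * w\<^sup>2" .
  then have "16 * (c + z + w)\<^sup>2 \<le> 64 * m ^ 4 + 64 * z\<^sup>2 + 8 * m ^ 4 + 8 * t"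
    using abc(3) m4 w by linarith
  with 1 have "quart (h \<cdot>\<^sub>H p) \<le> m ^ 4 * 105 + (8 + 8 * m ^ 4) * r\<^sup>2 + 64 * z\<^sup>2"
    unfolding h p quart_def using m4 by (simp add: w_def t_def algebra_simps)
  also have "\<dots> \<le> m ^ 4 * 256 + (256 * m ^ 4) * r\<^sup>2 + (256 * m ^ 4) * (16 * z\<^sup>2)"
  proof -
    have "(8 + 8 * m ^ 4) * r\<^sup>2 \<le> (256 * m ^ 4) * r\<^sup>2"
      using m4 by (intro mult_right_mono) auto
    moreover have "64 * z\<^sup>2 \<le> (256 * m ^ 4) * (16 * z\<^sup>2)"
      using mult_right_mono[of 4 "256 * m ^ 4" "16 * z\<^sup>2"] m4 by simp
    moreover have "m ^ 4 * 105 \<le> m ^ 4 * 256" using m4 by linarith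
    ultimately show ?thesis by (intro add_mono)
  qed
  also have "\<dots> = (4 * m) ^ 4 * quart p"
    unfolding p quart_def r_def by (simp add: power_mult_distrib algebra_simps)
  finally have "sgauge (h \<cdot>\<^sub>H p) \<le> ((4 * m) ^ 4 * quart p) powr (1/4)"
    unfolding sgauge_def[of "h \<cdot>\<^sub>H p"] using quart_pos[of "h \<cdot>\<^sub>H p"] by (intro powr_mono2) (simp_all del: hmul.simps)
  also have "\<dots> = ((4 * m * sgauge p) ^ 4) powr (1/4)"
    by (simp only: power_mult_distrib sgauge_pow4)
  also have "\<dots> = 4 * m * sgauge p"
  proof -
    have pos: "4 * m * sgauge p > 0" using m sgauge_ge_1[of p] by simp
    then have "(4 * m * sgauge p) ^ 4 = (4 * m * sgauge p) powr 4" by (simp add: powr_numeral)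
    then show ?thesis using pos by (simp only: powr_powr) simp
  qed
  finally show ?thesis .
qed

lemma barrier_translate:
  assumes "m \<ge> 1" "\<bar>fst h\<bar> \<le> m" "\<bar>fst (snd h)\<bar> \<le> m" "\<bar>snd (snd h)\<bar> \<le> m" "k \<ge> 0"
  shows "barrier k (h \<cdot>\<^sub>H p) \<le> barrier (4 * m * k) p"
  using mult_left_mono[OF sgauge_translate[OF assms(1-4)] assms(5), of p]
  by (simp add: barrier_def mult_ac)

lemma sgauge_sublevel_bounded: "bounded {p. sgauge p \<le> R}"
proof (rule bounded_subset)
  show "{p. sgauge p \<le> R} \<subseteq> {-R..R} \<times> {-R..R} \<times> {-(R\<^sup>2)..R\<^sup>2}"
  proof
    fix p assume "p \<in> {p. sgauge p \<le> R}"
    then have p: "sgauge p \<le> R" by simp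
    then have "(sgauge p)\<^sup>2 \<le> R\<^sup>2" using sgauge_ge_1[of p] by (intro power_mono) auto
    then have "\<bar>snd (snd p)\<bar> \<le> R\<^sup>2" using sgauge_bounds(4)[of p] by linarith
    moreover have "\<bar>fst p\<bar> \<le> R" "\<bar>fst (snd p)\<bar> \<le> R" using sgauge_bounds(2,3)[of p] p by linarith+
    ultimately show "p \<in> {-R..R} \<times> {-R..R} \<times> {-(R\<^sup>2)..R\<^sup>2}"
      by (cases p) (auto simp: abs_le_iff)
  qed
  show "bounded ({-R..R} \<times> {-R..R} \<times> {-(R\<^sup>2)..R\<^sup>2})"
    by (intro bounded_Times) auto
qed

text \<open>Any gap between two rates lets the larger one win outside a sublevel set of the gauge.
  Since these sets are bounded, this supplies the bounded set that \<open>comparison\<close> asks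
  for, and likewise reduces continuity estimates to compact sets.\<close>

lemma barrier_dominates:
  assumes "k < l" "e > 0"
  obtains R where "\<And>p. sgauge p > R \<Longrightarrow> C * barrier k p < e * barrier l p"
proof
  fix p assume R: "sgauge p > ln ((\<bar>C\<bar> + 1) / e) / (l - k)"
  then have "ln ((\<bar>C\<bar> + 1) / e) < (l - k) * sgauge p"
    using assms by (simp add: field_simps)
  then have "(\<bar>C\<bar> + 1) / e < exp ((l - k) * sgauge p)"
    using assms by (metis abs_ge_zero add_nonneg_pos divide_pos_pos exp_less_cancel_iff exp_ln zero_less_one)
  then have "\<bar>C\<bar> + 1 < e * exp ((l - k) * sgauge p)"
    using assms by (simp add: field_simps)
  then have "C * barrier k p < (e * exp ((l - k) * sgauge p)) * barrier k p"
    by (intro mult_strict_right_mono) auto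
  also have "\<dots> = e * barrier l p" by (simp add: barrier_def algebra_simps flip: exp_add)
  finally show "C * barrier k p < e * barrier l p" .
qed

text \<open>Linear growth costs an arbitrarily small increase of the rate, because t <= exp t. The
  coordinate factors produced by differentiating convolutions are absorbed in this way.\<close>

lemma mult_barrier_le:
  assumes "k < l" "\<bar>a\<bar> \<le> sgauge p" 
  shows "\<bar>a\<bar> * barrier k p \<le> 1 / (l - k) * barrier l p"
proof -
  have "(l - k) * \<bar>a\<bar> \<le> (l - k) * sgauge p" using assms by simp
  also have "\<dots> \<le> exp ((l - k) * sgauge p)" using exp_ge_add_one_self[of "(l - k) * sgauge p"] by linarith
  finally have "\<bar>a\<bar> \<le> 1 / (l - k) * exp ((l - k) * sgauge p)" using assms by (simp add: field_simps)
  then have "\<bar>a\<bar> * barrier k p \<le> 1 / (l - k) * exp ((l - k) * sgauge p) * barrier k p"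
    by (rule mult_right_mono) simp
  also have "\<dots> = 1 / (l - k) * barrier l p"
    by (simp add: barrier_def algebra_simps flip: exp_add)
  finally show ?thesis .
qed

section \<open>A random-walk approximation of the linear semigroup\<close>

locale generator =
  fixes s1 s2 b :: "real \<times> real"
begin

definition gen :: "(heis \<Rightarrow> real) \<Rightarrow> heis \<Rightarrow> real" where
  "gen g p = DX s1 (DX s1 g) p + DX s2 (DX s2 g) p - DX b g p"

text \<open>Averaging over the points at parameters \<open>\<plusminus>sqrt (6 \<tau>)\<close> with total weight \<open>1/3\<close> per
  direction gives \<open>\<tau> DX s DX s g\<close> up to \<open>O(\<tau>\<^sup>2)\<close>, and weight \<open>1/3\<close> at parameter \<open>- 3 \<tau>\<close> gives
  \<open>- \<tau> DX b g\<close>. Being an average of right translations, it commutes with left translations.\<close>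

definition step :: "real \<Rightarrow> (heis \<Rightarrow> real) \<Rightarrow> heis \<Rightarrow> real" where
  "step \<tau> g p =
     g (p \<cdot>\<^sub>H flow s1 (sqrt (6 * \<tau>))) / 6 + g (p \<cdot>\<^sub>H flow s1 (- sqrt (6 * \<tau>))) / 6
     + g (p \<cdot>\<^sub>H flow s2 (sqrt (6 * \<tau>))) / 6 + g (p \<cdot>\<^sub>H flow s2 (- sqrt (6 * \<tau>))) / 6
     + g (p \<cdot>\<^sub>H flow b (- 3 * \<tau>)) / 3"

text \<open>For \<tau> <= 1 all flow parameters in \<open>step\<close> are at most 3 in absolute
  value, and the exponential bounds the growth of a barrier over such a jump. The prefactor 3 is
  tuned to \<open>step_minus_id\<close>, where it cancels against a^2 / 2 = 3 \<tau>.\<close>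

definition stepC :: "real \<Rightarrow> real" where
  "stepC k = 3 * exp (k * 3 * (norm s1 + norm s2 + norm b))"

lemma step_mono: "(\<And>q. g q \<le> h q) \<Longrightarrow> step \<tau> g p \<le> step \<tau> h p"
  unfolding step_def by (intro add_mono divide_right_mono) auto

lemma step_linear: "step \<tau> (\<lambda>q. c * g q + d * h q) p = c * step \<tau> g p + d * step \<tau> h p"
  unfolding step_def by (simp add: field_simps)

lemma step_translate: "step \<tau> (\<lambda>q. g (h \<cdot>\<^sub>H q)) p = step \<tau> g (h \<cdot>\<^sub>H p)"
  unfolding step_def hmul_assoc ..

lemma stepC_ge_1: "k \<ge> 0 \<Longrightarrow> stepC k \<ge> 1"
proof -
  assume "k \<ge> 0"
  then have "exp (k * 3 * (norm s1 + norm s2 + norm b)) \<ge> 1" by simp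
  then show "stepC k \<ge> 1" unfolding stepC_def by linarith
qed

lemma barrier_flow_le:
  assumes "k \<ge> 0" "\<bar>a\<bar> \<le> 3" "v \<in> {s1, s2, b}"
  shows "barrier k (p \<cdot>\<^sub>H flow v a) \<le> stepC k / 3 * barrier k p"
proof -
  have v: "norm v \<le> norm s1 + norm s2 + norm b" using assms(3) by auto
  have "k * \<bar>a\<bar> * norm v \<le> k * 3 * (norm s1 + norm s2 + norm b)"
    using assms(1,2) v by (intro mult_mono) auto
  then have "exp (k * \<bar>a\<bar> * norm v) * barrier k p \<le> stepC k / 3 * barrier k p"
    unfolding stepC_def by (intro mult_right_mono) auto
  with barrier_flow[OF assms(1), of p v a] show ?thesis by linarith
qed

lemma sqrt6_le: "0 \<le> \<tau> \<Longrightarrow> \<tau> \<le> 1 \<Longrightarrow> \<bar>sqrt (6 * \<tau>)\<bar> \<le> 3"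
  by (simp add: real_le_lsqrt)

lemma flow_taylor_bound:
  assumes g: "Ck n g" "n > 0" and k: "k \<ge> 0" "K \<ge> 0" and v: "v \<in> {s1, s2, b}" and a: "\<bar>a\<bar> \<le> 3"
    and bd: "\<And>p. \<bar>(DX v ^^ n) g p\<bar> \<le> K * barrier k p"
  shows "\<bar>g (p \<cdot>\<^sub>H flow v a) - (\<Sum>m<n. (DX v ^^ m) g p / fact m * a ^ m)\<bar>
    \<le> K * (stepC k / 3 * barrier k p) * (\<bar>a\<bar> ^ n / fact n)"
proof -
  obtain t where t: "\<bar>t\<bar> \<le> \<bar>a\<bar>"
      "g (p \<cdot>\<^sub>H flow v a) = (\<Sum>m<n. (DX v ^^ m) g p / fact m * a ^ m)
       + (DX v ^^ n) g (p \<cdot>\<^sub>H flow v t) / fact n * a ^ n"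
    by (rule flow_taylor[where p=p and v=v and a=a, OF g]) simp
  have "\<bar>t\<bar> \<le> 3" using t(1) a by linarith
  with bd[of "p \<cdot>\<^sub>H flow v t"] mult_left_mono[OF barrier_flow_le[OF k(1) this v, of p] k(2)]
  have "\<bar>(DX v ^^ n) g (p \<cdot>\<^sub>H flow v t)\<bar> \<le> K * (stepC k / 3 * barrier k p)" by linarith
  then have "\<bar>(DX v ^^ n) g (p \<cdot>\<^sub>H flow v t)\<bar> * (\<bar>a\<bar> ^ n / fact n) \<le> K * (stepC k / 3 * barrier k p) * (\<bar>a\<bar> ^ n / fact n)"
    by (rule mult_right_mono) simp
  then show ?thesis unfolding t(2) by (simp add: abs_mult power_abs)
qed

text \<open>The jumps have length of order sqrt \<tau>, but the first-order terms of opposite jumps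
  cancel, so bounds on second derivatives give an error of order \<tau>.\<close>

lemma step_minus_id:
  assumes g: "Ck 2 g" and k: "k \<ge> 0" "K \<ge> 0" and \<tau>: "0 \<le> \<tau>" "\<tau> \<le> 1"
    and bd: "\<And>p. \<bar>DX s1 (DX s1 g) p\<bar> \<le> K * barrier k p" "\<And>p. \<bar>DX s2 (DX s2 g) p\<bar> \<le> K * barrier k p"
      "\<And>p. \<bar>DX b g p\<bar> \<le> K * barrier k p"
  shows "\<bar>step \<tau> g p - g p\<bar> \<le> stepC k * K * \<tau> * barrier k p"
proof -
  have mem: "s1 \<in> {s1, s2, b}" "s2 \<in> {s1, s2, b}" by simp_all
  define a where "a = sqrt (6 * \<tau>)"
  have a: "\<bar>a\<bar> \<le> 3" "\<bar>- a\<bar> \<le> 3" "a\<^sup>2 = 6 * \<tau>" using sqrt6_le[OF \<tau>] \<tau> by (simp_all add: a_def)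
  define e where "e = stepC k * K * \<tau> * barrier k p"
  have T: "\<bar>g (p \<cdot>\<^sub>H flow v a) - (g p + DX v g p * a)\<bar> \<le> e"
    "\<bar>g (p \<cdot>\<^sub>H flow v (- a)) - (g p - DX v g p * a)\<bar> \<le> e"
    if v: "v \<in> {s1, s2, b}" and bd: "\<And>p. \<bar>DX v (DX v g) p\<bar> \<le> K * barrier k p" for v
  proof -
    have bd2: "\<bar>(DX v ^^ 2) g p\<bar> \<le> K * barrier k p" for p using bd[of p] by (simp add: numeral_2_eq_2)
    have e: "K * (stepC k / 3 * barrier k p) * (a\<^sup>2 / fact 2) = e" by (simp add: a(3) e_def)
    have sum2: "(\<Sum>m<2. (DX v ^^ m) g p / fact m * c ^ m) = g p + DX v g p * c" for c
      by (simp add: numeral_2_eq_2)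
    show "\<bar>g (p \<cdot>\<^sub>H flow v a) - (g p + DX v g p * a)\<bar> \<le> e"
      using flow_taylor_bound[OF g _ k v a(1) bd2, of p] by (simp only: sum2 power2_abs e zero_less_numeral)
    show "\<bar>g (p \<cdot>\<^sub>H flow v (- a)) - (g p - DX v g p * a)\<bar> \<le> e"
      using flow_taylor_bound[OF g _ k v a(2) bd2, of p] by (simp only: sum2 power2_abs power2_minus e) simp
  qed
  have D: "\<bar>g (p \<cdot>\<^sub>H flow b (- 3 * \<tau>)) - g p\<bar> \<le> e"
    using flow_taylor_bound[of 1 g k K b "- 3 * \<tau>" p] Ck_mono[OF g, of 1] k bd(3) \<tau>
    by (simp add: e_def mult_ac)
  show ?thesis
    using T[OF mem(1) bd(1)] T[OF mem(2) bd(2)] D unfolding step_def a_def[symmetric] e_def[symmetric] by linarith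
qed

text \<open>The cubic terms cancel along with the linear ones. Each long jump leaves a remainder
  \<open>e / 2\<close>, from (6 \<tau>)^2 / 4! = 3/2 \<tau>^2, and the drift jump leaves
  \<open>3 / 2 * e\<close>; with the weights 1/6 and 1/3 these add up to 5/6 of
  \<open>e\<close>.\<close>

lemma step_minus_gen:
  assumes g: "Ck 4 g" and k: "k \<ge> 0" "K \<ge> 0" and \<tau>: "0 \<le> \<tau>" "\<tau> \<le> 1"
    and bd: "\<And>p. \<bar>(DX s1 ^^ 4) g p\<bar> \<le> K * barrier k p" "\<And>p. \<bar>(DX s2 ^^ 4) g p\<bar> \<le> K * barrier k p"
      "\<And>p. \<bar>DX b (DX b g) p\<bar> \<le> K * barrier k p"
  shows "\<bar>step \<tau> g p - g p - \<tau> * gen g p\<bar> \<le> stepC k * K * \<tau>\<^sup>2 * barrier k p"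
proof -
  have mem: "s1 \<in> {s1, s2, b}" "s2 \<in> {s1, s2, b}" by simp_all
  define a where "a = sqrt (6 * \<tau>)"
  have a: "\<bar>a\<bar> \<le> 3" "\<bar>- a\<bar> \<le> 3" "a\<^sup>2 = 6 * \<tau>" using sqrt6_le[OF \<tau>] \<tau> by (simp_all add: a_def)
  have "a ^ 4 = (a\<^sup>2)\<^sup>2" by (simp flip: power_mult)
  then have a4: "a ^ 4 = 36 * \<tau>\<^sup>2" by (simp add: a(3) power_mult_distrib)
  define e where "e = stepC k * K * \<tau>\<^sup>2 * barrier k p"
  have "e \<ge> 0" using stepC_ge_1[OF k(1)] k by (simp add: e_def)
  have T: "\<bar>g (p \<cdot>\<^sub>H flow v a) - (g p + DX v g p * a + 3 * (\<tau> * DX v (DX v g) p) + (DX v ^^ 3) g p / 6 * a ^ 3)\<bar> \<le> e / 2"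
    "\<bar>g (p \<cdot>\<^sub>H flow v (- a)) - (g p - DX v g p * a + 3 * (\<tau> * DX v (DX v g) p) - (DX v ^^ 3) g p / 6 * a ^ 3)\<bar> \<le> e / 2"
    if v: "v \<in> {s1, s2, b}" and bd: "\<And>p. \<bar>(DX v ^^ 4) g p\<bar> \<le> K * barrier k p" for v
  proof -
    have e: "K * (stepC k / 3 * barrier k p) * (\<bar>c\<bar> ^ 4 / fact 4) = e / 2" if "c ^ 4 = 36 * \<tau>\<^sup>2" for c
      using that by (simp add: e_def fact_numeral)
    have sum4: "(\<Sum>m<4. (DX v ^^ m) g p / fact m * c ^ m) =
        g p + DX v g p * c + DX v (DX v g) p / 2 * c\<^sup>2 + (DX v ^^ 3) g p / 6 * c ^ 3" for c
      by (simp add: eval_nat_numeral lessThan_Suc)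
    show "\<bar>g (p \<cdot>\<^sub>H flow v a) - (g p + DX v g p * a + 3 * (\<tau> * DX v (DX v g) p) + (DX v ^^ 3) g p / 6 * a ^ 3)\<bar> \<le> e / 2"
      using flow_taylor_bound[OF g _ k v a(1) bd, of p] unfolding sum4 e[OF a4] a(3) by (simp add: mult_ac)
    have "(- a) ^ 4 = 36 * \<tau>\<^sup>2" using a4 by simp
    from flow_taylor_bound[OF g _ k v a(2) bd, of p, unfolded sum4 e[OF this]]
    show "\<bar>g (p \<cdot>\<^sub>H flow v (- a)) - (g p - DX v g p * a + 3 * (\<tau> * DX v (DX v g) p) - (DX v ^^ 3) g p / 6 * a ^ 3)\<bar> \<le> e / 2"
      by (simp add: a(3) mult_ac)
  qed
  have D: "\<bar>g (p \<cdot>\<^sub>H flow b (- 3 * \<tau>)) - (g p - 3 * (\<tau> * DX b g p))\<bar> \<le> 3 / 2 * e"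
    using flow_taylor_bound[of 2 g k K b "- 3 * \<tau>" p] Ck_mono[OF g, of 2] k bd(3) \<tau>
    by (simp add: e_def numeral_2_eq_2 mult_ac)
  have "\<tau> * gen g p = \<tau> * DX s1 (DX s1 g) p + \<tau> * DX s2 (DX s2 g) p - \<tau> * DX b g p"
    by (simp add: gen_def ring_distribs)
  with T[OF mem(1) bd(1)] T[OF mem(2) bd(2)] D \<open>e \<ge> 0\<close> show ?thesis
    unfolding step_def a_def[symmetric] e_def[symmetric] by linarith
qed

text \<open>One constant for the walk and for its generator, so that the errors of the discrete and
  of the continuous evolution can be collected under one exponential factor.\<close>

definition growth_rate :: "real \<Rightarrow> real \<Rightarrow> bool" where
  "growth_rate k \<Lambda> \<longleftrightarrow> \<Lambda> \<ge> 0 \<and>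
     (\<forall>\<tau> p. 0 \<le> \<tau> \<longrightarrow> \<tau> \<le> 1 \<longrightarrow> \<bar>step \<tau> (barrier k) p - barrier k p\<bar> \<le> \<Lambda> * \<tau> * barrier k p) \<and>
     (\<forall>p. \<bar>gen (barrier k) p\<bar> \<le> \<Lambda> * barrier k p)"

lemma growth_rateD:
  assumes "growth_rate k \<Lambda>"
  shows "\<Lambda> \<ge> 0" "0 \<le> \<tau> \<Longrightarrow> \<tau> \<le> 1 \<Longrightarrow> \<bar>step \<tau> (barrier k) p - barrier k p\<bar> \<le> \<Lambda> * \<tau> * barrier k p"
    "\<bar>gen (barrier k) p\<bar> \<le> \<Lambda> * barrier k p"
  using assms unfolding growth_rate_def by blast+

lemma growth_rate_exists:
  assumes "k \<ge> 0"
  shows "\<exists>\<Lambda>. growth_rate k \<Lambda>"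
proof -
  define K where "K = (k\<^sup>2 + 6 * k) * ((norm s1)\<^sup>2 + (norm s2)\<^sup>2) + k * norm b"
  have K: "K \<ge> 0" unfolding K_def using assms by (intro add_nonneg_nonneg mult_nonneg_nonneg) auto
  have le: "(k\<^sup>2 + 6 * k) * (norm s1)\<^sup>2 \<le> K" "(k\<^sup>2 + 6 * k) * (norm s2)\<^sup>2 \<le> K" "k * norm b \<le> K"
    unfolding K_def using assms by (simp_all add: ring_distribs)
  have 1: "\<bar>DX s1 (DX s1 (barrier k)) p\<bar> \<le> K * barrier k p" for p
    using order_trans[OF DX_DX_barrier_le[OF assms] mult_right_mono[OF le(1)]] by simp
  have 2: "\<bar>DX s2 (DX s2 (barrier k)) p\<bar> \<le> K * barrier k p" for p
    using order_trans[OF DX_DX_barrier_le[OF assms] mult_right_mono[OF le(2)]] by simp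
  have 3: "\<bar>DX b (barrier k) p\<bar> \<le> K * barrier k p" for p
    using order_trans[OF DX_barrier_le[OF assms] mult_right_mono[OF le(3)]] by simp
  have "growth_rate k (3 * stepC k * K)"
    unfolding growth_rate_def
  proof (intro conjI allI impI)
    show "3 * stepC k * K \<ge> 0" using stepC_ge_1[OF assms] K by simp
    fix \<tau> p assume \<tau>: "0 \<le> (\<tau>::real)" "\<tau> \<le> 1"
    have "\<bar>step \<tau> (barrier k) p - barrier k p\<bar> \<le> stepC k * K * \<tau> * barrier k p"
      by (rule step_minus_id[OF Ck_barrier assms K \<tau> 1 2 3])
    also have "\<dots> \<le> 3 * stepC k * K * \<tau> * barrier k p"
      using \<tau> stepC_ge_1[OF assms] K by simp
    finally show "\<bar>step \<tau> (barrier k) p - barrier k p\<bar> \<le> 3 * stepC k * K * \<tau> * barrier k p" .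
  next
    fix p
    have "\<bar>gen (barrier k) p\<bar> \<le> 3 * (K * barrier k p)"
      unfolding gen_def using 1[of p] 2[of p] 3[of p] by linarith
    also have "\<dots> \<le> stepC k * (3 * (K * barrier k p))"
      using stepC_ge_1[OF assms] mult_right_mono[of 1 "stepC k" "3 * (K * barrier k p)"] K by simp
    finally show "\<bar>gen (barrier k) p\<bar> \<le> 3 * stepC k * K * barrier k p" by (simp add: mult_ac)
  qed
  then show ?thesis ..
qed

end

section \<open>Comparison with smooth functions\<close>

text \<open>Adding \<open>\<kappa> exp (M (t - t1))\<close> with \<open>M\<close> large keeps the negative value at time \<open>t1\<close> but
  prevents the minimum from being attained at the terminal time, where nothing can be tested.\<close>

lemma comparison:
  fixes d :: "heis \<times> real \<Rightarrow> real"
  assumes cont: "continuous_on (UNIV \<times> {a..c}) d"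
    and init: "\<And>p. d (p, a) \<ge> 0"
    and K: "bounded K" "\<And>p t. p \<notin> K \<Longrightarrow> t \<in> {a..c} \<Longrightarrow> d (p, t) \<ge> 0"
    and nomin: "\<And>p t \<kappa> M t1. a < t \<Longrightarrow> t < c \<Longrightarrow> \<kappa> > 0 \<Longrightarrow> M > 0 \<Longrightarrow>
       \<not> local_min_at (\<lambda>w. d w + \<kappa> * exp (M * (snd w - t1))) (p, t)"
    and t: "a \<le> t" "t < c"
  shows "d (p, t) \<ge> 0"
proof (rule ccontr)
  assume "\<not> d (p, t) \<ge> 0"
  then have neg: "d (p, t) < 0" by simp
  define \<kappa> where "\<kappa> = - d (p, t) / 2"
  have \<kappa>: "\<kappa> > 0" using neg by (simp add: \<kappa>_def)
  define S where "S = closure K \<times> {a..c}"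
  have pK: "p \<in> K" using K(2)[of p t] neg t by force
  have S: "compact S" unfolding S_def using K(1) by (intro compact_Times compact_closure[THEN iffD2]) auto
  have pS: "(p, t) \<in> S" unfolding S_def using pK t closure_subset by fastforce
  have contS: "continuous_on S d" by (rule continuous_on_subset[OF cont]) (auto simp: S_def)
  obtain w0 where w0: "w0 \<in> S" "\<And>w. w \<in> S \<Longrightarrow> d w0 \<le> d w"
    using continuous_attains_inf[OF S _ contS] pS by blast
  \<comment> \<open>Chosen so that \<kappa> M (c - t) equals \<open>\<bar>d w0\<bar> + 1\<close>; at
    the terminal time the penalty then exceeds the depth of the minimum of \<open>d\<close>.\<close>
  define M where "M = (\<bar>d w0\<bar> + 1) / (\<kappa> * (c - t))"
  have M: "M > 0" unfolding M_def using \<kappa> t by (intro divide_pos_pos mult_pos_pos) auto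
  define \<Phi> where "\<Phi> w = d w + \<kappa> * exp (M * (snd w - t))" for w :: "heis \<times> real"
  have "continuous_on S \<Phi>" unfolding \<Phi>_def by (intro continuous_intros contS)
  then obtain w1 where w1: "w1 \<in> S" "\<And>w. w \<in> S \<Longrightarrow> \<Phi> w1 \<le> \<Phi> w"
    using continuous_attains_inf[OF S] pS by blast
  have "\<Phi> (p, t) < 0" using neg by (simp add: \<Phi>_def \<kappa>_def)
  with w1(2)[OF pS] have w1neg: "\<Phi> w1 < 0" by simp
  obtain p1 t1 where w1eq: "w1 = (p1, t1)" by (cases w1)
  have t1: "a \<le> t1" "t1 \<le> c" using w1(1) by (auto simp: S_def w1eq)
  have "t1 \<noteq> a"
  proof
    assume "t1 = a"
    then have "\<Phi> w1 > 0" using init[of p1] \<kappa> by (simp add: \<Phi>_def w1eq add_nonneg_pos)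
    with w1neg show False by simp
  qed
  moreover have "t1 \<noteq> c"
  proof
    assume "t1 = c"
    have "\<bar>d w0\<bar> + 1 = \<kappa> * (M * (c - t))" using \<kappa> t by (simp add: M_def)
    also have "\<dots> \<le> \<kappa> * exp (M * (c - t))"
    proof (rule mult_left_mono)
      show "M * (c - t) \<le> exp (M * (c - t))" by (rule order_trans[OF _ exp_ge_add_one_self]) simp
    qed (use \<kappa> in simp)
    finally have "\<Phi> w1 > 0" using w0(2)[OF w1(1)] \<open>t1 = c\<close> by (simp add: \<Phi>_def w1eq)
    with w1neg show False by simp
  qed
  ultimately have t1': "a < t1" "t1 < c" using t1 by auto
  have "local_min_at \<Phi> (p1, t1)"
    unfolding local_min_at_def eventually_nhds
  proof (intro exI[of _ "UNIV \<times> {a<..<c}"] conjI ballI)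
    show "open (UNIV \<times> {a<..<c} :: (heis \<times> real) set)" by (intro open_Times) auto
    show "(p1, t1) \<in> UNIV \<times> {a<..<c}" using t1' by simp
    fix w :: "heis \<times> real" assume w: "w \<in> UNIV \<times> {a<..<c}"
    show "\<Phi> (p1, t1) \<le> \<Phi> w"
    proof (cases "fst w \<in> K")
      case True
      then have "w \<in> S" using w closure_subset by (cases w) (fastforce simp: S_def)
      then show ?thesis using w1(2) w1eq by simp
    next
      case False
      then have "d w \<ge> 0" using K(2)[of "fst w" "snd w"] w by (cases w) auto
      then have "\<Phi> w \<ge> 0" using \<kappa> by (simp add: \<Phi>_def)
      then show ?thesis using w1neg w1eq by simp
    qed
  qed
  moreover have "\<Phi> = (\<lambda>w. d w + \<kappa> * exp (M * (snd w - t)))"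
    by (rule ext) (rule \<Phi>_def)
  ultimately show False using nomin[OF t1' \<kappa> M, of t p1] by (simp only:)
qed

section \<open>The parabolic operator on smooth functions, and comparison of viscosity solutions
  with them\<close>

lemma trace_hess:
  assumes A: "A $ 1 $ 1 = (fst s1)\<^sup>2 + (fst s2)\<^sup>2" "A $ 1 $ 2 = fst s1 * snd s1 + fst s2 * snd s2"
    "A $ 2 $ 1 = fst s1 * snd s1 + fst s2 * snd s2" "A $ 2 $ 2 = (snd s1)\<^sup>2 + (snd s2)\<^sup>2"
    and g: "Ck (Suc (Suc n)) g"
  shows "trace (A ** hhess_sym g p) = DX s1 (DX s1 g) p + DX s2 (DX s2 g) p"
  unfolding DX_DX[OF g] hhess_sym_def
  by (simp add: trace_def matrix_matrix_mult_def sum_2 Let_def A field_simps)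

lemma Ck_slice: "Ck n V \<Longrightarrow> Ck n (\<lambda>q. V (q, t))" for V :: "heis \<times> real \<Rightarrow> real"
  using Ck_affine[of "\<lambda>q. (q, 0)" n V "(0, t)", OF bounded_linear_Pair[OF bounded_linear_ident bounded_linear_zero]]
  by simp

lemma Ck_space: "Ck n g \<Longrightarrow> Ck n (\<lambda>w. g (fst w))" for g :: "heis \<Rightarrow> real"
  using Ck_affine[of fst n g 0] by (simp add: bounded_linear_fst)

lemma Ck_time: "Ck n (\<lambda>w::heis \<times> real. snd w)"
  by (rule Ck_linear[OF bounded_linear_snd])

lemma Ck_time_deriv:
  fixes V :: "heis \<times> real \<Rightarrow> real"
  assumes "Ck (Suc n) V"
  shows "((\<lambda>s. V (p, s)) has_real_derivative deriv (\<lambda>s. V (p, s)) t) (at t)"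
proof -
  have "((\<lambda>s. V ((p, 0) + s *\<^sub>R (0, 1))) has_real_derivative fd V (p, t) (0, 1)) (at t)"
    using deriv_along_line[OF Ck_deriv[OF assms], where c="(p, 0)" and a=t and w="(0, 1)"] by simp
  then show ?thesis by (simp add: DERIV_imp_deriv)
qed

lemma X_add_const:
  assumes "Ck (Suc n) g"
  shows "X1 (\<lambda>q. g q + c) = X1 g" "X2 (\<lambda>q. g q + c) = X2 g"
proof -
  have 1: "((\<lambda>q. g q + c) has_derivative fd g p) (at p)" for p
    using Ck_deriv[OF assms] by (simp add: has_derivative_add_const)
  show "X1 (\<lambda>q. g q + c) = X1 g" "X2 (\<lambda>q. g q + c) = X2 g"
    by (rule ext, simp add: X_fd[OF 1] X_fd[OF Ck_deriv[OF assms]])+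
qed

lemma parab_op_time_shift:
  fixes V :: "heis \<times> real \<Rightarrow> real"
  assumes "Ck 2 V"
  shows "parab_op A f (\<lambda>w. V w + \<kappa> * exp (M * (snd w - t1))) p t
     = parab_op A f V p t + \<kappa> * M * exp (M * (t - t1))"
proof -
  have V: "Ck (Suc 1) V" using assms by (simp add: numeral_2_eq_2)
  note g = Ck_slice[OF V, of t]
  have "((\<lambda>s. V (p, s) + \<kappa> * exp (M * (s - t1))) has_real_derivative
     deriv (\<lambda>s. V (p, s)) t + \<kappa> * M * exp (M * (t - t1))) (at t)"
    by (rule derivative_eq_intros Ck_time_deriv[OF V] refl | simp)+
  then have "deriv (\<lambda>s. V (p, s) + \<kappa> * exp (M * (s - t1))) t
     = deriv (\<lambda>s. V (p, s)) t + \<kappa> * M * exp (M * (t - t1))" by (rule DERIV_imp_deriv)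
  then show ?thesis
    unfolding parab_op_def hhess_sym_def hgrad_def by (simp add: X_add_const[OF g])
qed

lemma supersolutionD:
  assumes "viscosity_supersolution A f u" "t > 0" "Ck 2 \<phi>" "local_min_at (\<lambda>q. u q - \<phi> q) (p, t)"
  shows "parab_op A f \<phi> p t \<ge> 0"
  using assms Ck_imp_C2_on[OF assms(3)] unfolding viscosity_supersolution_def C2_near_def by blast

lemma subsolutionD:
  assumes "viscosity_subsolution A f u" "t > 0" "Ck 2 \<phi>" "local_max_at (\<lambda>q. u q - \<phi> q) (p, t)"
  shows "parab_op A f \<phi> p t \<le> 0"
  using assms Ck_imp_C2_on[OF assms(3)] unfolding viscosity_subsolution_def C2_near_def by blast

text \<open>The sign \<sigma> treats super- and subsolutions at once. The penalty of
  \<open>comparison\<close> is moved into the test function with factor - \<sigma>; as \<sigma>^2 =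
  1 it lowers \<sigma> times the operator by a positive amount, against the strict inequality
  assumed for \<open>V\<close>.\<close>

lemma signed_compare:
  fixes u V :: "heis \<times> real \<Rightarrow> real"
  assumes touch: "\<And>\<phi> p t. t > 0 \<Longrightarrow> Ck 2 \<phi> \<Longrightarrow> local_min_at (\<lambda>q. \<sigma> * (u q - \<phi> q)) (p, t) \<Longrightarrow>
      0 \<le> \<sigma> * parab_op A f \<phi> p t"
    and \<sigma>: "\<sigma>\<^sup>2 = 1" and u: "continuous_on (UNIV \<times> {0..}) u"
    and V: "Ck 2 V" "\<And>p t. a < t \<Longrightarrow> t < c \<Longrightarrow> \<sigma> * parab_op A f V p t < 0"
    and a: "a \<ge> 0" and init: "\<And>p. 0 \<le> \<sigma> * (u (p, a) - V (p, a))"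
    and K: "bounded K" "\<And>p t. p \<notin> K \<Longrightarrow> t \<in> {a..c} \<Longrightarrow> 0 \<le> \<sigma> * (u (p, t) - V (p, t))"
    and t: "a \<le> t" "t < c"
  shows "0 \<le> \<sigma> * (u (p, t) - V (p, t))"
proof (rule comparison[where d="\<lambda>w. \<sigma> * (u w - V w)", OF _ init K _ t])
  show "continuous_on (UNIV \<times> {a..c}) (\<lambda>w. \<sigma> * (u w - V w))"
  proof (intro continuous_on_mult continuous_on_const continuous_on_diff)
    show "continuous_on (UNIV \<times> {a..c}) u"
      by (rule continuous_on_subset[OF u]) (use a in auto)
    show "continuous_on (UNIV \<times> {a..c}) V"
      by (rule continuous_on_subset[OF Ck_continuous[OF V(1)]]) auto
  qed
  fix p and t \<kappa> M t1 :: real assume *: "a < t" "t < c" "\<kappa> > 0" "M > 0"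
  show "\<not> local_min_at (\<lambda>w. \<sigma> * (u w - V w) + \<kappa> * exp (M * (snd w - t1))) (p, t)"
  proof
    assume lm: "local_min_at (\<lambda>w. \<sigma> * (u w - V w) + \<kappa> * exp (M * (snd w - t1))) (p, t)"
    define \<phi> where "\<phi> w = V w + (- \<sigma> * \<kappa>) * exp (M * (snd w - t1))" for w
    have "\<sigma> * (u w - V w) + \<kappa> * exp (M * (snd w - t1)) = \<sigma> * (u w - \<phi> w)" for w
    proof -
      have "\<sigma> * (u w - \<phi> w) = \<sigma> * (u w - V w) + \<sigma>\<^sup>2 * (\<kappa> * exp (M * (snd w - t1)))"
        by (simp add: \<phi>_def power2_eq_square algebra_simps)
      then show ?thesis unfolding \<sigma> by simp
    qed
    with lm have lm': "local_min_at (\<lambda>w. \<sigma> * (u w - \<phi> w)) (p, t)" by simp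
    have "Ck 2 \<phi>" unfolding \<phi>_def[abs_def] by (intro Ck_intros V Ck_time)
    from touch[OF _ this lm'] * a have "0 \<le> \<sigma> * parab_op A f \<phi> p t" by simp
    also have "\<dots> = \<sigma> * parab_op A f V p t - \<sigma>\<^sup>2 * (\<kappa> * M * exp (M * (t - t1)))"
      unfolding \<phi>_def[abs_def] parab_op_time_shift[OF V(1)] by (simp add: power2_eq_square algebra_simps)
    finally have "\<kappa> * M * exp (M * (t - t1)) \<le> \<sigma> * parab_op A f V p t" unfolding \<sigma> by simp
    moreover have "\<kappa> * M * exp (M * (t - t1)) > 0" using * by simp
    ultimately show False using V(2)[OF *(1,2), of p] by linarith
  qed
qed

lemma supersolution_compare:
  fixes V :: "heis \<times> real \<Rightarrow> real"
  assumes u: "viscosity_supersolution A f u" "continuous_on (UNIV \<times> {0..}) u"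
    and V: "Ck 2 V" "\<And>p t. a < t \<Longrightarrow> t < c \<Longrightarrow> parab_op A f V p t < 0"
    and a: "a \<ge> 0" and init: "\<And>p. V (p, a) \<le> u (p, a)"
    and K: "bounded K" "\<And>p t. p \<notin> K \<Longrightarrow> t \<in> {a..c} \<Longrightarrow> V (p, t) \<le> u (p, t)"
    and t: "a \<le> t" "t < c"
  shows "V (p, t) \<le> u (p, t)"
  using signed_compare[where \<sigma>=1 and A=A and f=f and K=K, OF _ _ u(2) V(1) _ a _ K(1) _ t]
    supersolutionD[OF u(1)] V(2) init K(2) by simp

lemma subsolution_compare:
  fixes V :: "heis \<times> real \<Rightarrow> real"
  assumes u: "viscosity_subsolution A f u" "continuous_on (UNIV \<times> {0..}) u"
    and V: "Ck 2 V" "\<And>p t. a < t \<Longrightarrow> t < c \<Longrightarrow> parab_op A f V p t > 0"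
    and a: "a \<ge> 0" and init: "\<And>p. u (p, a) \<le> V (p, a)"
    and K: "bounded K" "\<And>p t. p \<notin> K \<Longrightarrow> t \<in> {a..c} \<Longrightarrow> u (p, t) \<le> V (p, t)"
    and t: "a \<le> t" "t < c"
  shows "u (p, t) \<le> V (p, t)"
proof -
  have "parab_op A f \<phi> p t \<le> 0" if "t > 0" "Ck 2 \<phi>" "local_min_at (\<lambda>q. \<phi> q - u q) (p, t)" for \<phi> p t
  proof (rule subsolutionD[OF u(1) that(1,2)])
    show "local_max_at (\<lambda>q. u q - \<phi> q) (p, t)"
      using that(3) unfolding local_max_at_def local_min_at_def by (auto elim!: eventually_mono)
  qed
  then show ?thesis
    using signed_compare[where \<sigma>="- 1" and A=A and f=f and K=K, OF _ _ u(2) V(1) _ a _ K(1) _ t]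
      V(2) init K(2) by simp
qed

section \<open>Left convolution on space-time\<close>

definition rdiv :: "heis \<times> real \<Rightarrow> heis \<times> real \<Rightarrow> heis \<times> real" where
  "rdiv w v = (fst w \<cdot>\<^sub>H hinv (fst v), snd w - snd v)"

definition ldiv :: "heis \<times> real \<Rightarrow> heis \<times> real \<Rightarrow> heis \<times> real" where
  "ldiv v w = (hinv (fst v) \<cdot>\<^sub>H fst w, snd w - snd v)"

text \<open>A fixed box for all kernels: translating a barrier by a point of the support then costs
  a factor 4 in the rate, whatever the kernel (\<open>barrier_ldiv\<close>).\<close>

definition ubox :: "(heis \<times> real) set" where
  "ubox = cbox ((- 1, - 1, - 1), - 1) ((1, 1, 1), 1)"

text \<open>An average of left translates of \<open>G\<close>, so left-invariant operations pass
  through it. After the substitution in \<open>conv_local\<close> all smoothness in \<open>w\<close>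
  comes from the kernel, and \<open>G\<close> need only be continuous.\<close>

definition conv :: "(heis \<times> real \<Rightarrow> real) \<Rightarrow> (heis \<times> real \<Rightarrow> real) \<Rightarrow> heis \<times> real \<Rightarrow> real" where
  "conv \<psi> G w = (\<integral>v. \<psi> v * G (ldiv v w) \<partial>lborel)"

definition test_fun :: "nat \<Rightarrow> (heis \<times> real \<Rightarrow> real) \<Rightarrow> bool" where
  "test_fun n \<psi> \<longleftrightarrow> Ck n \<psi> \<and> (\<forall>v. v \<notin> ubox \<longrightarrow> \<psi> v = 0)"

lemma test_fun_zero: "test_fun n \<psi> \<Longrightarrow> v \<notin> ubox \<Longrightarrow> \<psi> v = 0"
  by (cases v) (auto simp: test_fun_def)

lemma ubox_iff: "v \<in> ubox \<longleftrightarrow> \<bar>fst (fst v)\<bar> \<le> 1 \<and> \<bar>fst (snd (fst v))\<bar> \<le> 1 \<and> \<bar>snd (snd (fst v))\<bar> \<le> 1 \<and> \<bar>snd v\<bar> \<le> 1"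
  by (cases v) (auto simp: ubox_def cbox_Pair_eq abs_le_iff)

lemma ldiv_rdiv: "ldiv (rdiv w v) w = v"
  by (cases w; cases v) (auto simp: rdiv_def ldiv_def hinv_eq hmul_eq field_simps)

lemma continuous_on_ldiv [continuous_intros]:
  "continuous_on S f \<Longrightarrow> continuous_on S g \<Longrightarrow> continuous_on S (\<lambda>x. ldiv (f x) (g x))"
  unfolding ldiv_def by (intro continuous_intros)

lemma continuous_on_rdiv [continuous_intros]:
  "continuous_on S f \<Longrightarrow> continuous_on S g \<Longrightarrow> continuous_on S (\<lambda>x. rdiv (f x) (g x))"
  unfolding rdiv_def by (intro continuous_intros)

section \<open>Invariance of Lebesgue measure under the group operations\<close>

lemma nn_integral_shear:
  fixes f :: "heis \<times> real \<Rightarrow> ennreal"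
  assumes [measurable]: "f \<in> borel_measurable borel"
  shows "(\<integral>\<^sup>+v. f ((fst (fst v), fst (snd (fst v)), snd (snd (fst v)) + (\<alpha> * fst (fst v) + \<beta> * fst (snd (fst v)))), snd v) \<partial>lborel)
     = (\<integral>\<^sup>+v. f v \<partial>lborel)"
proof -
  have fm [measurable]: "f \<in> borel_measurable (lborel \<Otimes>\<^sub>M lborel)" by (simp add: lborel_prod)
  define g where "g p = (\<integral>\<^sup>+t. f (p, t) \<partial>lborel)" for p
  have g [measurable]: "g \<in> borel_measurable borel"
    unfolding g_def using lborel.borel_measurable_nn_integral_fst[OF fm] by simp
  have g': "g \<in> borel_measurable (lborel \<Otimes>\<^sub>M (lborel \<Otimes>\<^sub>M lborel))"
    using g by (simp add: lborel_prod)
  define S where "S p = (fst p, fst (snd p), snd (snd p) + (\<alpha> * fst p + \<beta> * fst (snd p)))" for p :: heis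
  have S [measurable]: "S \<in> borel_measurable borel"
    unfolding S_def by (intro borel_measurable_continuous_onI continuous_intros)
  have "(\<lambda>v::heis \<times> real. (S (fst v), snd v)) \<in> borel_measurable borel"
    unfolding S_def by (intro borel_measurable_continuous_onI continuous_intros)
  from measurable_compose[OF this assms]
  have fS: "(\<lambda>v. f (S (fst v), snd v)) \<in> borel_measurable (lborel \<Otimes>\<^sub>M lborel)"
    by (simp add: lborel_prod)
  have gS: "(\<lambda>p. g (S p)) \<in> borel_measurable borel" by measurable
  have "(\<integral>\<^sup>+v. f (S (fst v), snd v) \<partial>lborel) = (\<integral>\<^sup>+p. g (S p) \<partial>lborel)"
    using lborel.nn_integral_fst[OF fS] by (simp add: lborel_prod g_def)
  also have "\<dots> = (\<integral>\<^sup>+p. g (S p) \<partial>(lborel \<Otimes>\<^sub>M lborel))" by (simp add: lborel_prod)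
  also have "\<dots> = (\<integral>\<^sup>+x. \<integral>\<^sup>+q. g (S (x, q)) \<partial>lborel \<partial>lborel)"
    by (rule lborel.nn_integral_fst[symmetric]) (use gS in \<open>simp add: lborel_prod\<close>)
  also have "\<dots> = (\<integral>\<^sup>+x. \<integral>\<^sup>+q. g (x, q) \<partial>lborel \<partial>lborel)"
  proof (rule nn_integral_cong)
    fix x :: real
    have m1: "(\<lambda>q. g (S (x, q))) \<in> borel_measurable (lborel \<Otimes>\<^sub>M lborel)"
      unfolding lborel_prod by measurable
    have m2: "(\<lambda>q. g (x, q)) \<in> borel_measurable (lborel \<Otimes>\<^sub>M lborel)"
      unfolding lborel_prod by measurable
    have "(\<integral>\<^sup>+q. g (S (x, q)) \<partial>lborel) = (\<integral>\<^sup>+y. \<integral>\<^sup>+z. g (S (x, y, z)) \<partial>lborel \<partial>lborel)"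
      using lborel.nn_integral_fst[OF m1] by (simp add: lborel_prod)
    also have "\<dots> = (\<integral>\<^sup>+y. \<integral>\<^sup>+z. g (x, y, z) \<partial>lborel \<partial>lborel)"
    proof (rule nn_integral_cong)
      fix y :: real
      have m3: "(\<lambda>z. g (x, y, z)) \<in> borel_measurable borel" by measurable
      show "(\<integral>\<^sup>+z. g (S (x, y, z)) \<partial>lborel) = (\<integral>\<^sup>+z. g (x, y, z) \<partial>lborel)"
        using nn_integral_real_affine[OF m3, of 1 "\<alpha> * x + \<beta> * y"] by (simp add: S_def add_ac)
    qed
    also have "\<dots> = (\<integral>\<^sup>+q. g (x, q) \<partial>lborel)"
      using lborel.nn_integral_fst[OF m2] by (simp add: lborel_prod)
    finally show "(\<integral>\<^sup>+q. g (S (x, q)) \<partial>lborel) = (\<integral>\<^sup>+q. g (x, q) \<partial>lborel)" .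
  qed
  also have "\<dots> = (\<integral>\<^sup>+p. g p \<partial>lborel)"
    using lborel.nn_integral_fst[of g lborel] g by (simp add: lborel_prod)
  also have "\<dots> = (\<integral>\<^sup>+v. f v \<partial>lborel)"
    using lborel.nn_integral_fst[OF fm] by (simp add: lborel_prod g_def)
  finally show ?thesis by (simp add: S_def)
qed

lemma distr_shear:
  "distr lborel lborel (\<lambda>v::heis \<times> real. ((fst (fst v), fst (snd (fst v)),
     snd (snd (fst v)) + (\<alpha> * fst (fst v) + \<beta> * fst (snd (fst v)))), snd v)) = lborel"
  (is "distr _ _ ?S = _")
proof (rule measure_eqI)
  have S [measurable]: "?S \<in> borel_measurable borel"
    by (intro borel_measurable_continuous_onI continuous_intros)
  then have S' : "?S \<in> lborel \<rightarrow>\<^sub>M lborel" by simp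
  fix X assume "X \<in> sets (distr lborel lborel ?S)"
  then have X [measurable]: "X \<in> sets borel" by simp
  have "emeasure (distr lborel lborel ?S) X = (\<integral>\<^sup>+v. indicator X v \<partial>distr lborel lborel ?S)"
    using X by simp
  also have "\<dots> = (\<integral>\<^sup>+v. indicator X (?S v) \<partial>lborel)"
    by (rule nn_integral_distr[OF S']) simp
  also have "\<dots> = (\<integral>\<^sup>+v. indicator X v \<partial>lborel)"
    by (rule nn_integral_shear) simp
  also have "\<dots> = emeasure lborel X" using X by simp
  finally show "emeasure (distr lborel lborel ?S) X = emeasure lborel X" .
qed simp

lemma distr_reflect:
  "distr lborel lborel (\<lambda>v::'a::euclidean_space. w - v) = lborel"
proof -
  have "lborel = density (distr lborel borel (\<lambda>v::'a. w + (-1) *\<^sub>R v)) (\<lambda>_. ennreal (\<bar>-1\<bar> ^ DIM('a)))"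
    by (rule lborel_affine) simp
  then show ?thesis by (simp add: density_1 distr_cong[OF refl sets_lborel])
qed

text \<open>For fixed \<open>w\<close> the map is a reflection followed by a shear of the vertical
  coordinate. The shear is a translation on every vertical line, so Fubini disposes of it. This
  invariance moves \<open>w\<close> from \<open>G\<close> into the kernel.\<close>

lemma distr_rdiv: "distr lborel lborel (rdiv w) = lborel"
proof -
  let ?S = "\<lambda>v::heis \<times> real. ((fst (fst v), fst (snd (fst v)),
     snd (snd (fst v)) + (- fst (snd (fst w)) / 2 * fst (fst v) + fst (fst w) / 2 * fst (snd (fst v)))), snd v)"
  have eq: "rdiv w = ?S \<circ> (\<lambda>v. w - v)"
    by (rule ext) (auto simp: rdiv_def hinv_eq hmul_eq field_simps)
  have S: "?S \<in> lborel \<rightarrow>\<^sub>M lborel"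
    by (simp, intro borel_measurable_continuous_onI continuous_intros) simp_all
  have R: "(\<lambda>v. w - v) \<in> lborel \<rightarrow>\<^sub>M lborel" by simp
  have "distr lborel lborel (rdiv w) = distr (distr lborel lborel (\<lambda>v. w - v)) lborel ?S"
    unfolding eq by (rule distr_distr[OF S R, symmetric])
  then show ?thesis by (simp only: distr_reflect distr_shear)
qed

lemma integrable_compact_support:
  fixes f :: "'a::euclidean_space \<Rightarrow> real"
  assumes "continuous_on UNIV f" "compact K" "\<And>v. v \<notin> K \<Longrightarrow> f v = 0"
  shows "integrable lborel f" "(\<integral>v. f v \<partial>lborel) = integral K f"
proof -
  have eq: "(\<lambda>v. indicator K v *\<^sub>R f v) = f"
  proof
    show "indicator K v *\<^sub>R f v = f v" for v using assms(3)[of v] by (cases "v \<in> K") simp_all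
  qed
  have si: "set_integrable lborel K f"
    unfolding set_integrable_def
    by (rule borel_integrable_compact[OF assms(2) continuous_on_subset[OF assms(1)]]) simp
  then show "integrable lborel f" unfolding set_integrable_def eq .
  show "(\<integral>v. f v \<partial>lborel) = integral K f"
    using set_borel_integral_eq_integral(2)[OF si] unfolding set_lebesgue_integral_def eq .
qed

lemma test_fun_continuous: "test_fun n \<psi> \<Longrightarrow> continuous_on S \<psi>"
  unfolding test_fun_def using Ck_continuous continuous_on_subset by blast

lemma continuous_on_UNIV_compose:
  "continuous_on UNIV G \<Longrightarrow> continuous_on S f \<Longrightarrow> continuous_on S (\<lambda>x. G (f x))"
  by (rule continuous_on_compose2[of UNIV]) auto

lemma conv_integrable:
  assumes "test_fun n \<psi>" "continuous_on UNIV G"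
  shows "integrable lborel (\<lambda>v. \<psi> v * G (ldiv v w))"
proof (rule integrable_compact_support(1))
  show "continuous_on UNIV (\<lambda>v. \<psi> v * G (ldiv v w))"
    by (intro continuous_intros test_fun_continuous[OF assms(1)] continuous_on_UNIV_compose[OF assms(2)])
  show "compact ubox" unfolding ubox_def by (rule compact_cbox)
qed (use assms(1) in \<open>auto simp: test_fun_def\<close>)

text \<open>Near \<open>w0\<close> the substituted integrand lives in one compact box, so continuity
  and differentiation under the integral sign are available. The box depends on \<open>w0\<close>
  alone; one box therefore serves a kernel together with all its derivatives.\<close>

lemma conv_local:
  fixes w0 :: "heis \<times> real"
  obtains a where "\<And>n \<psi> (G :: heis \<times> real \<Rightarrow> real) w. test_fun n \<psi> \<Longrightarrow> continuous_on UNIV G \<Longrightarrow> w \<in> ball w0 1 \<Longrightarrow>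
     conv \<psi> G w = integral (cbox (- a) a) (\<lambda>v. \<psi> (rdiv w v) * G v)"
proof -
  let ?K = "(\<lambda>(e, w). ldiv e w) ` (ubox \<times> cball w0 1)"
  have "compact ?K"
    by (intro compact_continuous_image compact_Times)
      (auto simp: ubox_def case_prod_beta intro!: continuous_intros)
  then obtain a where a: "?K \<subseteq> cbox (- a) a"
    using bounded_subset_cbox_symmetric[OF compact_imp_bounded] by blast
  have out: "rdiv w v \<notin> ubox" if "w \<in> ball w0 1" "v \<notin> cbox (- a) a" for w v
  proof
    assume "rdiv w v \<in> ubox"
    then have "(\<lambda>(e, w). ldiv e w) (rdiv w v, w) \<in> ?K" using that(1) by (intro imageI) auto
    then have "v \<in> cbox (- a) a" using a by (auto simp: ldiv_rdiv)
    with that(2) show False by simp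
  qed
  show ?thesis
  proof (rule that)
    fix n \<psi> and G :: "heis \<times> real \<Rightarrow> real" and w
    assume \<psi>: "test_fun n \<psi>" and G: "continuous_on UNIV G" and w: "w \<in> ball w0 1"
    have r: "rdiv w \<in> lborel \<rightarrow>\<^sub>M lborel"
      by (simp, intro borel_measurable_continuous_onI continuous_intros)
    have m: "(\<lambda>v. \<psi> v * G (ldiv v w)) \<in> borel_measurable lborel"
      using conv_integrable[OF \<psi> G] by (rule borel_measurable_integrable)
    have "conv \<psi> G w = (\<integral>v. \<psi> v * G (ldiv v w) \<partial>distr lborel lborel (rdiv w))"
      unfolding conv_def distr_rdiv ..
    also have "\<dots> = (\<integral>v. \<psi> (rdiv w v) * G v \<partial>lborel)"
      using integral_distr[OF r m] by (simp add: ldiv_rdiv)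
    also have "\<dots> = integral (cbox (- a) a) (\<lambda>v. \<psi> (rdiv w v) * G v)"
    proof (rule integrable_compact_support(2))
      show "continuous_on UNIV (\<lambda>v. \<psi> (rdiv w v) * G v)"
        by (intro continuous_intros continuous_on_UNIV_compose[OF test_fun_continuous[OF \<psi>]] G)
      fix v assume "v \<notin> cbox (- a) a"
      from test_fun_zero[OF \<psi> out[OF w this]] show "\<psi> (rdiv w v) * G v = 0" by simp
    qed (rule compact_cbox)
    finally show "conv \<psi> G w = integral (cbox (- a) a) (\<lambda>v. \<psi> (rdiv w v) * G v)" .
  qed
qed

lemma conv_continuous:
  assumes \<psi>: "test_fun n \<psi>" and G: "continuous_on UNIV G"
  shows "continuous_on UNIV (conv \<psi> G)"
proof -
  have "isCont (conv \<psi> G) w0" for w0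
  proof -
    obtain a where a: "\<And>n \<psi> (G :: heis \<times> real \<Rightarrow> real) w. test_fun n \<psi> \<Longrightarrow> continuous_on UNIV G \<Longrightarrow> w \<in> ball w0 1 \<Longrightarrow>
       conv \<psi> G w = integral (cbox (- a) a) (\<lambda>v. \<psi> (rdiv w v) * G v)" by (rule conv_local) blast
    have "continuous_on (ball w0 1 \<times> cbox (- a) a) (\<lambda>(w, v). \<psi> (rdiv w v) * G v)"
      unfolding case_prod_beta
      by (intro continuous_intros continuous_on_UNIV_compose[OF test_fun_continuous[OF \<psi>]] continuous_on_UNIV_compose[OF G])
    then have "continuous_on (ball w0 1) (\<lambda>w. integral (cbox (- a) a) (\<lambda>v. \<psi> (rdiv w v) * G v))"
      by (rule integral_continuous_on_param)
    then have "continuous_on (ball w0 1) (conv \<psi> G)"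
      by (subst continuous_on_cong[OF refl a[OF \<psi> G]])
    then show ?thesis by (rule continuous_on_interior) simp
  qed
  then show ?thesis by (simp add: continuous_at_imp_continuous_on)
qed

text \<open>Right-invariant fields act on a left convolution through its kernel; the left-invariant ones then differ
  by multiplications with the coordinates.\<close>

definition R1 :: "(heis \<times> real \<Rightarrow> real) \<Rightarrow> heis \<times> real \<Rightarrow> real" where
  "R1 \<psi> v = fd \<psi> v ((1, 0, fst (snd (fst v)) / 2), 0)"

definition R2 :: "(heis \<times> real \<Rightarrow> real) \<Rightarrow> heis \<times> real \<Rightarrow> real" where
  "R2 \<psi> v = fd \<psi> v ((0, 1, - fst (fst v) / 2), 0)"

definition Zd :: "(heis \<times> real \<Rightarrow> real) \<Rightarrow> heis \<times> real \<Rightarrow> real" where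
  "Zd \<psi> v = fd \<psi> v ((0, 0, 1), 0)"

definition Td :: "(heis \<times> real \<Rightarrow> real) \<Rightarrow> heis \<times> real \<Rightarrow> real" where
  "Td \<psi> v = fd \<psi> v ((0, 0, 0), 1)"

lemma linear_coords4:
  fixes F :: "heis \<times> real \<Rightarrow> real"
  assumes "linear F"
  shows "F ((a, b, c), d) = a * F ((1, 0, 0), 0) + b * F ((0, 1, 0), 0) + c * F ((0, 0, 1), 0) + d * F ((0, 0, 0), 1)"
proof -
  have "((a, b, c), d) = a *\<^sub>R ((1, 0, 0), 0) + b *\<^sub>R ((0, 1, 0), 0) + c *\<^sub>R ((0, 0, 1), 0) + d *\<^sub>R ((0, 0, 0 :: real), 1 :: real)"
    by simp
  then have "F ((a, b, c), d) = F (a *\<^sub>R ((1, 0, 0), 0) + b *\<^sub>R ((0, 1, 0), 0) + c *\<^sub>R ((0, 0, 1), 0) + d *\<^sub>R ((0, 0, 0), 1))"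
    by simp
  then show ?thesis by (simp only: linear_add[OF assms] linear_cmul[OF assms] real_scaleR_def)
qed

lemma fd_test_fun_outside:
  assumes "test_fun (Suc n) \<psi>" "v \<notin> ubox"
  shows "fd \<psi> v = (\<lambda>h. 0)"
proof -
  have "open (- ubox)" unfolding ubox_def by (simp add: open_Compl closed_cbox)
  moreover have "v \<in> - ubox" using assms(2) by simp
  ultimately have "(\<psi> has_derivative (\<lambda>h. 0)) (at v)"
    by (rule has_derivative_transform_within_open[OF has_derivative_const[of 0]])
      (simp add: test_fun_zero[OF assms(1)])
  then show ?thesis by (rule fd_eq)
qed

lemma test_fun_derivs:
  assumes "test_fun (Suc n) \<psi>"
  shows "test_fun n (R1 \<psi>)" "test_fun n (R2 \<psi>)" "test_fun n (Zd \<psi>)" "test_fun n (Td \<psi>)"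
proof -
  have C: "Ck (Suc n) \<psi>" using assms by (simp add: test_fun_def)
  have lin: "linear (fd \<psi> v)" for v using Ck_deriv[OF C] has_derivative_linear by blast
  have c: "Ck n (\<lambda>v::heis \<times> real. fst (fst v))" "Ck n (\<lambda>v::heis \<times> real. fst (snd (fst v)))"
    by (intro Ck_linear bounded_linear_compose[OF bounded_linear_coords(3) bounded_linear_fst]
       bounded_linear_compose[OF bounded_linear_coords(1) bounded_linear_fst])+
  have 1: "R1 \<psi> = (\<lambda>v. fd \<psi> v ((1, 0, 0), 0) + (1/2 * fst (snd (fst v))) * fd \<psi> v ((0, 0, 1), 0))"
  proof
    show "R1 \<psi> v = fd \<psi> v ((1, 0, 0), 0) + (1/2 * fst (snd (fst v))) * fd \<psi> v ((0, 0, 1), 0)" for v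
      unfolding R1_def using linear_coords4[OF lin, of v 1 0 "fst (snd (fst v)) / 2" 0] by simp
  qed
  have 2: "R2 \<psi> = (\<lambda>v. fd \<psi> v ((0, 1, 0), 0) + (- 1/2 * fst (fst v)) * fd \<psi> v ((0, 0, 1), 0))"
  proof
    show "R2 \<psi> v = fd \<psi> v ((0, 1, 0), 0) + (- 1/2 * fst (fst v)) * fd \<psi> v ((0, 0, 1), 0)" for v
      unfolding R2_def using linear_coords4[OF lin, of v 0 1 "- fst (fst v) / 2" 0] by simp
  qed
  show "test_fun n (R1 \<psi>)" unfolding test_fun_def
  proof
    show "Ck n (R1 \<psi>)" unfolding 1 by (intro Ck_intros Ck_fd C c)
  qed (use fd_test_fun_outside[OF assms] in \<open>simp add: R1_def\<close>)
  show "test_fun n (R2 \<psi>)" unfolding test_fun_def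
  proof
    show "Ck n (R2 \<psi>)" unfolding 2 by (intro Ck_intros Ck_fd C c)
  qed (use fd_test_fun_outside[OF assms] in \<open>simp add: R2_def\<close>)
  show "test_fun n (Zd \<psi>)" "test_fun n (Td \<psi>)" unfolding test_fun_def Zd_def[abs_def] Td_def[abs_def]
    using fd_test_fun_outside[OF assms] by (simp_all add: Ck_fd[OF C])
qed

lemma conv_has_derivative:
  assumes \<psi>: "test_fun (Suc n) \<psi>" and G: "continuous_on UNIV G"
  shows "(conv \<psi> G has_derivative (\<lambda>h.
      fst (fst h) * (conv (R1 \<psi>) G w - fst (snd (fst w)) / 2 * conv (Zd \<psi>) G w)
    + fst (snd (fst h)) * (conv (R2 \<psi>) G w + fst (fst w) / 2 * conv (Zd \<psi>) G w)
    + snd (snd (fst h)) * conv (Zd \<psi>) G w + snd h * conv (Td \<psi>) G w)) (at w)"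
proof -
  obtain a where a: "\<And>n \<psi> (G :: heis \<times> real \<Rightarrow> real) w'. test_fun n \<psi> \<Longrightarrow> continuous_on UNIV G \<Longrightarrow> w' \<in> ball w 1 \<Longrightarrow>
     conv \<psi> G w' = integral (cbox (- a) a) (\<lambda>v. \<psi> (rdiv w' v) * G v)" by (rule conv_local) blast
  have w: "w \<in> ball w 1" by simp
  note der = test_fun_derivs[OF \<psi>]
  have C: "Ck (Suc n) \<psi>" using \<psi> by (simp add: test_fun_def)
  have lin: "linear (fd \<psi> v)" for v using Ck_deriv[OF C] has_derivative_linear by blast
  have blin: "bounded_linear (fd \<psi> v)" for v using Ck_deriv[OF C] has_derivative_bounded_linear by blast
  define dr where "dr v h = ((fst (fst h), fst (snd (fst h)), snd (snd (fst h)) +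
      (fst (fst v) * fst (snd (fst h)) - fst (fst h) * fst (snd (fst v))) / 2), snd h)" for v h :: "heis \<times> real"
  define F where "F w v h = fd \<psi> (rdiv w v) (dr v h) * G v" for w v h
  \<comment> \<open>The chain rule leaves coordinates of \<open>v\<close>. Written as those of
    \<open>w\<close> minus those of \<open>rdiv w v\<close>, they split: the second part completes
    the right-invariant derivatives of the kernel, the first does not depend on \<open>v\<close> and
    leaves the integral.\<close>
  have Feq: "F w v h = (fst (fst h) * (R1 \<psi> (rdiv w v) - fst (snd (fst w)) / 2 * Zd \<psi> (rdiv w v))
    + fst (snd (fst h)) * (R2 \<psi> (rdiv w v) + fst (fst w) / 2 * Zd \<psi> (rdiv w v))
    + snd (snd (fst h)) * Zd \<psi> (rdiv w v) + snd h * Td \<psi> (rdiv w v)) * G v" for w v h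
  proof -
    define u where "u = rdiv w v"
    have "fst (fst v) = fst (fst w) - fst (fst u)" "fst (snd (fst v)) = fst (snd (fst w)) - fst (snd (fst u))"
      by (simp_all add: u_def rdiv_def hmul_eq hinv_eq)
    note uv = this
    have r: "R1 \<psi> u = fd \<psi> u ((1, 0, 0), 0) + fst (snd (fst u)) / 2 * fd \<psi> u ((0, 0, 1), 0)"
      "R2 \<psi> u = fd \<psi> u ((0, 1, 0), 0) - fst (fst u) / 2 * fd \<psi> u ((0, 0, 1), 0)"
      unfolding R1_def R2_def
      using linear_coords4[OF lin, of u 1 0 "fst (snd (fst u)) / 2" 0] linear_coords4[OF lin, of u 0 1 "- fst (fst u) / 2" 0]
      by simp_all
    have "fd \<psi> u (dr v h) = fst (fst h) * fd \<psi> u ((1, 0, 0), 0) + fst (snd (fst h)) * fd \<psi> u ((0, 1, 0), 0)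
       + (snd (snd (fst h)) + (fst (fst v) * fst (snd (fst h)) - fst (fst h) * fst (snd (fst v))) / 2) * fd \<psi> u ((0, 0, 1), 0)
       + snd h * fd \<psi> u ((0, 0, 0), 1)"
      unfolding dr_def by (rule linear_coords4[OF lin])
    note eq = this
    show ?thesis
      unfolding F_def Zd_def Td_def u_def[symmetric] r eq uv by (simp add: algebra_simps add_divide_distrib diff_divide_distrib)
  qed
  have drlin: "linear (dr v)" for v
    unfolding dr_def by (rule linearI) (auto simp: field_simps)
  have Flin: "bounded_linear (F w v)" for w v
  proof -
    have "bounded_linear (dr v)" using drlin linear_conv_bounded_linear by blast
    from bounded_linear_compose[OF blin this] show ?thesis
      unfolding F_def[abs_def] by (intro bounded_linear_mult_const) 
  qed
  have Fder: "((\<lambda>w. \<psi> (rdiv w v) * G v) has_derivative F w v) (at w)" for w v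
  proof -
    have "(\<lambda>w. rdiv w v) = (\<lambda>w. dr v w + rdiv 0 v)"
      by (rule ext) (auto simp: rdiv_def dr_def hmul_eq hinv_eq field_simps)
    moreover have "(dr v has_derivative dr v) (at w)"
      using drlin[of v] by (intro bounded_linear_imp_has_derivative) (simp add: linear_conv_bounded_linear)
    ultimately have "((\<lambda>w. rdiv w v) has_derivative dr v) (at w)"
      by (simp add: has_derivative_add_const)
    from has_derivative_compose[OF this Ck_deriv[OF C]] show ?thesis
      unfolding F_def[abs_def] by (rule has_derivative_mult_left)
  qed
  define fx where "fx w v = Blinfun (F w v)" for w v
  have fx: "blinfun_apply (fx w v) = F w v" for w v
    unfolding fx_def by (rule bounded_linear_Blinfun_apply[OF Flin])
  have contF: "continuous_on S (\<lambda>x. F (f x) (g x) h)" if "continuous_on S f" "continuous_on S g"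
    for S :: "'b::topological_space set" and f g h
    unfolding Feq using that
    by (intro continuous_intros continuous_on_UNIV_compose[OF test_fun_continuous[OF der(1)]]
        continuous_on_UNIV_compose[OF test_fun_continuous[OF der(2)]]
        continuous_on_UNIV_compose[OF test_fun_continuous[OF der(3)]]
        continuous_on_UNIV_compose[OF test_fun_continuous[OF der(4)]] continuous_on_UNIV_compose[OF G]) simp_all
  have contfx: "continuous_on (ball w 1 \<times> cbox (- a) a) (\<lambda>(w, v). fx w v)"
    unfolding case_prod_beta
    by (rule continuous_on_blinfun_componentwise) (simp only: fx, intro contF continuous_intros)
  have "((\<lambda>w. integral (cbox (- a) a) (\<lambda>v. \<psi> (rdiv w v) * G v)) has_derivative
      blinfun_apply (integral (cbox (- a) a) (fx w))) (at w within ball w 1)"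
  proof (rule leibniz_rule[OF _ _ contfx w convex_ball])
    show "((\<lambda>w. \<psi> (rdiv w v) * G v) has_derivative blinfun_apply (fx w v)) (at w within ball w0 1)" for w v w0
      unfolding fx by (rule has_derivative_at_withinI[OF Fder])
    show "(\<lambda>v. \<psi> (rdiv w' v) * G v) integrable_on cbox (- a) a" for w'
      by (intro integrable_continuous continuous_intros continuous_on_UNIV_compose[OF test_fun_continuous[OF \<psi>]]
          continuous_on_UNIV_compose[OF G])
  qed
  then have "((\<lambda>w. integral (cbox (- a) a) (\<lambda>v. \<psi> (rdiv w v) * G v)) has_derivative
      blinfun_apply (integral (cbox (- a) a) (fx w))) (at w)"
    by (simp add: at_within_open[OF w open_ball])
  then have D: "(conv \<psi> G has_derivative blinfun_apply (integral (cbox (- a) a) (fx w))) (at w)"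
    by (rule has_derivative_transform_within_open[OF _ open_ball w]) (simp add: a[OF \<psi> G])
  have "fx w integrable_on cbox (- a) a"
    by (intro integrable_continuous continuous_on_blinfun_componentwise)
      (simp only: fx, intro contF continuous_intros)
  then have "blinfun_apply (integral (cbox (- a) a) (fx w)) h = integral (cbox (- a) a) (\<lambda>v. F w v h)" for h
    by (simp add: blinfun_apply_integral fx)
  also have "integral (cbox (- a) a) (\<lambda>v. F w v h) =
      fst (fst h) * (conv (R1 \<psi>) G w - fst (snd (fst w)) / 2 * conv (Zd \<psi>) G w)
    + fst (snd (fst h)) * (conv (R2 \<psi>) G w + fst (fst w) / 2 * conv (Zd \<psi>) G w)
    + snd (snd (fst h)) * conv (Zd \<psi>) G w + snd h * conv (Td \<psi>) G w" for h
  proof -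
    have int: "((\<lambda>v. \<phi> (rdiv w v) * G v) has_integral conv \<phi> G w) (cbox (- a) a)" if "test_fun n \<phi>" for \<phi>
      unfolding a[OF that G w]
      by (intro integrable_integral integrable_continuous continuous_intros
          continuous_on_UNIV_compose[OF test_fun_continuous[OF that]] continuous_on_UNIV_compose[OF G])
    have "F w v h =
      fst (fst h) * (R1 \<psi> (rdiv w v) * G v - fst (snd (fst w)) / 2 * (Zd \<psi> (rdiv w v) * G v))
    + fst (snd (fst h)) * (R2 \<psi> (rdiv w v) * G v + fst (fst w) / 2 * (Zd \<psi> (rdiv w v) * G v))
    + snd (snd (fst h)) * (Zd \<psi> (rdiv w v) * G v) + snd h * (Td \<psi> (rdiv w v) * G v)" for v
      unfolding Feq by (simp add: algebra_simps)
    moreover have "((\<lambda>v. fst (fst h) * (R1 \<psi> (rdiv w v) * G v - fst (snd (fst w)) / 2 * (Zd \<psi> (rdiv w v) * G v))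
    + fst (snd (fst h)) * (R2 \<psi> (rdiv w v) * G v + fst (fst w) / 2 * (Zd \<psi> (rdiv w v) * G v))
    + snd (snd (fst h)) * (Zd \<psi> (rdiv w v) * G v) + snd h * (Td \<psi> (rdiv w v) * G v)) has_integral
      (fst (fst h) * (conv (R1 \<psi>) G w - fst (snd (fst w)) / 2 * conv (Zd \<psi>) G w)
    + fst (snd (fst h)) * (conv (R2 \<psi>) G w + fst (fst w) / 2 * conv (Zd \<psi>) G w)
    + snd (snd (fst h)) * conv (Zd \<psi>) G w + snd h * conv (Td \<psi>) G w)) (cbox (- a) a)"
      by (intro has_integral_add has_integral_diff has_integral_mult_right int der)
    ultimately show ?thesis by (simp add: integral_unique)
  qed
  finally have "blinfun_apply (integral (cbox (- a) a) (fx w)) = (\<lambda>h.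
      fst (fst h) * (conv (R1 \<psi>) G w - fst (snd (fst w)) / 2 * conv (Zd \<psi>) G w)
    + fst (snd (fst h)) * (conv (R2 \<psi>) G w + fst (fst w) / 2 * conv (Zd \<psi>) G w)
    + snd (snd (fst h)) * conv (Zd \<psi>) G w + snd h * conv (Td \<psi>) G w)" by (rule ext)
  with D show ?thesis by simp
qed

lemma Ck_conv:
  assumes "test_fun n \<psi>" "continuous_on UNIV G"
  shows "Ck n (conv \<psi> G)"
  using assms(1)
proof (induction n arbitrary: \<psi>)
  case 0
  then show ?case using conv_continuous[OF 0 assms(2)] by simp
next
  case (Suc n)
  note der = test_fun_derivs[OF Suc.prems, THEN Suc.IH]
  have c: "Ck n (\<lambda>v::heis \<times> real. fst (fst v))" "Ck n (\<lambda>v::heis \<times> real. fst (snd (fst v)))"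
    by (intro Ck_linear bounded_linear_compose[OF bounded_linear_coords(3) bounded_linear_fst]
       bounded_linear_compose[OF bounded_linear_coords(1) bounded_linear_fst])+
  show ?case
    by (rule Ck_SucI[OF conv_has_derivative[OF Suc.prems assms(2)]])
      (simp only: divide_inverse, intro Ck_intros der c)
qed

text \<open>The left- and right-invariant fields differ by a coordinate times the vertical
  derivative. Half of that term comes from \<open>conv_has_derivative\<close>, the other half from
  the field itself.\<close>

lemma X_conv:
  assumes "test_fun (Suc n) \<psi>" "continuous_on UNIV G"
  shows "X1 (\<lambda>q. conv \<psi> G (q, t)) p = conv (R1 \<psi>) G (p, t) - fst (snd p) * conv (Zd \<psi>) G (p, t)"
    "X2 (\<lambda>q. conv \<psi> G (q, t)) p = conv (R2 \<psi>) G (p, t) + fst p * conv (Zd \<psi>) G (p, t)"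
proof -
  have "((\<lambda>q. (q, t)) has_derivative (\<lambda>h. (h, 0))) (at p)"
    by (auto intro!: derivative_eq_intros)
  from has_derivative_compose[OF this conv_has_derivative[OF assms]]
  show "X1 (\<lambda>q. conv \<psi> G (q, t)) p = conv (R1 \<psi>) G (p, t) - fst (snd p) * conv (Zd \<psi>) G (p, t)"
    "X2 (\<lambda>q. conv \<psi> G (q, t)) p = conv (R2 \<psi>) G (p, t) + fst p * conv (Zd \<psi>) G (p, t)"
    by (simp_all add: X_fd)
qed

lemma test_fun_mono: "test_fun n \<psi> \<Longrightarrow> m \<le> n \<Longrightarrow> test_fun m \<psi>"
  using Ck_mono unfolding test_fun_def by blast

lemma barrier_ldiv:
  assumes "v \<in> ubox" "k \<ge> 0"
  shows "barrier k (fst (ldiv v w)) \<le> barrier (4 * k) (fst w)"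
  using barrier_translate[of 1 "hinv (fst v)" k "fst w"] assms
  by (simp add: ubox_iff ldiv_def hinv_eq)

lemma test_fun_abs_integrable:
  assumes "test_fun n \<psi>"
  shows "integrable lborel (\<lambda>v. \<bar>\<psi> v\<bar>)"
proof (rule integrable_compact_support(1))
  show "continuous_on UNIV (\<lambda>v. \<bar>\<psi> v\<bar>)"
    by (intro continuous_on_rabs test_fun_continuous[OF assms])
  show "compact ubox" unfolding ubox_def by (rule compact_cbox)
qed (simp add: test_fun_zero[OF assms])

lemma conv_bound:
  assumes \<psi>: "test_fun n \<psi>" and G: "continuous_on UNIV G" and k: "k \<ge> 0" "M \<ge> 0"
    and bd: "\<And>q s. \<bar>G (q, s)\<bar> \<le> M * barrier k q"
  shows "\<bar>conv \<psi> G (p, t)\<bar> \<le> (\<integral>v. \<bar>\<psi> v\<bar> \<partial>lborel) * (M * barrier (4 * k) p)"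
proof -
  have le: "\<bar>\<psi> v * G (ldiv v (p, t))\<bar> \<le> \<bar>\<psi> v\<bar> * (M * barrier (4 * k) p)" for v
  proof (cases "v \<in> ubox")
    case True
    have "\<bar>G (ldiv v (p, t))\<bar> \<le> M * barrier k (fst (ldiv v (p, t)))"
      using bd[of "fst (ldiv v (p, t))" "snd (ldiv v (p, t))"] by simp
    also have "\<dots> \<le> M * barrier (4 * k) p"
      using barrier_ldiv[OF True k(1), of "(p, t)"] k(2) by (intro mult_left_mono) auto
    finally show ?thesis unfolding abs_mult by (rule mult_left_mono) simp
  qed (simp add: test_fun_zero[OF \<psi>])
  have "\<bar>conv \<psi> G (p, t)\<bar> \<le> (\<integral>v. \<bar>\<psi> v * G (ldiv v (p, t))\<bar> \<partial>lborel)"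
    unfolding conv_def by (rule integral_abs_bound)
  also have "\<dots> \<le> (\<integral>v. \<bar>\<psi> v\<bar> * (M * barrier (4 * k) p) \<partial>lborel)"
    by (intro integral_mono le integrable_abs conv_integrable[OF \<psi> G] integrable_mult_left test_fun_abs_integrable[OF \<psi>])
  finally show ?thesis by simp
qed

text \<open>This class of operators is closed under horizontal derivatives, and each member is bounded uniformly over
  the functions with a given growth. This makes the constants below independent of the number of steps.\<close>

type_synonym fn_op = "(heis \<times> real \<Rightarrow> real) \<Rightarrow> heis \<times> real \<Rightarrow> real"

definition op_lin :: "real \<Rightarrow> fn_op \<Rightarrow> real \<Rightarrow> fn_op \<Rightarrow> fn_op" where
  "op_lin c O1 d O2 = (\<lambda>G w. c * O1 G w + d * O2 G w)"

definition op_x :: "fn_op \<Rightarrow> fn_op" where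
  "op_x O1 = (\<lambda>G w. fst (fst w) * O1 G w)"

definition op_y :: "fn_op \<Rightarrow> fn_op" where
  "op_y O1 = (\<lambda>G w. fst (snd (fst w)) * O1 G w)"

inductive Op :: "nat \<Rightarrow> fn_op \<Rightarrow> bool" where
  Op_conv: "test_fun n \<psi> \<Longrightarrow> Op n (conv \<psi>)"
| Op_lin: "Op n O1 \<Longrightarrow> Op n O2 \<Longrightarrow> Op n (op_lin c O1 d O2)"
| Op_x: "Op n O1 \<Longrightarrow> Op n (op_x O1)"
| Op_y: "Op n O1 \<Longrightarrow> Op n (op_y O1)"

lemma Op_mono: "Op n O1 \<Longrightarrow> m \<le> n \<Longrightarrow> Op m O1"
proof (induction rule: Op.induct)
  case (Op_conv n \<psi>) then show ?case by (intro Op.Op_conv test_fun_mono[OF Op_conv(1)])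
next
  case Op_lin then show ?case by (intro Op.Op_lin)
next
  case Op_x then show ?case by (intro Op.Op_x)
next
  case Op_y then show ?case by (intro Op.Op_y)
qed

lemma Ck_Op: "Op n O1 \<Longrightarrow> continuous_on UNIV G \<Longrightarrow> Ck n (O1 G)"
proof (induction rule: Op.induct)
  case (Op_conv n \<psi>) then show ?case by (rule Ck_conv)
next
  case Op_lin then show ?case unfolding op_lin_def by (intro Ck_add Ck_cmult)
next
  case Op_x then show ?case unfolding op_x_def
    by (intro Ck_mult[OF Ck_linear[OF bounded_linear_compose[OF bounded_linear_coords(3) bounded_linear_fst]]])
next
  case Op_y then show ?case unfolding op_y_def
    by (intro Ck_mult[OF Ck_linear[OF bounded_linear_compose[OF bounded_linear_coords(1) bounded_linear_fst]]])
qed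

definition bounded_op :: "real \<Rightarrow> real \<Rightarrow> ((heis \<times> real \<Rightarrow> real) \<Rightarrow> heis \<times> real \<Rightarrow> real) \<Rightarrow> real \<Rightarrow> bool" where
  "bounded_op k l O1 C \<longleftrightarrow> 0 \<le> C \<and> (\<forall>G M. continuous_on UNIV G \<longrightarrow> 0 \<le> M \<longrightarrow>
     (\<forall>q s. \<bar>G (q, s)\<bar> \<le> M * barrier k q) \<longrightarrow> (\<forall>p t. \<bar>O1 G (p, t)\<bar> \<le> C * M * barrier l p))"

lemma bounded_op_mono:
  assumes b: "bounded_op k l O1 c" and c: "c \<le> C"
  shows "bounded_op k l O1 C"
  unfolding bounded_op_def
proof (intro conjI allI impI)
  show "0 \<le> C" using assms by (simp add: bounded_op_def)
  fix G :: "heis \<times> real \<Rightarrow> real" and M :: real and p and t :: real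
  assume G: "continuous_on UNIV G" "0 \<le> M" "\<forall>q s. \<bar>G (q, s)\<bar> \<le> M * barrier k q"
  then have "\<bar>O1 G (p, t)\<bar> \<le> c * M * barrier l p" using b unfolding bounded_op_def by blast
  also have "\<dots> \<le> C * M * barrier l p" using G(2) c by (intro mult_right_mono) auto
  finally show "\<bar>O1 G (p, t)\<bar> \<le> C * M * barrier l p" .
qed

lemma bounded_op_finite:
  assumes "finite S" "\<forall>O1\<in>S. \<exists>C. bounded_op k l O1 C"
  shows "\<exists>C. \<forall>O1\<in>S. bounded_op k l O1 C"
  using assms
proof (induction S rule: finite_induct)
  case (insert x F)
  then obtain C c where C: "\<forall>O1\<in>F. bounded_op k l O1 C" and c: "bounded_op k l x c" by auto
  have "bounded_op k l O1 (max C c)" if "O1 \<in> insert x F" for O1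
  proof (cases "O1 = x")
    case True
    then show ?thesis using bounded_op_mono[OF c, of "max C c"] by simp
  next
    case False
    then show ?thesis using bounded_op_mono[OF bspec[OF C], of O1 "max C c"] that by simp
  qed
  then show ?case by blast
qed simp

lemma bounded_op_mult_coord:
  assumes "bounded_op k l' O1 C" "l' < l" "\<And>w. \<bar>c w\<bar> \<le> sgauge (fst w)"
  shows "bounded_op k l (\<lambda>G w. c w * O1 G w) (C / (l - l'))"
  unfolding bounded_op_def
proof (intro conjI allI impI)
  have C: "C \<ge> 0" using assms(1) by (simp add: bounded_op_def)
  then show "0 \<le> C / (l - l')" using assms(2) by simp
  fix G :: "heis \<times> real \<Rightarrow> real" and M :: real and p and t :: real
  assume "continuous_on UNIV G" "(0::real) \<le> M" "\<forall>q s. \<bar>G (q, s)\<bar> \<le> M * barrier k q"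
  then have "\<bar>O1 G (p, t)\<bar> \<le> C * M * barrier l' p" using assms(1) unfolding bounded_op_def by blast
  then have "\<bar>c (p, t) * O1 G (p, t)\<bar> \<le> \<bar>c (p, t)\<bar> * (C * M * barrier l' p)"
    unfolding abs_mult by (rule mult_left_mono) simp
  also have "\<dots> = C * M * (\<bar>c (p, t)\<bar> * barrier l' p)" by simp
  also have "\<dots> \<le> C * M * (1 / (l - l') * barrier l p)"
    using C \<open>0 \<le> M\<close> assms(3)[of "(p, t)"] by (intro mult_left_mono mult_barrier_le assms(2)) auto
  finally show "\<bar>c (p, t) * O1 G (p, t)\<bar> \<le> C / (l - l') * M * barrier l p" by simp
qed

text \<open>The convolution raises the rate by the factor 4, and every coordinate factor by an
  arbitrarily small amount. Placing \<open>l'\<close> halfway between \<open>4 * k\<close> and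
  \<open>l\<close> leaves room for any number of such factors.\<close>

lemma Op_bound:
  assumes "Op n O1" "k \<ge> 0" "4 * k < l"
  shows "\<exists>C. bounded_op k l O1 C"
  using assms(1,3)
proof (induction arbitrary: l rule: Op.induct)
  case (Op_conv n \<psi>)
  have "bounded_op k l (conv \<psi>) (\<integral>v. \<bar>\<psi> v\<bar> \<partial>lborel)"
    unfolding bounded_op_def
  proof (intro conjI allI impI)
    show nn: "0 \<le> (\<integral>v. \<bar>\<psi> v\<bar> \<partial>lborel)" by (rule integral_nonneg_AE) simp
    fix G :: "heis \<times> real \<Rightarrow> real" and M :: real and p and t :: real
    assume G: "continuous_on UNIV G" "(0::real) \<le> M" "\<forall>q s. \<bar>G (q, s)\<bar> \<le> M * barrier k q"
    have "\<bar>conv \<psi> G (p, t)\<bar> \<le> (\<integral>v. \<bar>\<psi> v\<bar> \<partial>lborel) * (M * barrier (4 * k) p)"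
      by (rule conv_bound[OF Op_conv(1) G(1) assms(2) G(2)]) (use G(3) in blast)
    also have "\<dots> \<le> (\<integral>v. \<bar>\<psi> v\<bar> \<partial>lborel) * (M * barrier l p)"
      using Op_conv(2) nn G(2) by (intro mult_left_mono barrier_mono) auto
    finally show "\<bar>conv \<psi> G (p, t)\<bar> \<le> (\<integral>v. \<bar>\<psi> v\<bar> \<partial>lborel) * M * barrier l p" by simp
  qed
  then show ?case ..
next
  case (Op_lin n O1 O2 c d)
  from Op_lin.IH(1)[OF Op_lin.prems] Op_lin.IH(2)[OF Op_lin.prems] obtain C1 C2 where C: "bounded_op k l O1 C1" "bounded_op k l O2 C2" by blast
  have "bounded_op k l (op_lin c O1 d O2) (\<bar>c\<bar> * C1 + \<bar>d\<bar> * C2)"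
    unfolding bounded_op_def op_lin_def
  proof (intro conjI allI impI)
    show "0 \<le> \<bar>c\<bar> * C1 + \<bar>d\<bar> * C2" using C by (simp add: bounded_op_def)
    fix G :: "heis \<times> real \<Rightarrow> real" and M :: real and p and t :: real
    assume "continuous_on UNIV G" "(0::real) \<le> M" "\<forall>q s. \<bar>G (q, s)\<bar> \<le> M * barrier k q"
    then have "\<bar>O1 G (p, t)\<bar> \<le> C1 * M * barrier l p" "\<bar>O2 G (p, t)\<bar> \<le> C2 * M * barrier l p"
      using C unfolding bounded_op_def by blast+
    then have "\<bar>c\<bar> * \<bar>O1 G (p, t)\<bar> + \<bar>d\<bar> * \<bar>O2 G (p, t)\<bar> \<le> \<bar>c\<bar> * (C1 * M * barrier l p) + \<bar>d\<bar> * (C2 * M * barrier l p)"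
      by (intro add_mono mult_left_mono) auto
    moreover have "\<bar>c * O1 G (p, t) + d * O2 G (p, t)\<bar> \<le> \<bar>c\<bar> * \<bar>O1 G (p, t)\<bar> + \<bar>d\<bar> * \<bar>O2 G (p, t)\<bar>"
      unfolding abs_mult[symmetric] by (rule abs_triangle_ineq)
    ultimately show "\<bar>c * O1 G (p, t) + d * O2 G (p, t)\<bar> \<le> (\<bar>c\<bar> * C1 + \<bar>d\<bar> * C2) * M * barrier l p"
      by (simp add: algebra_simps)
  qed
  then show ?case ..
next
  case (Op_x n O1)
  define l' where "l' = (4 * k + l) / 2"
  have l': "4 * k < l'" "l' < l" using Op_x.prems by (simp_all add: l'_def)
  obtain C where "bounded_op k l' O1 C" using Op_x.IH[OF l'(1)] by blast
  from bounded_op_mult_coord[OF this l'(2), of "\<lambda>w. fst (fst w)"]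
  have "bounded_op k l (op_x O1) (C / (l - l'))" unfolding op_x_def using sgauge_bounds(2) by simp
  then show ?case ..
next
  case (Op_y n O1)
  define l' where "l' = (4 * k + l) / 2"
  have l': "4 * k < l'" "l' < l" using Op_y.prems by (simp_all add: l'_def)
  obtain C where "bounded_op k l' O1 C" using Op_y.IH[OF l'(1)] by blast
  from bounded_op_mult_coord[OF this l'(2), of "\<lambda>w. fst (snd (fst w))"]
  have "bounded_op k l (op_y O1) (C / (l - l'))" unfolding op_y_def using sgauge_bounds(3) by simp
  then show ?case ..
qed

lemma DX_coord:
  "DX v (\<lambda>p. fst p) p = fst v" "DX v (\<lambda>p. fst (snd p)) p = snd v"
  using DX_fd[OF bounded_linear_imp_has_derivative[OF bounded_linear_coords(3)]]
    DX_fd[OF bounded_linear_imp_has_derivative[OF bounded_linear_coords(1)]] by simp_all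

definition realizes :: "((heis \<Rightarrow> real) \<Rightarrow> heis \<Rightarrow> real) \<Rightarrow> ((heis \<times> real \<Rightarrow> real) \<Rightarrow> heis \<times> real \<Rightarrow> real)
    \<Rightarrow> ((heis \<times> real \<Rightarrow> real) \<Rightarrow> heis \<times> real \<Rightarrow> real) \<Rightarrow> bool" where
  "realizes D O1 O2 \<longleftrightarrow> (\<forall>G t. continuous_on UNIV G \<longrightarrow> D (\<lambda>q. O1 G (q, t)) = (\<lambda>p. O2 G (p, t)))"

lemma realizesD: "realizes D O1 O2 \<Longrightarrow> continuous_on UNIV G \<Longrightarrow> D (\<lambda>q. O1 G (q, t)) = (\<lambda>p. O2 G (p, t))"
  unfolding realizes_def by blast

lemma realizesD_apply: "realizes D O1 O2 \<Longrightarrow> continuous_on UNIV G \<Longrightarrow> D (\<lambda>q. O1 G (q, t)) p = O2 G (p, t)"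
  using realizesD by metis

lemma realizesI:
  assumes "\<And>G t p. continuous_on UNIV G \<Longrightarrow> D (\<lambda>q. O1 G (q, t)) p = O2 G (p, t)"
  shows "realizes D O1 O2"
  unfolding realizes_def using assms by (intro allI impI ext)

lemma realizes_comp: "realizes D O1 O2 \<Longrightarrow> realizes E O2 O3 \<Longrightarrow> realizes (\<lambda>g. E (D g)) O1 O3"
  unfolding realizes_def by simp

text \<open>A convolution is differentiated through its kernel, and the product rule on a coordinate
  factor returns the original operator times a component of \<open>v\<close>, so no new kind of
  operator arises. The premise \<open>m = Suc n\<close> keeps the index a variable for the rule
  induction.\<close>

lemma Op_DX_aux: "Op m O1 \<Longrightarrow> m = Suc n \<Longrightarrow> \<exists>O2. Op n O2 \<and> realizes (DX v) O1 O2"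
proof (induction rule: Op.induct)
  case (Op_conv m \<psi>)
  note \<psi> = Op_conv(1)[unfolded Op_conv(2)]
  note d = test_fun_derivs[OF \<psi>]
  let ?O = "op_lin (fst v) (op_lin 1 (conv (R1 \<psi>)) (- 1) (op_y (conv (Zd \<psi>))))
     (snd v) (op_lin 1 (conv (R2 \<psi>)) 1 (op_x (conv (Zd \<psi>))))"
  have "Op n ?O" by (intro Op.intros d)
  moreover have "realizes (DX v) (conv \<psi>) ?O"
    by (rule realizesI) (simp add: DX_def X_conv[OF \<psi>] op_lin_def op_x_def op_y_def)
  ultimately show ?case by blast
next
  case (Op_lin m O1 O2 c d)
  then obtain Q1 Q2 where Q: "Op n Q1" "Op n Q2" "realizes (DX v) O1 Q1" "realizes (DX v) O2 Q2" by blast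
  have "realizes (DX v) (op_lin c O1 d O2) (op_lin c Q1 d Q2)"
  proof (rule realizesI)
    fix G t p assume G: "continuous_on UNIV (G :: heis \<times> real \<Rightarrow> real)"
    have "Ck (Suc n) (\<lambda>q. O1 G (q, t))" "Ck (Suc n) (\<lambda>q. O2 G (q, t))"
      using Op_lin G by (auto intro: Ck_slice Ck_Op)
    from DX_linear[OF this] realizesD_apply[OF Q(3) G] realizesD_apply[OF Q(4) G]
    show "DX v (\<lambda>q. op_lin c O1 d O2 G (q, t)) p = op_lin c Q1 d Q2 G (p, t)"
      by (simp add: op_lin_def)
  qed
  with Op.Op_lin[OF Q(1,2)] show ?case by blast
next
  case (Op_x m O1)
  then obtain Q where Q: "Op n Q" "realizes (DX v) O1 Q" by blast
  let ?O = "op_lin (fst v) O1 1 (op_x Q)"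
  have "Op n ?O" by (intro Op.intros Q Op_mono[OF Op_x(1)]) (simp add: Op_x)
  moreover have "realizes (DX v) (op_x O1) ?O"
  proof (rule realizesI)
    fix G t p assume G: "continuous_on UNIV (G :: heis \<times> real \<Rightarrow> real)"
    have "Ck (Suc n) (\<lambda>q. O1 G (q, t))" using Op_x G by (auto intro: Ck_slice Ck_Op)
    from DX_mult[OF Ck_coords(3) this] realizesD_apply[OF Q(2) G]
    show "DX v (\<lambda>q. op_x O1 G (q, t)) p = ?O G (p, t)"
      by (simp add: DX_coord op_lin_def op_x_def)
  qed
  ultimately show ?case by blast
next
  case (Op_y m O1)
  then obtain Q where Q: "Op n Q" "realizes (DX v) O1 Q" by blast
  let ?O = "op_lin (snd v) O1 1 (op_y Q)"
  have "Op n ?O" by (intro Op.intros Q Op_mono[OF Op_y(1)]) (simp add: Op_y)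
  moreover have "realizes (DX v) (op_y O1) ?O"
  proof (rule realizesI)
    fix G t p assume G: "continuous_on UNIV (G :: heis \<times> real \<Rightarrow> real)"
    have "Ck (Suc n) (\<lambda>q. O1 G (q, t))" using Op_y G by (auto intro: Ck_slice Ck_Op)
    from DX_mult[OF Ck_coords(1) this] realizesD_apply[OF Q(2) G]
    show "DX v (\<lambda>q. op_y O1 G (q, t)) p = ?O G (p, t)"
      by (simp add: DX_coord op_lin_def op_y_def)
  qed
  ultimately show ?case by blast
qed

lemma Op_DX: "Op (Suc n) O1 \<Longrightarrow> \<exists>O2. Op n O2 \<and> realizes (DX v) O1 O2"
  by (rule Op_DX_aux[OF _ refl])

lemma Op_DX_DX:
  assumes "Op (Suc (Suc n)) O1"
  shows "\<exists>O2. Op n O2 \<and> realizes (\<lambda>g. DX v (DX v g)) O1 O2"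
proof -
  obtain A where A: "Op (Suc n) A" "realizes (DX v) O1 A" using Op_DX[OF assms] by blast
  obtain B where B: "Op n B" "realizes (DX v) A B" using Op_DX[OF A(1)] by blast
  from B(1) realizes_comp[OF A(2) B(2)] show ?thesis by blast
qed

section \<open>Uniform derivative bounds for mollified functions\<close>

context generator begin

lemma Op_gen:
  assumes "Op (Suc (Suc n)) O1"
  shows "\<exists>O2. Op n O2 \<and> realizes gen O1 O2"
proof -
  obtain B1 where B1: "Op n B1" "realizes (\<lambda>g. DX s1 (DX s1 g)) O1 B1" using Op_DX_DX[OF assms] by blast
  obtain B2 where B2: "Op n B2" "realizes (\<lambda>g. DX s2 (DX s2 g)) O1 B2" using Op_DX_DX[OF assms] by blast
  obtain A3 where A3: "Op (Suc n) A3" "realizes (DX b) O1 A3" using Op_DX[OF assms] by blast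
  have "Op n A3" using Op_mono[OF A3(1)] by simp
  then have "Op n (op_lin 1 (op_lin 1 B1 1 B2) (- 1) A3)" by (intro Op_lin B1 B2)
  moreover have "realizes gen O1 (op_lin 1 (op_lin 1 B1 1 B2) (- 1) A3)"
  proof (rule realizesI)
    fix G t p assume G: "continuous_on UNIV (G :: heis \<times> real \<Rightarrow> real)"
    show "gen (\<lambda>q. O1 G (q, t)) p = op_lin 1 (op_lin 1 B1 1 B2) (- 1) A3 G (p, t)"
      unfolding gen_def op_lin_def realizesD_apply[OF B1(2) G] realizesD_apply[OF B2(2) G] realizesD_apply[OF A3(2) G] by simp
  qed
  ultimately show ?thesis by (intro exI conjI)
qed

text \<open>The list collects what \<open>step_minus_gen\<close> asks of \<open>g\<close>, what
  \<open>step_minus_id\<close> asks of \<open>gen g\<close>, and the bounds on \<open>g\<close>,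
  \<open>gen g\<close> and \<open>gen (gen g)\<close> that enter \<open>strip\<close>.\<close>

definition smooth_bound :: "real \<Rightarrow> real \<Rightarrow> (heis \<Rightarrow> real) \<Rightarrow> bool" where
  "smooth_bound l C g \<longleftrightarrow> Ck 4 g \<and> (\<forall>p. \<bar>g p\<bar> \<le> C * barrier l p \<and> \<bar>gen g p\<bar> \<le> C * barrier l p
     \<and> \<bar>gen (gen g) p\<bar> \<le> C * barrier l p
     \<and> \<bar>(DX s1 ^^ 4) g p\<bar> \<le> C * barrier l p \<and> \<bar>(DX s2 ^^ 4) g p\<bar> \<le> C * barrier l p
     \<and> \<bar>DX b (DX b g) p\<bar> \<le> C * barrier l p
     \<and> \<bar>DX s1 (DX s1 (gen g)) p\<bar> \<le> C * barrier l p \<and> \<bar>DX s2 (DX s2 (gen g)) p\<bar> \<le> C * barrier l p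
     \<and> \<bar>DX b (gen g) p\<bar> \<le> C * barrier l p)"

definition conv_smooth_const :: "real \<Rightarrow> real \<Rightarrow> (heis \<times> real \<Rightarrow> real) \<Rightarrow> real \<Rightarrow> bool" where
  "conv_smooth_const k l \<psi> C \<longleftrightarrow> C \<ge> 0 \<and> (\<forall>G M t. continuous_on UNIV G \<longrightarrow> M \<ge> 0 \<longrightarrow>
     (\<forall>q s. \<bar>G (q, s)\<bar> \<le> M * barrier k q) \<longrightarrow> smooth_bound l (C * M) (\<lambda>q. conv \<psi> G (q, t)))"

lemma conv_smooth_constD:
  assumes "conv_smooth_const k l \<psi> C"
  shows "C \<ge> 0" "continuous_on UNIV G \<Longrightarrow> M \<ge> 0 \<Longrightarrow> (\<And>q s. \<bar>G (q, s)\<bar> \<le> M * barrier k q)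
     \<Longrightarrow> smooth_bound l (C * M) (\<lambda>q. conv \<psi> G (q, t))"
  using assms unfolding conv_smooth_const_def by blast+

lemma conv_smooth_const_exists:
  assumes \<psi>: "test_fun 4 \<psi>" and k: "k \<ge> 0" "4 * k < l"
  shows "\<exists>C. conv_smooth_const k l \<psi> C"
proof -
  have O0: "Op (Suc (Suc (Suc (Suc 0)))) (conv \<psi>)" using \<psi> by (intro Op_conv) (simp add: eval_nat_numeral)
  obtain O1 where O1: "Op (Suc (Suc 0)) O1" "realizes gen (conv \<psi>) O1" using Op_gen[OF O0] by blast
  obtain O2 where O2: "Op 0 O2" "realizes gen O1 O2" using Op_gen[OF O1(1)] by blast
  obtain O3' where O3': "Op (Suc (Suc 0)) O3'" "realizes (\<lambda>g. DX s1 (DX s1 g)) (conv \<psi>) O3'"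
    using Op_DX_DX[OF O0] by blast
  obtain O3 where O3: "Op 0 O3" "realizes (\<lambda>g. DX s1 (DX s1 g)) O3' O3" using Op_DX_DX[OF O3'(1)] by blast
  obtain O4' where O4': "Op (Suc (Suc 0)) O4'" "realizes (\<lambda>g. DX s2 (DX s2 g)) (conv \<psi>) O4'"
    using Op_DX_DX[OF O0] by blast
  obtain O4 where O4: "Op 0 O4" "realizes (\<lambda>g. DX s2 (DX s2 g)) O4' O4" using Op_DX_DX[OF O4'(1)] by blast
  obtain O5 where O5: "Op (Suc (Suc 0)) O5" "realizes (\<lambda>g. DX b (DX b g)) (conv \<psi>) O5"
    using Op_DX_DX[OF O0] by blast
  obtain O6 where O6: "Op 0 O6" "realizes (\<lambda>g. DX s1 (DX s1 g)) O1 O6" using Op_DX_DX[OF O1(1)] by blast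
  obtain O7 where O7: "Op 0 O7" "realizes (\<lambda>g. DX s2 (DX s2 g)) O1 O7" using Op_DX_DX[OF O1(1)] by blast
  obtain O8 where O8: "Op (Suc 0) O8" "realizes (DX b) O1 O8" using Op_DX[OF O1(1)] by blast
  let ?S = "{conv \<psi>, O1, O2, O3, O4, O5, O6, O7, O8}"
  have "\<forall>O'\<in>?S. \<exists>C. bounded_op k l O' C"
    by (simp add: Op_bound[OF O0 k] Op_bound[OF O1(1) k] Op_bound[OF O2(1) k] Op_bound[OF O3(1) k]
      Op_bound[OF O4(1) k] Op_bound[OF O5(1) k] Op_bound[OF O6(1) k] Op_bound[OF O7(1) k] Op_bound[OF O8(1) k])
  from bounded_op_finite[OF _ this] obtain C where C: "\<forall>O'\<in>?S. bounded_op k l O' C" by auto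
  have "conv_smooth_const k l \<psi> C"
    unfolding conv_smooth_const_def
  proof (intro conjI allI impI)
    show "C \<ge> 0" using C by (simp add: bounded_op_def)
    fix G :: "heis \<times> real \<Rightarrow> real" and M t :: real
    assume G: "continuous_on UNIV G" "M \<ge> 0" "\<forall>q s. \<bar>G (q, s)\<bar> \<le> M * barrier k q"
    have bd: "\<bar>O' G (p, t)\<bar> \<le> C * M * barrier l p" if "O' \<in> ?S" for O' p
      using bspec[OF C that] G unfolding bounded_op_def by blast
    note e = realizesD[OF O1(2) G(1)] realizesD[OF O2(2) G(1)] realizesD[OF O3'(2) G(1)] realizesD[OF O3(2) G(1)]
      realizesD[OF O4'(2) G(1)] realizesD[OF O4(2) G(1)] realizesD[OF O5(2) G(1)] realizesD[OF O6(2) G(1)]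
      realizesD[OF O7(2) G(1)] realizesD[OF O8(2) G(1)]
    have p4: "(D ^^ 4) g = D (D (D (D g)))" for D :: "(heis \<Rightarrow> real) \<Rightarrow> heis \<Rightarrow> real" and g
      by (simp add: eval_nat_numeral)
    have "Ck 4 (\<lambda>q. conv \<psi> G (q, t))" by (intro Ck_slice Ck_conv \<psi> G)
    then show "smooth_bound l (C * M) (\<lambda>q. conv \<psi> G (q, t))"
      unfolding smooth_bound_def p4 e
      by (intro conjI allI bd) simp_all
  qed
  then show ?thesis ..
qed

text \<open>Associativity: left division by the integration point commutes with right multiplication
  by a jump.\<close>

lemma step_conv:
  assumes \<psi>: "test_fun n \<psi>" and G: "continuous_on UNIV G"
  shows "step \<tau> (\<lambda>q. conv \<psi> G (q, t)) p = conv \<psi> (\<lambda>v. step \<tau> (\<lambda>q. G (q, snd v)) (fst v)) (p, t)"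
proof -
  have "ldiv v (p \<cdot>\<^sub>H \<xi>, t) = (fst (ldiv v (p, t)) \<cdot>\<^sub>H \<xi>, snd (ldiv v (p, t)))" for v \<xi>
    by (simp add: ldiv_def hmul_assoc del: hmul.simps)
  then have int: "integrable lborel (\<lambda>v. \<psi> v * G (fst (ldiv v (p, t)) \<cdot>\<^sub>H \<xi>, snd (ldiv v (p, t))))"
    and eq: "conv \<psi> G (p \<cdot>\<^sub>H \<xi>, t) = (\<integral>v. \<psi> v * G (fst (ldiv v (p, t)) \<cdot>\<^sub>H \<xi>, snd (ldiv v (p, t))) \<partial>lborel)" for \<xi>
    using conv_integrable[OF \<psi> G, of "(p \<cdot>\<^sub>H \<xi>, t)"] by (simp_all add: conv_def)
  show ?thesis
    unfolding step_def eq unfolding conv_def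
    by (simp add: ring_distribs int)
qed

end

section \<open>Mollifiers\<close>

lemma conv_close:
  assumes \<psi>: "test_fun n \<psi>" and G: "continuous_on UNIV G"
    and nn: "\<And>v. \<psi> v \<ge> 0" and one: "(\<integral>v. \<psi> v \<partial>lborel) = 1"
    and cl: "\<And>v. \<psi> v \<noteq> 0 \<Longrightarrow> \<bar>G (ldiv v w) - c\<bar> \<le> e"
  shows "\<bar>conv \<psi> G w - c\<bar> \<le> e"
proof -
  have i: "integrable lborel \<psi>" using test_fun_abs_integrable[OF \<psi>] nn by simp
  have "\<psi> v * G (ldiv v w) \<le> \<psi> v * (c + e)" "\<psi> v * (c - e) \<le> \<psi> v * G (ldiv v w)" for v
    using cl[of v] nn[of v] by (cases "\<psi> v = 0"; auto simp: abs_le_iff intro!: mult_left_mono)+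
  then have "conv \<psi> G w \<le> (\<integral>v. \<psi> v * (c + e) \<partial>lborel)" "(\<integral>v. \<psi> v * (c - e) \<partial>lborel) \<le> conv \<psi> G w"
    unfolding conv_def by (intro integral_mono integrable_mult_left i conv_integrable[OF \<psi> G]; simp)+
  then have "conv \<psi> G w \<le> c + e" "c - e \<le> conv \<psi> G w" by (simp_all add: one)
  then show ?thesis by (simp add: abs_le_iff)
qed

text \<open>The kernel only sees times \<open>t - snd v \<ge> t\<close>, so that mollification is possible up to the initial time.\<close>

definition mollifier :: "real \<Rightarrow> (heis \<times> real \<Rightarrow> real) \<Rightarrow> bool" where
  "mollifier \<delta> \<psi> \<longleftrightarrow> test_fun 4 \<psi> \<and> (\<forall>v. \<psi> v \<ge> 0) \<and> (\<integral>v. \<psi> v \<partial>lborel) = 1 \<and>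
     (\<forall>v. \<psi> v \<noteq> 0 \<longrightarrow> \<bar>fst (fst v)\<bar> \<le> \<delta> \<and> \<bar>fst (snd (fst v))\<bar> \<le> \<delta> \<and> \<bar>snd (snd (fst v))\<bar> \<le> \<delta>
        \<and> - \<delta> \<le> snd v \<and> snd v \<le> 0)"

lemma mollifierD:
  assumes "mollifier \<delta> \<psi>"
  shows "test_fun 4 \<psi>" "\<psi> v \<ge> 0" "(\<integral>v. \<psi> v \<partial>lborel) = 1"
    "\<psi> v \<noteq> 0 \<Longrightarrow> \<bar>fst (fst v)\<bar> \<le> \<delta>" "\<psi> v \<noteq> 0 \<Longrightarrow> \<bar>fst (snd (fst v))\<bar> \<le> \<delta>"
    "\<psi> v \<noteq> 0 \<Longrightarrow> \<bar>snd (snd (fst v))\<bar> \<le> \<delta>" "\<psi> v \<noteq> 0 \<Longrightarrow> - \<delta> \<le> snd v" "\<psi> v \<noteq> 0 \<Longrightarrow> snd v \<le> 0"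
  using assms unfolding mollifier_def by blast+

lemma mollifier_exists:
  assumes \<delta>: "0 < \<delta>" "\<delta> \<le> 1"
  shows "\<exists>\<psi>. mollifier \<delta> \<psi>"
proof -
  \<comment> \<open>The fifth power is the smallest that \<open>Ck_max_power\<close> places in class
    \<open>Ck 4\<close>.\<close>
  define bump where "bump s = max 0 (1 - s\<^sup>2) ^ 5" for s :: real
  have bump_nn: "bump s \<ge> 0" for s by (simp add: bump_def)
  have bump_le: "\<bar>s\<bar> \<le> 1" if "bump s \<noteq> 0" for s
  proof -
    have "1 - s\<^sup>2 > 0" using that by (auto simp: bump_def max_def split: if_splits)
    then have "s\<^sup>2 \<le> 1" by linarith
    then show ?thesis by (simp only: abs_square_le_1)
  qed
  \<comment> \<open>In the last factor 2 t / \<delta> + 1 maps the interval from - \<delta> to 0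
    onto that from - 1 to 1, which makes the support one-sided in time.\<close>
  define \<psi> where "\<psi> v = bump (fst (fst v) / \<delta>) * bump (fst (snd (fst v)) / \<delta>) * bump (snd (snd (fst v)) / \<delta>) * bump (2 * snd v / \<delta> + 1)"
    for v :: "heis \<times> real"
  have supp: "\<bar>fst (fst v)\<bar> \<le> \<delta> \<and> \<bar>fst (snd (fst v))\<bar> \<le> \<delta> \<and> \<bar>snd (snd (fst v))\<bar> \<le> \<delta>
        \<and> - \<delta> \<le> snd v \<and> snd v \<le> 0" if "\<psi> v \<noteq> 0" for v
  proof -
    have nz: "bump (fst (fst v) / \<delta>) \<noteq> 0" "bump (fst (snd (fst v)) / \<delta>) \<noteq> 0"
      "bump (snd (snd (fst v)) / \<delta>) \<noteq> 0" "bump (2 * snd v / \<delta> + 1) \<noteq> 0"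
      using that by (auto simp: \<psi>_def)
    from nz[THEN bump_le] show ?thesis using \<delta> by (simp add: abs_le_iff field_simps)
  qed
  have ub: "\<psi> v = 0" if "v \<notin> ubox" for v
    using supp[of v] that \<delta> unfolding ubox_iff by fastforce
  have lin: "Ck n (\<lambda>v::heis \<times> real. fst (fst v))" "Ck n (\<lambda>v::heis \<times> real. fst (snd (fst v)))"
     "Ck n (\<lambda>v::heis \<times> real. snd (snd (fst v)))" for n
    by (intro Ck_linear bounded_linear_compose[OF bounded_linear_coords(3) bounded_linear_fst]
       bounded_linear_compose[OF bounded_linear_coords(1) bounded_linear_fst]
       bounded_linear_compose[OF bounded_linear_coords(2) bounded_linear_fst])+
  have B: "Ck 4 (\<lambda>v::heis \<times> real. bump (L v))" if "\<And>n. Ck n L" for L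
    unfolding bump_def by (intro Ck_max_power Ck_diff Ck_const Ck_power that) simp
  have L: "Ck n (\<lambda>v::heis \<times> real. fst (fst v) / \<delta>)" "Ck n (\<lambda>v::heis \<times> real. fst (snd (fst v)) / \<delta>)"
    "Ck n (\<lambda>v::heis \<times> real. snd (snd (fst v)) / \<delta>)" "Ck n (\<lambda>v::heis \<times> real. 2 * snd v / \<delta> + 1)" for n
    using Ck_cmult[OF lin(1), of n "1 / \<delta>"] Ck_cmult[OF lin(2), of n "1 / \<delta>"] Ck_cmult[OF lin(3), of n "1 / \<delta>"]
      Ck_add[OF Ck_cmult[OF Ck_time, of n "2 / \<delta>"] Ck_const, of 1] by simp_all
  have "Ck 4 \<psi>" unfolding \<psi>_def[abs_def] by (intro Ck_mult B L)
  then have tf: "test_fun 4 \<psi>" using ub by (auto simp: test_fun_def)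
  have nn: "\<psi> v \<ge> 0" for v by (simp add: \<psi>_def bump_nn)
  define I where "I = (\<integral>v. \<psi> v \<partial>lborel)"
  have "I \<ge> 0" unfolding I_def by (rule integral_nonneg_AE) (simp add: nn)
  \<comment> \<open>A continuous nonnegative function with integral zero vanishes, whereas \<psi>
    equals 1 at the centre of its support, the spatial origin at time - \<delta> / 2.\<close>
  moreover have "I \<noteq> 0"
  proof
    assume "I = 0"
    have "I = integral ubox \<psi>" unfolding I_def
      by (rule integrable_compact_support(2)[OF test_fun_continuous[OF tf]]) (auto simp: ubox_def compact_cbox ub[unfolded ubox_def])
    moreover have "\<psi> integrable_on ubox" unfolding ubox_def
      by (intro integrable_continuous test_fun_continuous[OF tf])
    ultimately have "(\<psi> has_integral 0) ubox" using \<open>I = 0\<close> by (metis integrable_integral)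
    moreover have "((0, 0, 0), - \<delta> / 2) \<in> ubox" using \<delta> by (simp add: ubox_iff)
    moreover have "box ((- 1, - 1, - 1), - 1) ((1, 1, 1), 1 :: real) \<noteq> ({} :: (heis \<times> real) set)"
      by (auto simp: box_ne_empty Basis_prod_def)
    ultimately have "\<psi> ((0, 0, 0), - \<delta> / 2) = 0"
      unfolding ubox_def by (intro has_integral_0_cbox_imp_0[OF test_fun_continuous[OF tf] nn])
    then show False using \<delta> by (simp add: \<psi>_def bump_def)
  qed
  ultimately have I: "I > 0" by simp
  have "mollifier \<delta> (\<lambda>v. 1 / I * \<psi> v)"
    unfolding mollifier_def
  proof (intro conjI allI impI)
    show "test_fun 4 (\<lambda>v. 1 / I * \<psi> v)"
      using Ck_cmult[of 4 \<psi> "1 / I"] tf test_fun_zero[OF tf] by (simp add: test_fun_def)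
    show "(\<integral>v. 1 / I * \<psi> v \<partial>lborel) = 1" using I by (simp flip: I_def)
  qed (use I nn supp in auto)
  then show ?thesis by (intro exI)
qed

section \<open>A weighted modulus of continuity under small left translations and time
  shifts\<close>

definition translation_modulus :: "(heis \<times> real \<Rightarrow> real) \<Rightarrow> real \<Rightarrow> real \<Rightarrow> real \<Rightarrow> real \<Rightarrow> bool" where
  "translation_modulus u T l e \<delta> \<longleftrightarrow> 0 < \<delta> \<and> \<delta> \<le> 1 \<and>
    (\<forall>q p t t'. \<bar>fst q\<bar> \<le> \<delta> \<longrightarrow> \<bar>fst (snd q)\<bar> \<le> \<delta> \<longrightarrow> \<bar>snd (snd q)\<bar> \<le> \<delta> \<longrightarrow> t \<in> {0..T} \<longrightarrow> t' \<in> {0..T}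
       \<longrightarrow> \<bar>t - t'\<bar> \<le> \<delta> \<longrightarrow> \<bar>u (hinv q \<cdot>\<^sub>H p, t') - u (p, t)\<bar> \<le> e * barrier l p)"

lemma translation_modulusD:
  assumes "translation_modulus u T l e \<delta>"
  shows "0 < \<delta>" "\<delta> \<le> 1" "\<bar>fst q\<bar> \<le> \<delta> \<Longrightarrow> \<bar>fst (snd q)\<bar> \<le> \<delta> \<Longrightarrow> \<bar>snd (snd q)\<bar> \<le> \<delta> \<Longrightarrow> t \<in> {0..T}
      \<Longrightarrow> t' \<in> {0..T} \<Longrightarrow> \<bar>t - t'\<bar> \<le> \<delta> \<Longrightarrow> \<bar>u (hinv q \<cdot>\<^sub>H p, t') - u (p, t)\<bar> \<le> e * barrier l p"
  using assms unfolding translation_modulus_def by blast+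

text \<open>On a sublevel set of the gauge this is uniform continuity on a compact set. Outside it,
  both values are bounded by \<open>M * barrier (4 * k) p\<close>, which the weight of larger rate
  dominates; no continuity is used there.\<close>

lemma translation_modulus_exists:
  fixes u :: "heis \<times> real \<Rightarrow> real"
  assumes u: "continuous_on (UNIV \<times> {0..}) u" and k: "k \<ge> 0" "4 * k < l" and M: "M \<ge> 0"
    and bd: "\<And>p t. t \<in> {0..T} \<Longrightarrow> \<bar>u (p, t)\<bar> \<le> M * barrier k p" and e: "e > 0"
  shows "\<exists>\<delta>. translation_modulus u T l e \<delta>"
proof -
  obtain R where R: "\<And>p. sgauge p > R \<Longrightarrow> 2 * M * barrier (4 * k) p < e * barrier l p"
    using barrier_dominates[OF k(2) e] by blast
  define S where "S = closure {p. sgauge p \<le> R}"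
  define K where "K = (cbox (-1, -1, -1) (1, 1, 1) :: heis set) \<times> S \<times> {0..T}"
  have "compact S" unfolding S_def by (simp add: compact_closure sgauge_sublevel_bounded)
  then have K: "compact K" unfolding K_def by (intro compact_Times compact_cbox) auto
  define F where "F = (\<lambda>(q, p, t). u (hinv q \<cdot>\<^sub>H p, t))"
  have "continuous_on K F"
    unfolding F_def case_prod_beta
    by (rule continuous_on_compose2[OF u]) (auto intro!: continuous_intros simp: K_def)
  then have "uniformly_continuous_on K F" by (rule compact_uniformly_continuous[OF _ K])
  then obtain \<eta> where \<eta>: "\<eta> > 0" "\<And>x x'. x \<in> K \<Longrightarrow> x' \<in> K \<Longrightarrow> dist x' x < \<eta> \<Longrightarrow> dist (F x') (F x) < e"
    unfolding uniformly_continuous_on_def using e by metis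
  \<comment> \<open>Three coordinates of \<open>q\<close> and one time shift, each at most \<delta>,
    add up to 4 \<delta> < \<eta>.\<close>
  define \<delta> where "\<delta> = min 1 (\<eta> / 5)"
  have \<delta>: "0 < \<delta>" "\<delta> \<le> 1" "4 * \<delta> < \<eta>" using \<eta>(1) by (auto simp: \<delta>_def)
  have "translation_modulus u T l e \<delta>"
    unfolding translation_modulus_def
  proof (intro conjI allI impI \<delta>)
    fix q p :: heis and t t' :: real
    assume q: "\<bar>fst q\<bar> \<le> \<delta>" "\<bar>fst (snd q)\<bar> \<le> \<delta>" "\<bar>snd (snd q)\<bar> \<le> \<delta>"
      and t: "t \<in> {0..T}" "t' \<in> {0..T}" "\<bar>t - t'\<bar> \<le> \<delta>"
    show "\<bar>u (hinv q \<cdot>\<^sub>H p, t') - u (p, t)\<bar> \<le> e * barrier l p"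
    proof (cases "sgauge p > R")
      case True
      have "barrier k (hinv q \<cdot>\<^sub>H p) \<le> barrier (4 * k) p"
        using barrier_translate[of 1 "hinv q" k p] q \<delta> k by (simp add: hinv_eq del: hmul.simps)
      then have "\<bar>u (hinv q \<cdot>\<^sub>H p, t')\<bar> \<le> M * barrier (4 * k) p"
        using bd[OF t(2), of "hinv q \<cdot>\<^sub>H p"] mult_left_mono[OF _ M] by (meson order_trans)
      moreover have "\<bar>u (p, t)\<bar> \<le> M * barrier (4 * k) p"
        using bd[OF t(1), of p] mult_left_mono[OF barrier_mono[of k "4 * k" p] M] k by linarith
      ultimately show ?thesis using R[OF True] by linarith
    next
      case False
      then have pS: "p \<in> S" using closure_subset[of "{p. sgauge p \<le> R}"] by (auto simp: S_def)
      have 1: "(q, p, t') \<in> K" "(0, p, t) \<in> K"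
        using q \<delta> pS t by (auto simp: K_def cbox_Pair_eq zero_prod_def abs_le_iff mem_Times_iff intro!: exI[of _ q])
      have "norm q \<le> \<bar>fst q\<bar> + (\<bar>fst (snd q)\<bar> + \<bar>snd (snd q)\<bar>)"
        using norm_Pair_le[of "fst q" "snd q"] norm_Pair_le[of "fst (snd q)" "snd (snd q)"] by simp
      then have "norm (q, (0 :: heis), t' - t) \<le> 4 * \<delta>"
        using norm_Pair_le[of q "(0 :: heis, t' - t)"] norm_Pair_le[of "0 :: heis" "t' - t"] q t(3) by simp
      then have "dist (q, p, t') (0, p, t) < \<eta>" using \<delta>(3) by (simp add: dist_norm)
      from \<eta>(2)[OF 1(2,1) this] have "\<bar>u (hinv q \<cdot>\<^sub>H p, t') - u (p, t)\<bar> < e"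
        by (simp add: F_def dist_real_def hinv_eq hmul_eq)
      also have "e \<le> e * barrier l p" using barrier_ge_1[of l p] k e by simp
      finally show ?thesis by simp
    qed
  qed
  then show ?thesis ..
qed

section \<open>Supersolutions dominate the random walk\<close>

lemma strip_profile_deriv:
  fixes A0 :: real
  shows "((\<lambda>s. A0 + (s - a) * B0 - c0 - c * (s - a) - (K * (s - a)\<^sup>2 + E * exp (L * (s - a))) * B)
    has_real_derivative (B0 - c - (2 * K * (t - a) + E * L * exp (L * (t - a))) * B)) (at t)"
  by (rule derivative_eq_intros refl)+ (simp add: algebra_simps)

context generator begin

lemma gen_linear:
  assumes "Ck 2 g" "Ck 2 h"
  shows "gen (\<lambda>q. c * g q + d * h q) p = c * gen g p + d * gen h p"
proof -
  have g: "Ck (Suc (Suc 0)) g" and h: "Ck (Suc (Suc 0)) h" using assms by (simp_all add: numeral_2_eq_2)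
  have "DX v (\<lambda>q. c * g q + d * h q) = (\<lambda>p. c * DX v g p + d * DX v h p)" for v
    by (rule ext) (rule DX_linear[OF g h])
  then show ?thesis
    unfolding gen_def by (simp add: DX_linear[OF Ck_DX[OF g] Ck_DX[OF h]] algebra_simps)
qed

lemma gen_const: "gen (\<lambda>q. c) p = 0"
proof -
  have "DX v (\<lambda>q. d) = (\<lambda>p. 0)" for v d
    by (rule ext) (use DX_fd[OF has_derivative_const] in simp)
  then show ?thesis by (simp add: gen_def)
qed

lemma Ck_gen:
  assumes "Ck (Suc (Suc n)) g"
  shows "Ck n (gen g)"
  unfolding gen_def[abs_def]
  by (intro Ck_diff Ck_add Ck_DX[OF Ck_DX[OF assms]] Ck_DX[OF Ck_mono_Suc[OF assms]])

lemma smooth_boundD: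
  assumes "smooth_bound l K g"
  shows "Ck 4 g" "\<bar>g p\<bar> \<le> K * barrier l p" "\<bar>gen g p\<bar> \<le> K * barrier l p"
    "\<bar>gen (gen g) p\<bar> \<le> K * barrier l p"
    "\<bar>(DX s1 ^^ 4) g p\<bar> \<le> K * barrier l p" "\<bar>(DX s2 ^^ 4) g p\<bar> \<le> K * barrier l p"
    "\<bar>DX b (DX b g) p\<bar> \<le> K * barrier l p"
    "\<bar>DX s1 (DX s1 (gen g)) p\<bar> \<le> K * barrier l p" "\<bar>DX s2 (DX s2 (gen g)) p\<bar> \<le> K * barrier l p"
    "\<bar>DX b (gen g) p\<bar> \<le> K * barrier l p"
  using assms unfolding smooth_bound_def by blast+

lemma step_iter_mono:
  assumes "\<And>q. g q \<le> h q"
  shows "(step \<tau> ^^ n) g p \<le> (step \<tau> ^^ n) h p"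
proof (induction n arbitrary: p)
  case 0 then show ?case using assms by simp
next
  case (Suc n)
  have "step \<tau> ((step \<tau> ^^ n) g) p \<le> step \<tau> ((step \<tau> ^^ n) h) p" by (rule step_mono[OF Suc.IH])
  then show ?case by simp
qed

lemma step_iter_linear:
  "(step \<tau> ^^ n) (\<lambda>q. c * g q + d * h q) p = c * (step \<tau> ^^ n) g p + d * (step \<tau> ^^ n) h p"
proof (induction n arbitrary: p)
  case (Suc n)
  have "(step \<tau> ^^ n) (\<lambda>q. c * g q + d * h q) = (\<lambda>p. c * (step \<tau> ^^ n) g p + d * (step \<tau> ^^ n) h p)"
    by (rule ext) (rule Suc.IH)
  then show ?case by (simp add: step_linear)
qed simp

lemma step_iter_translate: "(step \<tau> ^^ n) (\<lambda>q. g (h \<cdot>\<^sub>H q)) p = (step \<tau> ^^ n) g (h \<cdot>\<^sub>H p)"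
proof (induction n arbitrary: p)
  case (Suc n)
  have "(step \<tau> ^^ n) (\<lambda>q. g (h \<cdot>\<^sub>H q)) = (\<lambda>p. (step \<tau> ^^ n) g (h \<cdot>\<^sub>H p))"
    by (rule ext) (rule Suc.IH)
  then show ?case by (simp add: step_translate del: hmul.simps)
qed simp

lemma continuous_step:
  assumes "continuous_on UNIV g"
  shows "continuous_on UNIV (step \<tau> g)"
proof -
  have c: "continuous_on UNIV (\<lambda>p. g (p \<cdot>\<^sub>H \<xi>) / d)" if "d \<noteq> 0" for \<xi> d
    by (intro continuous_on_divide continuous_on_UNIV_compose[OF assms] continuous_on_hmul
      continuous_on_id continuous_on_const) (use that in simp)
  show ?thesis unfolding step_def[abs_def] by (intro continuous_on_add c) simp_all
qed

lemma continuous_step_iter: "continuous_on UNIV g \<Longrightarrow> continuous_on UNIV ((step \<tau> ^^ n) g)"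
  by (induction n) (simp_all add: continuous_step)

text \<open>A discrete Gronwall argument: 1 + \<Lambda> \<tau> <= exp (\<Lambda> \<tau>), so the
  number of steps enters only through the elapsed time n \<tau>.\<close>

lemma step_iter_barrier:
  assumes \<Lambda>: "\<Lambda> \<ge> 0" "\<And>\<tau> p. 0 \<le> \<tau> \<Longrightarrow> \<tau> \<le> 1 \<Longrightarrow> \<bar>step \<tau> (barrier k) p - barrier k p\<bar> \<le> \<Lambda> * \<tau> * barrier k p"
    and \<tau>: "0 \<le> \<tau>" "\<tau> \<le> 1"
  shows "(step \<tau> ^^ n) (barrier k) p \<le> exp (\<Lambda> * (n * \<tau>)) * barrier k p"
proof (induction n arbitrary: p)
  case (Suc n)
  have "(step \<tau> ^^ Suc n) (barrier k) p \<le> step \<tau> (\<lambda>q. exp (\<Lambda> * (n * \<tau>)) * barrier k q) p"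
    using step_mono[OF Suc.IH] by simp
  also have "\<dots> = exp (\<Lambda> * (n * \<tau>)) * step \<tau> (barrier k) p"
    using step_linear[where d=0 and h="barrier k"] by simp
  also have "\<dots> \<le> exp (\<Lambda> * (n * \<tau>)) * (exp (\<Lambda> * \<tau>) * barrier k p)"
  proof (rule mult_left_mono)
    have "step \<tau> (barrier k) p \<le> (1 + \<Lambda> * \<tau>) * barrier k p"
      using \<Lambda>(2)[OF \<tau>, of p] by (simp add: algebra_simps abs_le_iff)
    also have "\<dots> \<le> exp (\<Lambda> * \<tau>) * barrier k p"
      by (intro mult_right_mono exp_ge_add_one_self) simp
    finally show "step \<tau> (barrier k) p \<le> exp (\<Lambda> * \<tau>) * barrier k p" .
  qed simp
  finally show ?case by (simp add: algebra_simps exp_add)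
qed simp

lemma step_iter_abs_le:
  assumes \<Lambda>: "\<Lambda> \<ge> 0" "\<And>\<tau> p. 0 \<le> \<tau> \<Longrightarrow> \<tau> \<le> 1 \<Longrightarrow> \<bar>step \<tau> (barrier k) p - barrier k p\<bar> \<le> \<Lambda> * \<tau> * barrier k p"
    and \<tau>: "0 \<le> \<tau>" "\<tau> \<le> 1" and g: "\<And>p. \<bar>g p\<bar> \<le> M * barrier k p" and M: "M \<ge> 0"
  shows "\<bar>(step \<tau> ^^ n) g p\<bar> \<le> M * exp (\<Lambda> * (n * \<tau>)) * barrier k p"
proof -
  have scale: "(step \<tau> ^^ n) (\<lambda>q. a * barrier k q) p = a * (step \<tau> ^^ n) (barrier k) p" for a
    using step_iter_linear[where d=0 and h="barrier k"] by simp
  have "(step \<tau> ^^ n) g p \<le> (step \<tau> ^^ n) (\<lambda>q. M * barrier k q) p"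
    by (rule step_iter_mono) (use g in \<open>simp add: abs_le_iff\<close>)
  moreover have "(step \<tau> ^^ n) (\<lambda>q. - M * barrier k q) p \<le> (step \<tau> ^^ n) g p"
    by (rule step_iter_mono) (use g in \<open>simp add: abs_le_iff minus_le_iff\<close>)
  moreover have "M * (step \<tau> ^^ n) (barrier k) p \<le> M * (exp (\<Lambda> * (n * \<tau>)) * barrier k p)"
    by (rule mult_left_mono[OF step_iter_barrier[OF \<Lambda> \<tau>] M])
  ultimately show ?thesis unfolding scale by (simp add: abs_le_iff algebra_simps)
qed

end

section \<open>The linear equation belonging to one affine majorant\<close>

locale bellman = generator +
  fixes A :: "real ^ 2 ^ 2" and f :: "real ^ 2 \<Rightarrow> real" and c :: real
  assumes A_eq: "A $ 1 $ 1 = (fst s1)\<^sup>2 + (fst s2)\<^sup>2" "A $ 1 $ 2 = fst s1 * snd s1 + fst s2 * snd s2"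
    "A $ 2 $ 1 = fst s1 * snd s1 + fst s2 * snd s2" "A $ 2 $ 2 = (snd s1)\<^sup>2 + (snd s2)\<^sup>2"
    and f_le: "\<And>\<xi>. f \<xi> \<le> fst b * \<xi> $ 1 + snd b * \<xi> $ 2 + c"
begin

lemma parab_op_le:
  fixes V :: "heis \<times> real \<Rightarrow> real"
  assumes "Ck 2 V"
  shows "parab_op A f V p t \<le> deriv (\<lambda>s. V (p, s)) t - gen (\<lambda>q. V (q, t)) p + c"
proof -
  have "Ck (Suc (Suc 0)) (\<lambda>q. V (q, t))" using Ck_slice[OF assms] by (simp add: numeral_2_eq_2)
  from trace_hess[OF A_eq this] f_le[of "hgrad (\<lambda>q. V (q, t)) p"] show ?thesis
    unfolding parab_op_def gen_def by (simp add: hgrad_def DX_def)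
qed

text \<open>One time step, by comparison with \<open>V\<close> below, where r is the time elapsed
  since \<open>a\<close>. The first-order expansion of the semigroup leaves the defect r
  \<open>gen (gen g)\<close>, of order K r times the barrier. The derivative 2 K r of K r^2 pays for
  it and, because r \<Lambda> <= 1, also for the action of the generator on that correction. The
  exponent \<Lambda> + 1 instead of \<Lambda> makes the inequality strict. The strip has length 2
  \<tau> because comparison says nothing at its terminal time.\<close>

lemma strip:
  assumes u: "viscosity_supersolution A f u" "continuous_on (UNIV \<times> {0..}) u"
    and g: "smooth_bound l0 K g" and K: "K \<ge> 0" and kl: "0 \<le> k" "k \<le> l0" "l0 < l"
    and \<Lambda>: "\<Lambda> \<ge> 0" "\<And>p. \<bar>gen (barrier l) p\<bar> \<le> \<Lambda> * barrier l p"
    and \<tau>: "0 < \<tau>" "\<tau> \<le> 1" "2 * \<tau> * \<Lambda> \<le> 1" and a: "a \<ge> 0" and E: "E > 0"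
    and growth: "M \<ge> 0" "\<And>p t. t \<in> {a..a + 2 * \<tau>} \<Longrightarrow> - M * barrier k p \<le> u (p, t)"
    and init: "\<And>p. g p - c0 - E * barrier l p \<le> u (p, a)"
  shows "g p + \<tau> * gen g p - c0 - c * \<tau> - K * \<tau>\<^sup>2 * barrier l p - E * exp ((\<Lambda> + 1) * \<tau>) * barrier l p \<le> u (p, a + \<tau>)"
proof -
  define h where "h = gen g"
  note g4 = smooth_boundD(1)[OF g]
  have g2: "Ck 2 g" using g4 by (rule Ck_mono) simp
  have h2: "Ck 2 h" using Ck_gen[of 2 g] g4 by (simp add: h_def eval_nat_numeral)
  define m where "m r = K * r\<^sup>2 + E * exp ((\<Lambda> + 1) * r)" for r
  define V where "V w = g (fst w) + (snd w - a) * h (fst w) - c0 - c * (snd w - a) - m (snd w - a) * barrier l (fst w)"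
    for w :: "heis \<times> real"
  have V2: "Ck 2 V" unfolding V_def m_def
    by (intro Ck_intros Ck_space g2 h2 Ck_barrier Ck_time)
  have "V (p, a + \<tau>) \<le> u (p, a + \<tau>)"
  proof -
    \<comment> \<open>The coefficient adds up K for \<open>g\<close>, 2 K for the term linear in r
      <= 2, the constants c0 and c r, and M for the lower bound of \<open>u\<close>.\<close>
    obtain R where R: "\<And>p. sgauge p > R \<Longrightarrow> (3 * K + \<bar>c0\<bar> + 2 * \<bar>c\<bar> + M) * barrier l0 p < E * barrier l p"
      using barrier_dominates[OF kl(3) E] by blast
    show ?thesis
    proof (rule supersolution_compare[OF u V2 _ a, where c="a + 2 * \<tau>" and K="{p. sgauge p \<le> R}"])
      fix p t assume t: "a < t" "t < a + 2 * \<tau>"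
      define r where "r = t - a"
      have r: "0 < r" "r < 2 * \<tau>" using t by (auto simp: r_def)
      have r\<Lambda>: "r * \<Lambda> \<le> 1" using mult_right_mono[of r "2 * \<tau>" \<Lambda>] r \<tau> \<Lambda>(1) by linarith
      let ?B = "barrier l p" and ?e = "exp ((\<Lambda> + 1) * r)"
      have "((\<lambda>s. V (p, s)) has_real_derivative (h p - c - (2 * K * r + E * (\<Lambda> + 1) * ?e) * ?B)) (at t)"
        unfolding V_def m_def fst_conv snd_conv r_def
        by (rule strip_profile_deriv)
      then have 1: "deriv (\<lambda>s. V (p, s)) t = h p - c - (2 * K * r + E * (\<Lambda> + 1) * ?e) * ?B"
        by (rule DERIV_imp_deriv)
      have "(\<lambda>q. V (q, t)) = (\<lambda>q. 1 * (1 * g q + r * h q) + (- 1) * (m r * barrier l q + (c0 + c * r) * 1))"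
        by (rule ext) (simp add: V_def r_def algebra_simps)
      then have "gen (\<lambda>q. V (q, t)) p = 1 * (1 * gen g p + r * gen h p) + (- 1) * (m r * gen (barrier l) p + (c0 + c * r) * gen (\<lambda>q. 1) p)"
        by (simp only: gen_linear g2 h2 Ck_barrier Ck_const Ck_add Ck_cmult)
      then have 2: "gen (\<lambda>q. V (q, t)) p = h p + r * gen h p - m r * gen (barrier l) p"
        by (simp add: gen_const h_def)
      have gh: "\<bar>gen h p\<bar> \<le> K * ?B"
      proof -
        have "\<bar>gen h p\<bar> \<le> K * barrier l0 p" unfolding h_def by (rule smooth_boundD(4)[OF g])
        also have "\<dots> \<le> K * ?B" using kl(3) K by (intro mult_left_mono barrier_mono) auto
        finally show ?thesis .
      qed
      have e1: "- (r * gen h p) \<le> r * K * ?B"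
        using mult_left_mono[of "- gen h p" "K * ?B" r] gh r by (simp add: abs_le_iff)
      have mpos: "m r \<ge> 0" using K E by (simp add: m_def)
      have e2: "m r * gen (barrier l) p \<le> m r * (\<Lambda> * ?B)"
        using \<Lambda>(2)[of p] mpos by (intro mult_left_mono) (auto simp: abs_le_iff)
      have e3: "K * r * (r * \<Lambda>) * ?B \<le> K * r * 1 * ?B"
        using r\<Lambda> K r by (intro mult_right_mono mult_left_mono) auto
      have "parab_op A f V p t \<le> - ((2 * K * r + E * (\<Lambda> + 1) * ?e) * ?B) - r * gen h p + m r * gen (barrier l) p"
        using parab_op_le[OF V2, of p t] unfolding 1 2 by linarith
      also have "\<dots> \<le> - ((2 * K * r + E * (\<Lambda> + 1) * ?e) * ?B) + r * K * ?B + m r * (\<Lambda> * ?B)"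
        using e1 e2 by linarith
      also have "\<dots> = - (K * r * ?B) + K * r * (r * \<Lambda>) * ?B - E * ?e * ?B"
        by (simp add: m_def algebra_simps power2_eq_square)
      also have "\<dots> \<le> - E * ?e * ?B" using e3 by simp
      also have "\<dots> < 0" using E by simp
      finally show "parab_op A f V p t < 0" .
    next
      show "V (p, a) \<le> u (p, a)" for p using init[of p] by (simp add: V_def m_def)
      show "bounded {p. sgauge p \<le> R}" by (rule sgauge_sublevel_bounded)
      fix p t assume p: "p \<notin> {p. sgauge p \<le> R}" and t: "t \<in> {a..a + 2 * \<tau>}"
      define r where "r = t - a"
      have r: "0 \<le> r" "r \<le> 2" using t \<tau> by (auto simp: r_def)
      let ?B = "barrier l p" and ?Q = "barrier l0 p"
      have B0: "?Q \<ge> 1" using kl by (intro barrier_ge_1) simp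
      have g1: "g p \<le> K * ?Q" "\<bar>h p\<bar> \<le> K * ?Q" unfolding h_def
        using smooth_boundD(2,3)[OF g, of p] by (auto simp: abs_le_iff)
      have "r * h p \<le> r * (K * ?Q)" using g1 r by (intro mult_left_mono) (auto simp: abs_le_iff)
      also have "\<dots> \<le> 2 * (K * ?Q)" using r K by (intro mult_right_mono) auto
      finally have e1: "r * h p \<le> 2 * (K * ?Q)" .
      have "- c * r \<le> \<bar>c\<bar> * r" using r by (intro mult_right_mono) auto
      then have "- c0 - c * r \<le> \<bar>c0\<bar> + \<bar>c\<bar> * r" by simp
      also have "\<dots> \<le> (\<bar>c0\<bar> + 2 * \<bar>c\<bar>) * 1"
        using mult_left_mono[OF r(2), of "\<bar>c\<bar>"] by simp
      also have "\<dots> \<le> (\<bar>c0\<bar> + 2 * \<bar>c\<bar>) * ?Q" using B0 by (intro mult_left_mono) auto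
      finally have e2: "- c0 - c * r \<le> (\<bar>c0\<bar> + 2 * \<bar>c\<bar>) * ?Q" .
      have "E * 1 \<le> E * exp ((\<Lambda> + 1) * r)" using E r \<Lambda>(1) by (intro mult_left_mono) auto
      moreover have "K * r\<^sup>2 \<ge> 0" using K by simp
      ultimately have "E \<le> m r" by (simp add: m_def)
      then have e3: "E * ?B \<le> m r * ?B" by (rule mult_right_mono) simp
      have e4: "- (M * ?Q) \<le> u (p, t)"
        using growth(2)[OF t, of p] mult_left_mono[OF barrier_mono[OF kl(2), of p] growth(1)] by linarith
      have "V (p, t) = g p + r * h p + (- c0 - c * r) - m r * ?B" by (simp add: V_def r_def)
      moreover have eR: "3 * (K * ?Q) + (\<bar>c0\<bar> + 2 * \<bar>c\<bar>) * ?Q + M * ?Q < E * ?B"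
        using R[of p] p by (simp add: algebra_simps)
      ultimately show "V (p, t) \<le> u (p, t)"
        using eR g1(1) e1 e2 e3 e4 by linarith
    qed (use \<tau> in auto)
  qed
  then show ?thesis by (simp add: V_def m_def h_def algebra_simps)
qed

text \<open>The data at time t are mollified once, and \<open>strip\<close> is applied n times to
  the walk started there. A strip adds an error of order \<tau>^2, so the total is of order s \<tau>
  and vanishes as n grows. The threshold \<open>n0\<close> depends neither on the time nor on the
  point, so that one n serves all translates when the inequality is averaged. Growth up to
  \<open>T + 2\<close> is assumed because a strip reaches 2 \<tau> <= 2 ahead.\<close>

lemma supersolution_step:
  assumes u: "viscosity_supersolution A f u" "continuous_on (UNIV \<times> {0..}) u"
    and k: "k \<ge> 0" "4 * k < l" and M: "M \<ge> 0"
    and bd: "\<And>p t. t \<in> {0..T + 2} \<Longrightarrow> \<bar>u (p, t)\<bar> \<le> M * barrier k p"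
    and s: "0 < s" "s \<le> T" and e: "e > 0"
  obtains n0 where "n0 > 0" "\<And>n t p. n \<ge> n0 \<Longrightarrow> 0 \<le> t \<Longrightarrow> t + s \<le> T \<Longrightarrow>
     (step (s / real n) ^^ n) (\<lambda>q. u (q, t)) p - c * s - e * barrier l p \<le> u (p, t + s)"
proof -
  \<comment> \<open>Convolution needs a rate above \<open>4 * k\<close>, and the correction in
    \<open>strip\<close> a rate above that of the mollified data.\<close>
  define l0 where "l0 = (4 * k + l) / 2"
  have l: "4 * k < l0" "l0 < l" "k \<le> l0" "l0 \<ge> 0" "l \<ge> 0" using k by (auto simp: l0_def)
  obtain \<Lambda> where "growth_rate l \<Lambda>" using growth_rate_exists[OF l(5)] ..
  note \<Lambda> = growth_rateD[OF this]
  obtain \<Lambda>1 where "growth_rate k \<Lambda>1" using growth_rate_exists[OF k(1)] ..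
  note \<Lambda>1 = growth_rateD[OF this]
  define L where "L = \<Lambda> + 1"
  \<comment> \<open>Three equal shares: mollification of the initial data, the accumulated strip
    errors, and the return from the walk of the mollified data to that of \<open>u\<close>.\<close>
  define e' where "e' = e / (3 * exp (L * s))"
  have e': "e' > 0" using e by (simp add: e'_def)
  obtain \<delta> where "translation_modulus u (T + 2) l e' \<delta>"
    using translation_modulus_exists[OF u(2) k M bd e'] ..
  note \<delta> = translation_modulusD[OF this]
  obtain \<psi> where "mollifier \<delta> \<psi>" using mollifier_exists[OF \<delta>(1,2)] ..
  note \<psi> = mollifierD[OF this]
  obtain C where "conv_smooth_const k l0 \<psi> C" using conv_smooth_const_exists[OF \<psi>(1) k(1) l(1)] ..
  note C = conv_smooth_constD[OF this]
  define K where "K = C * (M * exp (\<Lambda>1 * s))"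
  have K: "K \<ge> 0" using C(1) M by (simp add: K_def)
  \<comment> \<open>The first summand is the error of \<open>strip\<close>, the second the
    consistency error of \<open>step_minus_gen\<close>, both in units of \<tau>^2.\<close>
  define K' where "K' = K + stepC l0 * K"
  have K': "K' \<ge> 0" using K stepC_ge_1[OF l(4)] by (simp add: K'_def)
  \<comment> \<open>The three bounds on \<tau> secure \<tau> <= 1, 2 \<tau> \<Lambda> <= 1 as
    \<open>strip\<close> demands, and K' s \<tau> <= e'.\<close>
  define \<eta> where "\<eta> = min 1 (min (1 / (2 * \<Lambda> + 1)) (e' / (K' * s + 1)))"
  have \<eta>: "\<eta> > 0" using \<Lambda>(1) e' K' s by (auto simp: \<eta>_def intro!: divide_pos_pos add_nonneg_pos)
  obtain n0 :: nat where n0: "s / \<eta> < real n0" using reals_Archimedean2 by blast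
  have "s / \<eta> > 0" using s \<eta> by simp
  with n0 have n0pos: "n0 > 0" by (metis less_trans of_nat_0_less_iff)
  show ?thesis
  proof (rule that[OF n0pos])
    fix n t0 p assume n: "n \<ge> n0" and t0: "0 \<le> t0" "t0 + s \<le> T"
    define \<tau> where "\<tau> = s / real n"
    have npos: "n > 0" using n n0pos by simp
    have "s / \<eta> < real n" using n0 n by linarith
    then have "\<tau> < \<eta>" using \<eta> npos by (simp add: \<tau>_def field_simps)
    then have \<tau>: "0 < \<tau>" "\<tau> \<le> 1" "\<tau> \<le> 1 / (2 * \<Lambda> + 1)" "\<tau> \<le> e' / (K' * s + 1)"
      using s npos by (auto simp: \<eta>_def \<tau>_def)
    have n\<tau>: "real n * \<tau> = s" using npos by (simp add: \<tau>_def)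
    have \<tau>\<Lambda>: "2 * \<tau> * \<Lambda> \<le> 1"
    proof -
      have "\<tau> * (2 * \<Lambda> + 1) \<le> 1" using \<tau>(3) \<Lambda>(1) by (simp add: field_simps)
      then show ?thesis using \<tau>(1) by (simp add: algebra_simps)
    qed
    have \<tau>K: "K' * s * \<tau> \<le> e'"
    proof -
      have pos: "K' * s + 1 > 0" using K' s by (intro add_nonneg_pos) auto
      then have "\<tau> * (K' * s + 1) \<le> e'" using \<tau>(4) by (simp add: field_simps)
      then show ?thesis using \<tau>(1) by (simp add: algebra_simps)
    qed
    define G where "G i = (step \<tau> ^^ i) (\<lambda>q. u (q, t0))" for i
    \<comment> \<open>The iterates are functions of space only; the kernel's time variable is
      integrated out, and the time 0 is a dummy.\<close>
    define g where "g i q = conv \<psi> (\<lambda>v. G i (fst v)) (q, 0)" for i q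
    have t0T: "t0 \<in> {0..T + 2}" using t0 s by simp
    have G0c: "continuous_on UNIV (\<lambda>q. u (q, t0))"
      by (rule continuous_on_compose2[OF u(2)]) (use t0 in \<open>auto intro!: continuous_intros\<close>)
    have Gc: "continuous_on UNIV (G i)" for i unfolding G_def by (rule continuous_step_iter[OF G0c])
    have Gc': "continuous_on UNIV (\<lambda>v::heis \<times> real. G i (fst v))" for i
      by (intro continuous_on_UNIV_compose[OF Gc] continuous_intros)
    have Gb: "\<bar>G i q\<bar> \<le> M * exp (\<Lambda>1 * s) * barrier k q" if "i \<le> n" for i q
    proof -
      have "\<bar>G i q\<bar> \<le> M * exp (\<Lambda>1 * (i * \<tau>)) * barrier k q"
        unfolding G_def by (rule step_iter_abs_le[OF \<Lambda>1(1,2) _ \<tau>(2) bd[OF t0T] M]) (use \<tau> in auto)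
      also have "\<dots> \<le> M * exp (\<Lambda>1 * s) * barrier k q"
        using that \<tau>(1) \<Lambda>1(1) M unfolding n\<tau>[symmetric]
        by (intro mult_right_mono mult_left_mono) (auto intro!: mult_left_mono mult_right_mono)
      finally show ?thesis .
    qed
    have sb: "smooth_bound l0 K (g i)" if "i \<le> n" for i
      unfolding g_def K_def by (rule C(2)[OF Gc']) (use M Gb[OF that] in auto)
    have gSuc: "g (Suc i) q = step \<tau> (g i) q" for i q
      using step_conv[OF \<psi>(1) Gc', of \<tau> i 0 q] by (simp add: g_def[abs_def] G_def)
    have g0: "\<bar>g 0 q - u (q, t0)\<bar> \<le> e' * barrier l q" for q
      unfolding g_def
    proof (rule conv_close[OF \<psi>(1) Gc' \<psi>(2,3)])
      fix v assume "\<psi> v \<noteq> 0"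
      from \<delta>(3)[OF \<psi>(4-6)[OF this] t0T t0T, of q] \<delta>(1)
      show "\<bar>G 0 (fst (ldiv v (q, 0))) - u (q, t0)\<bar> \<le> e' * barrier l q"
        by (simp add: G_def ldiv_def)
    qed
    have main: "g i q - c * (i * \<tau>) - (e' + K' * (i * \<tau>) * \<tau>) * exp (L * (i * \<tau>)) * barrier l q \<le> u (q, t0 + i * \<tau>)"
      if "i \<le> n" for i q using that
    proof (induction i arbitrary: q)
      case 0
      then show ?case using g0[of q] by (simp add: abs_le_iff)
    next
      case (Suc i)
      let ?E = "(e' + K' * (i * \<tau>) * \<tau>) * exp (L * (i * \<tau>))"
      have i\<tau>: "real (Suc i) * \<tau> \<le> s" unfolding n\<tau>[symmetric] using Suc.prems \<tau>(1) by (intro mult_right_mono) auto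
      have i\<tau>': "real (Suc i) * \<tau> = i * \<tau> + \<tau>" by (simp add: algebra_simps)
      have E: "?E > 0" using e' K' \<tau> by (intro mult_pos_pos add_pos_nonneg) auto
      have in': "i \<le> n" using Suc.prems by simp
      have st: "g i q + \<tau> * gen (g i) q - c * (i * \<tau>) - c * \<tau> - K * \<tau>\<^sup>2 * barrier l q - ?E * exp ((\<Lambda> + 1) * \<tau>) * barrier l q
          \<le> u (q, (t0 + i * \<tau>) + \<tau>)"
      proof (rule strip[OF u sb[OF in'] K k(1) l(3,2) \<Lambda>(1,3) \<tau>(1,2) \<tau>\<Lambda> _ E M])
        show "0 \<le> t0 + real i * \<tau>" using t0 \<tau> by simp
        show "g i p - c * (i * \<tau>) - ?E * barrier l p \<le> u (p, t0 + i * \<tau>)" for p by (rule Suc.IH[OF in'])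
        fix p t assume "t \<in> {t0 + i * \<tau>..t0 + i * \<tau> + 2 * \<tau>}"
        moreover have "t0 + i * \<tau> + 2 * \<tau> \<le> T + 2" "0 \<le> t0 + i * \<tau>" using i\<tau> i\<tau>' t0 \<tau> by auto
        ultimately have "t \<in> {0..T + 2}" by auto
        from bd[OF this, of p] show "- M * barrier k p \<le> u (p, t)" by (simp add: abs_le_iff)
      qed
      have "\<bar>step \<tau> (g i) q - g i q - \<tau> * gen (g i) q\<bar> \<le> stepC l0 * K * \<tau>\<^sup>2 * barrier l0 q"
        using \<tau> by (intro step_minus_gen[OF _ l(4) K] smooth_boundD[OF sb[OF in']]) simp_all
      also have "\<dots> \<le> stepC l0 * K * \<tau>\<^sup>2 * barrier l q"
        using stepC_ge_1[OF l(4)] K l(2) by (intro mult_left_mono barrier_mono) auto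
      finally have "g (Suc i) q \<le> g i q + \<tau> * gen (g i) q + stepC l0 * K * \<tau>\<^sup>2 * barrier l q"
        unfolding gSuc by (simp add: abs_le_iff)
      with st have "g (Suc i) q - c * (i * \<tau>) - c * \<tau> - K' * \<tau>\<^sup>2 * barrier l q - ?E * exp (L * \<tau>) * barrier l q
          \<le> u (q, t0 + i * \<tau> + \<tau>)"
        by (simp add: K'_def L_def algebra_simps)
      moreover have "K' * \<tau>\<^sup>2 * barrier l q + ?E * exp (L * \<tau>) * barrier l q
         \<le> (e' + K' * (i * \<tau> + \<tau>) * \<tau>) * exp (L * (i * \<tau> + \<tau>)) * barrier l q"
      proof -
        have "1 \<le> exp (L * (i * \<tau> + \<tau>))" using \<Lambda>(1) \<tau>(1) by (simp add: L_def)
        then have "K' * \<tau>\<^sup>2 * 1 \<le> K' * \<tau>\<^sup>2 * exp (L * (i * \<tau> + \<tau>))"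
          using K' by (intro mult_left_mono) auto
        then have "K' * \<tau>\<^sup>2 + ?E * exp (L * \<tau>) \<le> (e' + K' * (i * \<tau> + \<tau>) * \<tau>) * exp (L * (i * \<tau> + \<tau>))"
          by (simp add: exp_add algebra_simps power2_eq_square)
        from mult_right_mono[OF this, of "barrier l q"] show ?thesis by (simp add: algebra_simps)
      qed
      ultimately show ?case unfolding i\<tau>' by (simp add: algebra_simps)
    qed
    have "(step \<tau> ^^ n) (\<lambda>q. u (q, t0)) p \<le> g n p + e' * exp (L * s) * barrier l p"
    proof -
      have gn: "g i = (step \<tau> ^^ i) (g 0)" for i
        by (induction i) (auto simp: gSuc)
      have "(step \<tau> ^^ n) (\<lambda>q. u (q, t0)) p \<le> (step \<tau> ^^ n) (\<lambda>q. 1 * g 0 q + e' * barrier l q) p"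
        by (rule step_iter_mono) (use g0 in \<open>simp add: abs_le_iff algebra_simps\<close>)
      also have "\<dots> = g n p + e' * (step \<tau> ^^ n) (barrier l) p"
        unfolding step_iter_linear by (simp add: gn[of n])
      also have "\<dots> \<le> g n p + e' * (exp (\<Lambda> * (n * \<tau>)) * barrier l p)"
        using step_iter_barrier[OF \<Lambda>(1,2) _ \<tau>(2), of n p] \<tau>(1) e' by (intro add_left_mono mult_left_mono) auto
      also have "\<dots> \<le> g n p + e' * (exp (L * s) * barrier l p)"
        unfolding n\<tau> using e' s by (intro add_left_mono mult_left_mono mult_right_mono) (auto simp: L_def algebra_simps)
      finally show ?thesis by (simp add: mult_ac)
    qed
    moreover have "(e' + K' * s * \<tau>) * exp (L * s) * barrier l p \<le> 2 * (e' * exp (L * s) * barrier l p)"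
    proof -
      have "(e' + K' * s * \<tau>) * (exp (L * s) * barrier l p) \<le> (2 * e') * (exp (L * s) * barrier l p)"
        using \<tau>K by (intro mult_right_mono) auto
      then show ?thesis by (simp only: mult.assoc)
    qed
    moreover have "3 * (e' * exp (L * s) * barrier l p) = e * barrier l p" by (simp add: e'_def)
    ultimately show "(step (s / real n) ^^ n) (\<lambda>q. u (q, t0)) p - c * s - e * barrier l p \<le> u (p, t0 + s)"
      using main[of n p] unfolding n\<tau> \<tau>_def[symmetric] by linarith
  qed
qed

end

section \<open>The mollified average is a classical supersolution\<close>

context generator begin

text \<open>Induction over the elapsed time r = i \<tau>: the errors of one further step fit into
  the increment m ((r + \<tau>)^2 - r^2), where \<open>\<sigma>\<close> ensures r \<Lambda> <= 1.
  The bound is independent of n, so s can be fixed while n is chosen as large as desired.\<close>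

lemma step_iter_lower:
  assumes g: "smooth_bound l K g" and K: "K \<ge> 0" and l: "l \<ge> 0"
  shows "\<exists>m \<sigma>. \<sigma> > 0 \<and> (\<forall>s n p. 0 < s \<longrightarrow> s \<le> \<sigma> \<longrightarrow> 0 < n \<longrightarrow>
     g p + s * gen g p - m * s\<^sup>2 * barrier l p \<le> (step (s / real n) ^^ n) g p)"
proof -
  define h where "h = gen g"
  obtain \<Lambda> where "growth_rate l \<Lambda>" using growth_rate_exists[OF l] ..
  note \<Lambda> = growth_rateD[OF this]
  note sb = smooth_boundD[OF g]
  have h2: "Ck 2 h" using Ck_gen[of 2 g] sb(1) by (simp add: h_def eval_nat_numeral)
  define m where "m = 3 * (stepC l * K)"
  have SK: "stepC l * K \<ge> 0" using stepC_ge_1[OF l] K by simp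
  have m: "m \<ge> 0" using SK by (simp add: m_def)
  define \<sigma> where "\<sigma> = min 1 (1 / (\<Lambda> + 1))"
  have \<sigma>: "\<sigma> > 0" using \<Lambda>(1) by (simp add: \<sigma>_def)
  have main: "g p + s * gen g p - m * s\<^sup>2 * barrier l p \<le> (step (s / real n) ^^ n) g p"
    if s: "0 < s" "s \<le> \<sigma>" and n: "0 < n" for s n p
  proof -
    define \<tau> where "\<tau> = s / real n"
    have n1: "1 \<le> real n" using n by simp
    have "s / real n \<le> s / 1" using s n1 by (intro divide_left_mono) auto
    then have \<tau>: "0 < \<tau>" "\<tau> \<le> 1" using s n by (auto simp: \<tau>_def \<sigma>_def)
    have n\<tau>: "real n * \<tau> = s" using n by (simp add: \<tau>_def)
    have s\<Lambda>: "s * \<Lambda> \<le> 1"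
    proof -
      have "s * (\<Lambda> + 1) \<le> 1" using s(2) \<Lambda>(1) by (simp add: \<sigma>_def field_simps)
      then show ?thesis using s by (simp add: algebra_simps)
    qed
    have "g p + (i * \<tau>) * h p - m * (i * \<tau>)\<^sup>2 * barrier l p \<le> (step \<tau> ^^ i) g p" if "i \<le> n" for i
      using that
    proof (induction i arbitrary: p)
      case 0 show ?case by simp
    next
      case (Suc i)
      define r where "r = real i * \<tau>"
      have r: "0 \<le> r" "r \<le> s" unfolding r_def n\<tau>[symmetric] using \<tau> Suc.prems by (auto intro: mult_right_mono)
      have r\<Lambda>: "r * \<Lambda> \<le> 1" using mult_right_mono[OF r(2) \<Lambda>(1)] s\<Lambda> by linarith
      have rS: "real (Suc i) * \<tau> = r + \<tau>" by (simp add: r_def algebra_simps)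
      let ?B = "barrier l p"
      have 1: "g p + \<tau> * h p - stepC l * K * \<tau>\<^sup>2 * ?B \<le> step \<tau> g p"
        using step_minus_gen[OF sb(1) l K _ \<tau>(2) sb(5,6,7), of p] \<tau>(1) unfolding h_def abs_le_iff by linarith
      have "\<bar>step \<tau> h p - h p\<bar> \<le> stepC l * K * \<tau> * ?B"
        unfolding h_def by (rule step_minus_id[OF h2[unfolded h_def] l K _ \<tau>(2) sb(8,9,10)]) (use \<tau>(1) in simp)
      then have "h p - stepC l * K * \<tau> * ?B \<le> step \<tau> h p" unfolding abs_le_iff by linarith
      then have 2: "r * (h p - stepC l * K * \<tau> * ?B) \<le> r * step \<tau> h p" using r(1) by (rule mult_left_mono)
      have "step \<tau> (barrier l) p \<le> ?B + \<Lambda> * \<tau> * ?B"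
        using \<Lambda>(2)[of \<tau> p] \<tau> unfolding abs_le_iff by linarith
      then have 3: "m * r\<^sup>2 * step \<tau> (barrier l) p \<le> m * r\<^sup>2 * (?B + \<Lambda> * \<tau> * ?B)"
        using m by (intro mult_left_mono) auto
      have lin: "step \<tau> (\<lambda>q. g q + r * h q - m * r\<^sup>2 * barrier l q) p
         = step \<tau> g p + r * step \<tau> h p - m * r\<^sup>2 * step \<tau> (barrier l) p"
        unfolding step_def by (simp add: field_simps)
      have "step \<tau> (\<lambda>q. g q + r * h q - m * r\<^sup>2 * barrier l q) p \<le> step \<tau> ((step \<tau> ^^ i) g) p"
        by (rule step_mono) (use Suc.IH Suc.prems in \<open>simp add: r_def\<close>)
      then have 4: "step \<tau> g p + r * step \<tau> h p - m * r\<^sup>2 * step \<tau> (barrier l) p \<le> (step \<tau> ^^ Suc i) g p"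
        unfolding lin by simp
      have 5: "stepC l * K * \<tau>\<^sup>2 + r * (stepC l * K * \<tau>) + m * r\<^sup>2 * (\<Lambda> * \<tau>) \<le> m * (2 * r * \<tau> + \<tau>\<^sup>2)"
      proof -
        have a: "(stepC l * K) * \<tau>\<^sup>2 \<le> m * \<tau>\<^sup>2"
          by (rule mult_right_mono) (use SK in \<open>unfold m_def, linarith, simp\<close>)
        have b: "(stepC l * K) * (r * \<tau>) \<le> m * (r * \<tau>)"
          by (rule mult_right_mono) (use SK r \<tau> in \<open>unfold m_def, linarith, simp\<close>)
        have "m * (r * \<tau>) * (r * \<Lambda>) \<le> m * (r * \<tau>) * 1" using m r \<tau> r\<Lambda> by (intro mult_left_mono) auto
        with a b show ?thesis by (simp add: algebra_simps power2_eq_square)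
      qed
      have "(stepC l * K * \<tau>\<^sup>2 + r * (stepC l * K * \<tau>) + m * r\<^sup>2 * (\<Lambda> * \<tau>)) * ?B \<le> (m * (2 * r * \<tau> + \<tau>\<^sup>2)) * ?B"
        by (rule mult_right_mono[OF 5]) simp
      then have "g p + (r + \<tau>) * h p - m * (r + \<tau>)\<^sup>2 * ?B
         \<le> (g p + \<tau> * h p - stepC l * K * \<tau>\<^sup>2 * ?B) + r * (h p - stepC l * K * \<tau> * ?B) - m * r\<^sup>2 * (?B + \<Lambda> * \<tau> * ?B)"
        by (simp add: algebra_simps power2_eq_square)
      with 1 2 3 4 show ?case unfolding rS by linarith
    qed
    from this[of n] show ?thesis unfolding n\<tau> by (simp add: h_def \<tau>_def)
  qed
  then show ?thesis using \<sigma> by blast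
qed

text \<open>With s fixed, e tends to zero first, the number of steps varying with e; then the
  inequality is divided by s and s tends to zero from the right. Differentiability of
  \<open>W\<close> identifies the one-sided limit with \<open>deriv\<close>.\<close>

lemma time_derivative_lower:
  fixes W :: "heis \<times> real \<Rightarrow> real"
  assumes W: "Ck 1 W" and g: "smooth_bound l K (\<lambda>q. W (q, t))" and K: "K \<ge> 0" and l: "l \<ge> 0"
    and s0: "s0 > 0" and H: "\<And>s e. 0 < s \<Longrightarrow> s \<le> s0 \<Longrightarrow> e > 0 \<Longrightarrow>
      \<exists>n>0. (step (s / real n) ^^ n) (\<lambda>q. W (q, t)) p - c * s - e \<le> W (p, t + s)"
  shows "gen (\<lambda>q. W (q, t)) p - c \<le> deriv (\<lambda>s. W (p, s)) t"
proof -
  let ?g = "\<lambda>q. W (q, t)"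
  obtain m \<sigma> where \<sigma>: "\<sigma> > 0" and low: "\<And>s n p. 0 < s \<Longrightarrow> s \<le> \<sigma> \<Longrightarrow> 0 < n \<Longrightarrow>
     ?g p + s * gen ?g p - m * s\<^sup>2 * barrier l p \<le> (step (s / real n) ^^ n) ?g p"
    using step_iter_lower[OF g K l] by blast
  have diff: "gen ?g p - c - m * barrier l p * s \<le> (W (p, t + s) - W (p, t)) / s" if s: "0 < s" "s < min \<sigma> s0" for s
  proof -
    have "W (p, t) + s * gen ?g p - m * s\<^sup>2 * barrier l p - c * s \<le> W (p, t + s)"
    proof (rule field_le_epsilon)
      fix e :: real assume "e > 0"
      then obtain n where n: "n > 0" "(step (s / real n) ^^ n) ?g p - c * s - e \<le> W (p, t + s)"
        using H[of s e] s by auto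
      with low[of s n p] s show "W (p, t) + s * gen ?g p - m * s\<^sup>2 * barrier l p - c * s \<le> W (p, t + s) + e" by simp
    qed
    then have "(gen ?g p - c - m * barrier l p * s) * s \<le> W (p, t + s) - W (p, t)"
      by (simp add: algebra_simps power2_eq_square)
    then show ?thesis using s by (simp add: le_divide_eq)
  qed
  have "Ck (Suc 0) W" using W by simp
  from Ck_time_deriv[OF this]
  have "((\<lambda>h. (W (p, t + h) - W (p, t)) / h) \<longlongrightarrow> deriv (\<lambda>s. W (p, s)) t) (at 0)"
    by (simp add: DERIV_def)
  then have lim: "((\<lambda>h. (W (p, t + h) - W (p, t)) / h) \<longlongrightarrow> deriv (\<lambda>s. W (p, s)) t) (at_right 0)"
    by (rule tendsto_mono[rotated]) (simp add: at_le)
  have lim2: "((\<lambda>h. gen ?g p - c - m * barrier l p * h) \<longlongrightarrow> gen ?g p - c - m * barrier l p * 0) (at_right 0)"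
    by (intro tendsto_intros)
  have "gen ?g p - c - m * barrier l p * 0 \<le> deriv (\<lambda>s. W (p, s)) t"
  proof (rule tendsto_le[OF _ lim lim2])
    show "\<forall>\<^sub>F h in at_right 0. gen ?g p - c - m * barrier l p * h \<le> (W (p, t + h) - W (p, t)) / h"
      unfolding eventually_at_right_field using \<sigma> s0 diff by (intro exI[of _ "min \<sigma> s0"]) auto
  qed simp
  then show ?thesis by simp
qed

lemma continuous_step_spacetime:
  fixes G :: "heis \<times> real \<Rightarrow> real"
  assumes "continuous_on UNIV G"
  shows "continuous_on UNIV (\<lambda>v. (step \<tau> ^^ n) (\<lambda>q. G (q, snd v)) (fst v))"
proof (induction n)
  case 0 then show ?case using assms by simp
next
  case (Suc n)
  define F where "F v = (step \<tau> ^^ n) (\<lambda>q. G (q, snd v)) (fst v)" for v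
  have F: "continuous_on UNIV F" using Suc.IH by (simp add: F_def[abs_def])
  have c: "continuous_on UNIV (\<lambda>v. F (fst v \<cdot>\<^sub>H \<xi>, snd v) / d)" if "d \<noteq> 0" for \<xi> d
    by (intro continuous_on_divide continuous_on_UNIV_compose[OF F] continuous_on_Pair continuous_on_hmul
      continuous_on_fst continuous_on_snd continuous_on_id continuous_on_const) (use that in simp)
  have "(step \<tau> ^^ Suc n) (\<lambda>q. G (q, snd v)) (fst v) = step \<tau> (\<lambda>p. F (p, snd v)) (fst v)" for v
    by (simp add: F_def)
  then show ?case unfolding step_def by (simp only:) (intro continuous_on_add c, simp_all)
qed

lemma step_iter_conv:
  assumes \<psi>: "test_fun m \<psi>" and G: "continuous_on UNIV G"
  shows "(step \<tau> ^^ n) (\<lambda>q. conv \<psi> G (q, t)) p = conv \<psi> (\<lambda>v. (step \<tau> ^^ n) (\<lambda>q. G (q, snd v)) (fst v)) (p, t)"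
proof (induction n arbitrary: p)
  case (Suc n)
  define F where "F = (\<lambda>v. (step \<tau> ^^ n) (\<lambda>q. G (q, snd v)) (fst v))"
  have F: "continuous_on UNIV F" unfolding F_def by (rule continuous_step_spacetime[OF G])
  have "(step \<tau> ^^ n) (\<lambda>q. conv \<psi> G (q, t)) = (\<lambda>p. conv \<psi> F (p, t))"
    by (rule ext) (simp add: Suc.IH F_def)
  then have "(step \<tau> ^^ Suc n) (\<lambda>q. conv \<psi> G (q, t)) p = step \<tau> (\<lambda>p. conv \<psi> F (p, t)) p" by simp
  also have "\<dots> = conv \<psi> (\<lambda>v. step \<tau> (\<lambda>q. F (q, snd v)) (fst v)) (p, t)" by (rule step_conv[OF \<psi> F])
  finally show ?case by (simp add: F_def)
qed simp

end

lemma conv_le: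
  assumes \<psi>: "test_fun n \<psi>" and nn: "\<And>v. \<psi> v \<ge> 0" and one: "(\<integral>v. \<psi> v \<partial>lborel) = 1"
    and G: "continuous_on UNIV G1" "continuous_on UNIV G2"
    and le: "\<And>v. \<psi> v \<noteq> 0 \<Longrightarrow> G1 (ldiv v w1) - d \<le> G2 (ldiv v w2)"
  shows "conv \<psi> G1 w1 - d \<le> conv \<psi> G2 w2"
proof -
  have i: "integrable lborel \<psi>" using test_fun_abs_integrable[OF \<psi>] nn by simp
  have "\<psi> v * G1 (ldiv v w1) - \<psi> v * d \<le> \<psi> v * G2 (ldiv v w2)" for v
  proof (cases "\<psi> v = 0")
    case False
    have "\<psi> v * (G1 (ldiv v w1) - d) \<le> \<psi> v * G2 (ldiv v w2)"
      by (rule mult_left_mono[OF le[OF False] nn])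
    then show ?thesis by (simp add: algebra_simps)
  qed simp
  then have "(\<integral>v. \<psi> v * G1 (ldiv v w1) - \<psi> v * d \<partial>lborel) \<le> (\<integral>v. \<psi> v * G2 (ldiv v w2) \<partial>lborel)"
    by (intro integral_mono Bochner_Integration.integrable_diff conv_integrable[OF \<psi>] G integrable_mult_left i)
  moreover have "(\<integral>v. \<psi> v * G1 (ldiv v w1) - \<psi> v * d \<partial>lborel) = conv \<psi> G1 w1 - d"
    unfolding conv_def
    by (subst Bochner_Integration.integral_diff[OF conv_integrable[OF \<psi> G(1)] integrable_mult_left[OF i]])
      (simp add: one)
  ultimately show ?thesis unfolding conv_def by simp
qed

section \<open>The average of two left translates, with time frozen outside a bounded
  interval\<close>

definition clamp_time :: "real \<Rightarrow> real \<Rightarrow> real" where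
  "clamp_time T t = max 0 (min T t)"

lemma clamp_time_range: "T \<ge> 0 \<Longrightarrow> clamp_time T t \<in> {0..T}"
  by (auto simp: clamp_time_def)

lemma clamp_time_id: "t \<in> {0..T} \<Longrightarrow> clamp_time T t = t"
  by (auto simp: clamp_time_def)

definition sym_avg :: "heis \<Rightarrow> (heis \<times> real \<Rightarrow> real) \<Rightarrow> heis \<times> real \<Rightarrow> real" where
  "sym_avg h u w = (u (hinv h \<cdot>\<^sub>H fst w, snd w) + u (h \<cdot>\<^sub>H fst w, snd w)) / 2"

text \<open>\<open>conv\<close> requires a function continuous on all of space-time and bounded
  uniformly in time, while \<open>u\<close> is controlled only for nonnegative times up to a
  horizon. Freezing the time outside preserves continuity and the growth bound.\<close>

definition clamped :: "real \<Rightarrow> (heis \<times> real \<Rightarrow> real) \<Rightarrow> heis \<times> real \<Rightarrow> real" where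
  "clamped T u w = u (fst w, clamp_time T (snd w))"

lemma continuous_clamped:
  assumes "continuous_on (UNIV \<times> {0..}) u"
  shows "continuous_on UNIV (clamped T u)"
proof -
  have "continuous_on UNIV (\<lambda>w. (fst w, clamp_time T (snd w)) :: heis \<times> real)"
    unfolding clamp_time_def by (intro continuous_intros)
  then show ?thesis unfolding clamped_def[abs_def]
    by (rule continuous_on_compose2[OF assms]) (auto simp: clamp_time_def)
qed

lemma continuous_sym_avg:
  assumes "continuous_on (UNIV \<times> {0..}) u"
  shows "continuous_on (UNIV \<times> {0..}) (sym_avg h u)"
proof -
  have "continuous_on (UNIV \<times> {0..}) (\<lambda>w. u (g \<cdot>\<^sub>H fst w, snd w))" for g
    by (rule continuous_on_compose2[OF assms]) (auto intro!: continuous_intros)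
  then show ?thesis unfolding sym_avg_def[abs_def] by (intro continuous_intros) auto
qed

lemma barrier_translate_ex: "\<exists>m\<ge>1. \<forall>k\<ge>0. \<forall>p. barrier k (h \<cdot>\<^sub>H p) \<le> barrier (m * k) p \<and> barrier k (hinv h \<cdot>\<^sub>H p) \<le> barrier (m * k) p"
proof -
  define m where "m = 1 + \<bar>fst h\<bar> + \<bar>fst (snd h)\<bar> + \<bar>snd (snd h)\<bar>"
  have m: "m \<ge> 1" "\<bar>fst h\<bar> \<le> m" "\<bar>fst (snd h)\<bar> \<le> m" "\<bar>snd (snd h)\<bar> \<le> m" by (auto simp: m_def)
  have m': "\<bar>fst (hinv h)\<bar> \<le> m" "\<bar>fst (snd (hinv h))\<bar> \<le> m" "\<bar>snd (snd (hinv h))\<bar> \<le> m"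
    using m by (simp_all add: hinv_eq)
  show ?thesis
    using barrier_translate[OF m] barrier_translate[OF m(1) m'] m(1)
    by (intro exI[of _ "4 * m"] conjI allI impI) simp_all
qed

lemma sym_avg_bound:
  assumes bd: "\<And>p. \<bar>u (p, t)\<bar> \<le> M * barrier k p"
    and tr: "barrier k (h \<cdot>\<^sub>H q) \<le> barrier l q" "barrier k (hinv h \<cdot>\<^sub>H q) \<le> barrier l q" and M: "M \<ge> 0"
  shows "\<bar>sym_avg h u (q, t)\<bar> \<le> M * barrier l q"
proof -
  have "\<bar>u (h \<cdot>\<^sub>H q, t)\<bar> \<le> M * barrier l q" "\<bar>u (hinv h \<cdot>\<^sub>H q, t)\<bar> \<le> M * barrier l q"
    using bd[of "h \<cdot>\<^sub>H q"] bd[of "hinv h \<cdot>\<^sub>H q"] mult_left_mono[OF tr(1) M] mult_left_mono[OF tr(2) M]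
    by linarith+
  then show ?thesis by (simp add: sym_avg_def abs_le_iff)
qed

context bellman begin

text \<open>\<open>supersolution_step\<close> is applied at \<open>hinv h \<cdot>\<^sub>H q\<close>
  and \<open>h \<cdot>\<^sub>H q\<close> for every point \<open>q\<close> seen by the kernel;
  linearity and left invariance of the walk combine these into the same inequality for
  \<open>W\<close>. The kernel looks ahead in time by at most \<delta>, whence the condition
  \<open>t + \<delta> < T\<close>.\<close>

lemma mollified_supersolution:
  assumes u: "viscosity_supersolution A f u" "continuous_on (UNIV \<times> {0..}) u"
    and k: "k \<ge> 0" and M: "M \<ge> 0"
    and bd: "\<And>p t. t \<in> {0..T + 2} \<Longrightarrow> \<bar>u (p, t)\<bar> \<le> M * barrier k p"
    and \<psi>: "mollifier \<delta> \<psi>" and t: "0 \<le> t" "t + \<delta> < T"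
    and W: "W = conv \<psi> (clamped (T + 2) (sym_avg h u))"
  shows "gen (\<lambda>q. W (q, t)) p - c \<le> deriv (\<lambda>s. W (p, s)) t"
proof -
  note \<psi>D = mollifierD[OF \<psi>]
  define w where "w = clamped (T + 2) (sym_avg h u)"
  have wc: "continuous_on UNIV w" unfolding w_def by (intro continuous_clamped continuous_sym_avg u)
  have Ww: "W = conv \<psi> w" by (simp add: W w_def)
  obtain m where m: "m \<ge> 1" "\<And>k p. k \<ge> 0 \<Longrightarrow> barrier k (h \<cdot>\<^sub>H p) \<le> barrier (m * k) p"
    "\<And>k p. k \<ge> 0 \<Longrightarrow> barrier k (hinv h \<cdot>\<^sub>H p) \<le> barrier (m * k) p"
    using barrier_translate_ex[of h] by blast
  \<comment> \<open>A kernel of integral one is nonzero somewhere, and its support condition there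
    forces \<delta> >= 0.\<close>
  obtain v0 where "\<psi> v0 \<noteq> 0"
    using \<psi>D(3) by (metis (mono_tags, lifting) integral_zero zero_neq_one Bochner_Integration.integral_cong)
  then have \<delta>0: "\<delta> \<ge> 0" using \<psi>D(4)[of v0] by linarith
  have T0: "T > 0" using t \<delta>0 by linarith
  have wbd: "\<bar>w (q, s)\<bar> \<le> M * barrier (m * k) q" for q s
    unfolding w_def clamped_def fst_conv snd_conv
    by (rule sym_avg_bound[OF bd[OF clamp_time_range] m(2,3)[OF k] M]) (use T0 in simp_all)
  have mk: "m * k \<ge> 0" using m(1) k by simp
  define l where "l = 4 * (m * k) + 1"
  have l: "4 * (m * k) < l" "l \<ge> 0" using mk by (simp_all add: l_def)
  obtain C where "conv_smooth_const (m * k) l \<psi> C" using conv_smooth_const_exists[OF \<psi>D(1) mk l(1)] ..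
  note C = conv_smooth_constD[OF this]
  have sb: "smooth_bound l (C * M) (\<lambda>q. W (q, t))" unfolding Ww by (rule C(2)[OF wc M wbd])
  have W1: "Ck 1 W" unfolding Ww by (rule Ck_mono[OF Ck_conv[OF \<psi>D(1) wc]]) simp
  define s0 where "s0 = T - t - \<delta>"
  have s0: "s0 > 0" using t by (simp add: s0_def)
  define l2 where "l2 = 4 * k + 1"
  have l2: "4 * k < l2" "l2 \<ge> 0" using k by (simp_all add: l2_def)
  \<comment> \<open>Bounds the weight at all points that enter \<open>W\<close> near
    \<open>p\<close>: the factor m accounts for translation by \<open>h\<close> or its inverse, the
    factor 4 for the kernel. Running the walk with error \<open>e / D\<close> then yields
    \<open>e\<close> uniformly.\<close>
  define D where "D = barrier (4 * (m * l2)) p"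
  have D: "D > 0" by (simp add: D_def)
  show ?thesis
  proof (rule time_derivative_lower[OF W1 sb _ l(2) s0])
    show "0 \<le> C * M" using C(1) M by simp
    fix s e :: real assume s: "0 < s" "s \<le> s0" and e: "e > 0"
    have sT: "s \<le> T" using s t \<delta>0 by (simp add: s0_def)
    have eD: "e / D > 0" using e D by simp
    obtain n where n: "n > 0" "\<And>t p. 0 \<le> t \<Longrightarrow> t + s \<le> T \<Longrightarrow>
       (step (s / real n) ^^ n) (\<lambda>q. u (q, t)) p - c * s - e / D * barrier l2 p \<le> u (p, t + s)"
      by (rule supersolution_step[OF u k l2(1) M bd s(1) sT eD]) blast+
    define F where "F = (\<lambda>v. (step (s / real n) ^^ n) (\<lambda>q. w (q, snd v)) (fst v))"
    have "conv \<psi> F (p, t) - (c * s + e) \<le> conv \<psi> w (p, t + s)"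
    proof (rule conv_le[OF \<psi>D(1,2,3)])
      show "continuous_on UNIV F" unfolding F_def by (rule continuous_step_spacetime[OF wc])
      show "continuous_on UNIV w" by (rule wc)
      fix v assume v: "\<psi> v \<noteq> 0"
      define q where "q = fst (ldiv v (p, t))"
      define t' where "t' = t - snd v"
      have t': "0 \<le> t'" "t' + s \<le> T" "t' \<in> {0..T + 2}" "t' + s \<in> {0..T + 2}"
        using \<psi>D(7,8)[OF v] t s by (auto simp: t'_def s0_def)
      have lv: "ldiv v (p, t) = (q, t')" "ldiv v (p, t + s) = (q, t' + s)"
        by (simp_all add: q_def t'_def ldiv_def)
      have vu: "v \<in> ubox" using test_fun_zero[OF \<psi>D(1)] v by blast
      have qD: "barrier (m * l2) q \<le> D"
        unfolding q_def D_def using barrier_ldiv[OF vu, of "m * l2" "(p, t)"] m(1) l2(2) by simp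
      have hq: "barrier l2 (h \<cdot>\<^sub>H q) \<le> D" "barrier l2 (hinv h \<cdot>\<^sub>H q) \<le> D"
        using m(2,3)[OF l2(2), of q] qD by linarith+
      have "e / D * barrier l2 (h \<cdot>\<^sub>H q) \<le> e / D * D" "e / D * barrier l2 (hinv h \<cdot>\<^sub>H q) \<le> e / D * D"
        using hq eD by (intro mult_left_mono; simp)+
      then have be: "e / D * barrier l2 (h \<cdot>\<^sub>H q) \<le> e" "e / D * barrier l2 (hinv h \<cdot>\<^sub>H q) \<le> e" using D by simp_all
      have wt: "w (r, t') = (1/2) * u (hinv h \<cdot>\<^sub>H r, t') + (1/2) * u (h \<cdot>\<^sub>H r, t')"
        "w (r, t' + s) = (1/2) * u (hinv h \<cdot>\<^sub>H r, t' + s) + (1/2) * u (h \<cdot>\<^sub>H r, t' + s)" for r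
        using t' by (simp_all add: w_def clamped_def sym_avg_def clamp_time_id)
      have "F (ldiv v (p, t)) = (step (s / real n) ^^ n) (\<lambda>r. (1/2) * u (hinv h \<cdot>\<^sub>H r, t') + (1/2) * u (h \<cdot>\<^sub>H r, t')) q"
        unfolding F_def lv by (simp add: wt)
      also have "\<dots> = (1/2) * (step (s / real n) ^^ n) (\<lambda>r. u (r, t')) (hinv h \<cdot>\<^sub>H q)
           + (1/2) * (step (s / real n) ^^ n) (\<lambda>r. u (r, t')) (h \<cdot>\<^sub>H q)"
        unfolding step_iter_linear
        using step_iter_translate[of n "s / real n" "\<lambda>r. u (r, t')" "hinv h" q]
          step_iter_translate[of n "s / real n" "\<lambda>r. u (r, t')" h q] by simp
      finally have Feq: "F (ldiv v (p, t)) = (1/2) * (step (s / real n) ^^ n) (\<lambda>r. u (r, t')) (hinv h \<cdot>\<^sub>H q)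
           + (1/2) * (step (s / real n) ^^ n) (\<lambda>r. u (r, t')) (h \<cdot>\<^sub>H q)" .
      show "F (ldiv v (p, t)) - (c * s + e) \<le> w (ldiv v (p, t + s))"
        unfolding Feq unfolding lv wt using n(2)[OF t'(1,2), of "hinv h \<cdot>\<^sub>H q"] n(2)[OF t'(1,2), of "h \<cdot>\<^sub>H q"] be by linarith
    qed
    moreover have "conv \<psi> F (p, t) = (step (s / real n) ^^ n) (\<lambda>q. W (q, t)) p"
      unfolding F_def Ww by (rule step_iter_conv[OF \<psi>D(1) wc, symmetric])
    ultimately show "\<exists>n>0. (step (s / real n) ^^ n) (\<lambda>q. W (q, t)) p - c * s - e \<le> W (p, t + s)"
      using n(1) Ww by (intro exI[of _ n]) simp
  qed
qed

end

section \<open>Affine majorants and the square root of A\<close>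

text \<open>If the minimum were negative, take its leftmost minimizer z. It is interior, the value
  at z - d exceeds the minimum and the value at z + d is at least the minimum, which contradicts the
  midpoint inequality.\<close>

lemma midpoint_concave_nonneg:
  fixes \<phi> :: "real \<Rightarrow> real"
  assumes cont: "continuous_on {0..1} \<phi>" and ends: "\<phi> 0 = 0" "\<phi> 1 = 0"
    and mid: "\<And>s t. s \<in> {0..1} \<Longrightarrow> t \<in> {0..1} \<Longrightarrow> \<phi> s + \<phi> t \<le> 2 * \<phi> ((s + t) / 2)"
    and t: "t \<in> {0..1}"
  shows "\<phi> t \<ge> 0"
proof (rule ccontr)
  assume neg: "\<not> \<phi> t \<ge> 0"
  obtain t0 where t0: "t0 \<in> {0..1}" "\<And>s. s \<in> {0..1} \<Longrightarrow> \<phi> t0 \<le> \<phi> s"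
    using continuous_attains_inf[OF compact_Icc _ cont] by auto
  have m: "\<phi> t0 < 0" using t0(2)[OF t] neg by simp
  define Z where "Z = {s \<in> {0..1}. \<phi> s \<le> \<phi> t0}"
  have "closed Z" unfolding Z_def by (rule continuous_on_closed_Collect_le[OF cont continuous_on_const closed_atLeastAtMost])
  moreover have "bounded Z" by (rule bounded_subset[of "{0..1}"]) (auto simp: Z_def)
  ultimately have "compact Z" by (simp add: compact_eq_bounded_closed)
  moreover have "Z \<noteq> {}" using t0(1) by (auto simp: Z_def)
  ultimately obtain z where z: "z \<in> Z" "\<And>s. s \<in> Z \<Longrightarrow> z \<le> s" using compact_attains_inf[of Z] by blast
  have z01: "z \<in> {0..1}" and zm: "\<phi> z = \<phi> t0" using z(1) t0(2)[of z] by (auto simp: Z_def)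
  have "z \<noteq> 0" "z \<noteq> 1" using zm m ends by auto
  then have zz: "0 < z" "z < 1" using z01 by auto
  define d where "d = min z (1 - z)"
  have d: "0 < d" "z - d \<in> {0..1}" "z + d \<in> {0..1}" using zz by (auto simp: d_def)
  have "z - d \<notin> Z" using z(2)[of "z - d"] d(1) by auto
  then have "\<phi> (z - d) > \<phi> t0" using d(2) by (auto simp: Z_def)
  moreover have "\<phi> (z + d) \<ge> \<phi> t0" by (rule t0(2)[OF d(3)])
  moreover have "\<phi> (z - d) + \<phi> (z + d) \<le> 2 * \<phi> z" using mid[OF d(2,3)] by simp
  ultimately show False using zm by simp
qed

lemma midpoint_concave_imp_concave:
  fixes f :: "'a::real_normed_vector \<Rightarrow> real"
  assumes cont: "continuous_on UNIV f"
    and mid: "\<And>x y. f x + f y \<le> 2 * f ((1 / 2) *\<^sub>R (x + y))"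
    and t: "t \<in> {0..1}"
  shows "(1 - t) * f x + t * f y \<le> f ((1 - t) *\<^sub>R x + t *\<^sub>R y)"
proof -
  define \<phi> where "\<phi> s = f ((1 - s) *\<^sub>R x + s *\<^sub>R y) - ((1 - s) * f x + s * f y)" for s
  have "\<phi> t \<ge> 0"
  proof (rule midpoint_concave_nonneg[OF _ _ _ _ t])
    have c: "continuous_on {0..1} (\<lambda>s. f ((1 - s) *\<^sub>R x + s *\<^sub>R y))"
      by (rule continuous_on_compose2[OF cont]) (auto intro!: continuous_intros)
    show "continuous_on {0..1} \<phi>" unfolding \<phi>_def by (intro continuous_intros c)
    show "\<phi> 0 = 0" "\<phi> 1 = 0" by (simp_all add: \<phi>_def)
    fix r s :: real
    have "(1 / 2) *\<^sub>R (((1 - r) *\<^sub>R x + r *\<^sub>R y) + ((1 - s) *\<^sub>R x + s *\<^sub>R y))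
       = (1 - (r + s) / 2) *\<^sub>R x + ((r + s) / 2) *\<^sub>R y"
      by (simp add: algebra_simps flip: scaleR_add_left)
    with mid[of "(1 - r) *\<^sub>R x + r *\<^sub>R y" "(1 - s) *\<^sub>R x + s *\<^sub>R y"]
    have "f ((1 - r) *\<^sub>R x + r *\<^sub>R y) + f ((1 - s) *\<^sub>R x + s *\<^sub>R y)
       \<le> 2 * f ((1 - (r + s) / 2) *\<^sub>R x + ((r + s) / 2) *\<^sub>R y)" by simp
    then show "\<phi> r + \<phi> s \<le> 2 * \<phi> ((r + s) / 2)" unfolding \<phi>_def by (simp add: field_simps)
  qed
  then show ?thesis by (simp add: \<phi>_def)
qed

text \<open>The hypograph is separated from the open vertical ray above the point of contact. A
  vertical hyperplane is impossible because the hypograph has points over every \<open>x\<close>;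
  hence \<rho> > 0, and dividing by it gives the slope.\<close>

lemma concave_supergradient:
  fixes f :: "'a::euclidean_space \<Rightarrow> real"
  assumes cont: "continuous_on UNIV f"
    and mid: "\<And>x y. f x + f y \<le> 2 * f ((1 / 2) *\<^sub>R (x + y))"
  shows "\<exists>d. \<forall>x. f x \<le> f x0 + d \<bullet> (x - x0)"
proof -
  define S where "S = {p :: 'a \<times> real. snd p \<le> f (fst p)}"
  define R where "R = {p :: 'a \<times> real. fst p = x0 \<and> snd p > f x0}"
  have "convex S"
    unfolding convex_alt
  proof (intro ballI allI impI)
    fix p q and t :: real assume pq: "p \<in> S" "q \<in> S" and t: "0 \<le> t \<and> t \<le> 1"
    have "(1 - t) * snd p + t * snd q \<le> (1 - t) * f (fst p) + t * f (fst q)"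
      using pq t by (intro add_mono mult_left_mono) (auto simp: S_def)
    also have "\<dots> \<le> f ((1 - t) *\<^sub>R fst p + t *\<^sub>R fst q)"
      by (rule midpoint_concave_imp_concave[OF cont mid]) (use t in auto)
    finally show "(1 - t) *\<^sub>R p + t *\<^sub>R q \<in> S" by (simp add: S_def)
  qed
  moreover have "convex R"
    unfolding convex_alt
  proof (intro ballI allI impI)
    fix p q and t :: real assume pq: "p \<in> R" "q \<in> R" and t: "0 \<le> t \<and> t \<le> 1"
    have "0 < (1 - t) * (snd p - f x0) + t * (snd q - f x0)"
    proof (cases "t = 0")
      case False
      then show ?thesis using pq t by (intro add_nonneg_pos mult_nonneg_nonneg mult_pos_pos) (auto simp: R_def)
    qed (use pq in \<open>auto simp: R_def\<close>)
    then have "f x0 < (1 - t) * snd p + t * snd q" by (simp add: algebra_simps)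
    moreover have "(1 - t) *\<^sub>R x0 + t *\<^sub>R x0 = x0" by (simp flip: scaleR_add_left)
    ultimately show "(1 - t) *\<^sub>R p + t *\<^sub>R q \<in> R" using pq by (simp add: R_def)
  qed
  moreover have "(x0, f x0) \<in> S" "(x0, f x0 + 1) \<in> R" "S \<inter> R = {}" by (auto simp: S_def R_def)
  ultimately obtain w \<beta> where w: "w \<noteq> 0" "\<forall>p\<in>S. w \<bullet> p \<le> \<beta>" "\<forall>p\<in>R. w \<bullet> p \<ge> \<beta>"
    using separating_hyperplane_sets[of S R] by blast
  obtain a \<rho> where wa: "w = (a, \<rho>)" by (cases w)
  have up: "a \<bullet> x + \<rho> * r \<le> \<beta>" if "r \<le> f x" for x r
    using w(2) that by (auto simp: S_def wa inner_prod_def)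
  have lo: "\<beta> \<le> a \<bullet> x0 + \<rho> * r" if "r > f x0" for r
    using w(3) that by (auto simp: R_def wa inner_prod_def)
  have "\<rho> \<ge> 0"
    using up[of "f x0" x0] lo[of "f x0 + 1"] by (simp add: algebra_simps)
  moreover have "\<rho> \<noteq> 0"
  proof
    assume "\<rho> = 0"
    then have "a \<bullet> x \<le> a \<bullet> x0" for x using up[of "f x" x] lo[of "f x0 + 1"] by simp
    from this[of "x0 + a"] have "a \<bullet> a \<le> 0" by (simp add: inner_add_right)
    then have "a \<bullet> a = 0" using inner_ge_zero[of a] by linarith
    then have "a = 0" by simp
    with \<open>\<rho> = 0\<close> w(1) wa show False by (simp add: zero_prod_def)
  qed
  ultimately have \<rho>: "\<rho> > 0" by simp
  have lo0: "\<beta> \<le> a \<bullet> x0 + \<rho> * f x0"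
  proof (rule field_le_epsilon)
    fix e :: real assume "e > 0"
    then show "\<beta> \<le> a \<bullet> x0 + \<rho> * f x0 + e"
      using lo[of "f x0 + e / \<rho>"] \<rho> by (simp add: distrib_left)
  qed
  have "f x \<le> f x0 + (- (1 / \<rho>) *\<^sub>R a) \<bullet> (x - x0)" for x
  proof -
    have "\<rho> * f x \<le> \<rho> * f x0 + a \<bullet> x0 - a \<bullet> x" using up[of "f x" x] lo0 by simp
    then have "f x \<le> f x0 + (a \<bullet> x0 - a \<bullet> x) / \<rho>" using \<rho> by (simp add: field_simps)
    then show ?thesis by (simp add: inner_diff_right diff_divide_distrib)
  qed
  then show ?thesis by blast
qed

text \<open>Cholesky factorization; a vanishing upper left entry forces the off-diagonal entry to
  vanish as well.\<close>

lemma psd_factor: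
  fixes A :: "real ^ 2 ^ 2"
  assumes sym: "transpose A = A" and psd: "\<And>v. v \<bullet> (A *v v) \<ge> 0"
  shows "\<exists>s1 s2. A $ 1 $ 1 = (fst s1)\<^sup>2 + (fst s2)\<^sup>2 \<and> A $ 1 $ 2 = fst s1 * snd s1 + fst s2 * snd s2 \<and>
    A $ 2 $ 1 = fst s1 * snd s1 + fst s2 * snd s2 \<and> A $ 2 $ 2 = (snd s1)\<^sup>2 + (snd s2 :: real)\<^sup>2"
proof -
  define a e d where "a = A $ 1 $ 1" and "e = A $ 1 $ 2" and "d = A $ 2 $ 2"
  have "transpose A $ 2 $ 1 = A $ 1 $ 2" by (simp add: transpose_def)
  then have e': "A $ 2 $ 1 = e" unfolding sym e_def .
  have q: "a * x\<^sup>2 + 2 * e * x * y + d * y\<^sup>2 \<ge> 0" for x y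
    using psd[of "vector [x, y]"]
    by (simp add: inner_vec_def matrix_vector_mult_def sum_2 e' a_def[symmetric] e_def[symmetric] d_def[symmetric]
        power2_eq_square algebra_simps)
  have a0: "a \<ge> 0" using q[of 1 0] by simp
  have d0: "d \<ge> 0" using q[of 0 1] by simp
  show ?thesis
  proof (cases "a = 0")
    case True
    have "e = 0"
    proof (rule ccontr)
      assume "e \<noteq> 0"
      \<comment> \<open>At this point the quadratic form equals - (d + 1) + d = - 1.\<close>
      then show False using q[of "- (d + 1) / (2 * e)" 1] True by (simp add: field_simps)
    qed
    then show ?thesis using True d0 a_def e_def d_def e'
      by (intro exI[of _ "(0, sqrt d)"] exI[of _ "(0, 0)"]) simp
  next
    case False
    then have a: "a > 0" using a0 by simp
    \<comment> \<open>The form at (e, - a) is a times the determinant, so the Schur complement is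
      nonnegative.\<close>
    have "a * (a * d - e\<^sup>2) \<ge> 0" using q[of e "- a"] by (simp add: power2_eq_square algebra_simps)
    then have "d - e\<^sup>2 / a \<ge> 0" using a by (simp add: zero_le_mult_iff field_simps)
    then show ?thesis using a a_def e_def d_def e'
      by (intro exI[of _ "(sqrt a, e / sqrt a)"] exI[of _ "(0, sqrt (d - e\<^sup>2 / a))"])
        (simp add: power_divide)
  qed
qed

section \<open>Comparison with the average\<close>

locale concave_equation =
  fixes s1 s2 :: "real \<times> real" and A :: "real ^ 2 ^ 2" and f :: "real ^ 2 \<Rightarrow> real" and L :: real
  assumes A_eq: "A $ 1 $ 1 = (fst s1)\<^sup>2 + (fst s2)\<^sup>2" "A $ 1 $ 2 = fst s1 * snd s1 + fst s2 * snd s2"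
    "A $ 2 $ 1 = fst s1 * snd s1 + fst s2 * snd s2" "A $ 2 $ 2 = (snd s1)\<^sup>2 + (snd s2)\<^sup>2"
    and lipschitz: "L-lipschitz_on UNIV f"
    and concave: "\<And>\<xi> \<eta>. f \<xi> + f \<eta> \<le> 2 * f ((1 / 2) *\<^sub>R (\<xi> + \<eta>))"

text \<open>With zero drift, \<open>gen\<close> is the second-order part of the equation, and the
  first-order part stays in \<open>f\<close>. A nonzero drift enters only when
  \<open>bellman\<close> is interpreted at a supergradient.\<close>

sublocale concave_equation \<subseteq> generator s1 s2 "(0, 0)" .

context concave_equation begin

lemma L_nonneg: "L \<ge> 0"
  using lipschitz by (rule lipschitz_on_nonneg)

lemma f_lower: "f \<xi> - L * norm (\<eta> - \<xi>) \<le> f \<eta>"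
  using lipschitz_onD[OF lipschitz, of \<xi> \<eta>] by (simp add: dist_norm norm_minus_commute abs_le_iff)

lemma gen_eq_lap: "gen g p = DX s1 (DX s1 g) p + DX s2 (DX s2 g) p"
  by (simp add: gen_def DX_def[of "(0, 0)"])

lemma parab_op_eq:
  fixes V :: "heis \<times> real \<Rightarrow> real"
  assumes "Ck 2 V"
  shows "parab_op A f V p t = deriv (\<lambda>s. V (p, s)) t - gen (\<lambda>q. V (q, t)) p + f (hgrad (\<lambda>q. V (q, t)) p)"
proof -
  have "Ck (Suc (Suc 0)) (\<lambda>q. V (q, t))" using Ck_slice[OF assms] by (simp add: numeral_2_eq_2)
  from trace_hess[OF A_eq this] show ?thesis
    unfolding parab_op_def gen_eq_lap by simp
qed

lemma mollified_classical_supersolution: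
  assumes u: "viscosity_supersolution A f u" "continuous_on (UNIV \<times> {0..}) u"
    and k: "k \<ge> 0" and M: "M \<ge> 0"
    and bd: "\<And>p t. t \<in> {0..T + 2} \<Longrightarrow> \<bar>u (p, t)\<bar> \<le> M * barrier k p"
    and \<psi>: "mollifier \<delta> \<psi>" and t: "0 \<le> t" "t + \<delta> < T"
    and W: "W = conv \<psi> (clamped (T + 2) (sym_avg h u))"
  shows "gen (\<lambda>q. W (q, t)) p - f (hgrad (\<lambda>q. W (q, t)) p) \<le> deriv (\<lambda>s. W (p, s)) t"
proof -
  let ?g = "\<lambda>q. W (q, t)"
  define \<xi>0 where "\<xi>0 = hgrad ?g p"
  have "continuous_on UNIV f" by (rule lipschitz_on_continuous_on[OF lipschitz])
  then obtain d where d: "\<And>\<xi>. f \<xi> \<le> f \<xi>0 + d \<bullet> (\<xi> - \<xi>0)"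
    using concave_supergradient[OF _ concave] by blast
  define c where "c = f \<xi>0 - d \<bullet> \<xi>0"
  have inner2: "d \<bullet> \<xi> = d $ 1 * \<xi> $ 1 + d $ 2 * \<xi> $ 2" for \<xi>
    by (simp add: inner_vec_def sum_2)
  \<comment> \<open>The majorant depends on the point under consideration. This is harmless because
    \<open>W\<close> is fixed and satisfies the linear inequality of every majorant at every
    point.\<close>
  interpret B: bellman s1 s2 "(d $ 1, d $ 2)" A f c
  proof
    show "f \<xi> \<le> fst (d $ 1, d $ 2) * \<xi> $ 1 + snd (d $ 1, d $ 2) * \<xi> $ 2 + c" for \<xi>
      using d[of \<xi>] by (simp add: c_def inner_diff_right inner2)
  qed (rule A_eq)+
  have "B.gen ?g p - c \<le> deriv (\<lambda>s. W (p, s)) t"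
    by (rule B.mollified_supersolution[OF u k M bd \<psi> t W])
  moreover have "B.gen ?g p = gen ?g p - d \<bullet> \<xi>0"
    by (simp add: B.gen_def gen_eq_lap DX_def[of "(d $ 1, d $ 2)"] inner2 \<xi>0_def hgrad_def)
  ultimately show ?thesis by (simp add: c_def \<xi>0_def)
qed

text \<open>The time derivative of the added term beats its second-order part, bounded through
  \<open>DX_DX_barrier_le\<close>, and the change of \<open>f\<close>, which the Lipschitz bound
  limits to L times 2 l times the term: each of the two horizontal derivatives of the barrier
  contributes l.\<close>

lemma strict_supersolution:
  fixes W :: "heis \<times> real \<Rightarrow> real"
  assumes W: "Ck 2 W" and sup: "gen (\<lambda>q. W (q, t)) p - f (hgrad (\<lambda>q. W (q, t)) p) \<le> deriv (\<lambda>s. W (p, s)) t"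
    and l: "l \<ge> 0" and e: "e > 0"
    and \<Lambda>: "\<Lambda> > (l\<^sup>2 + 6 * l) * ((norm s1)\<^sup>2 + (norm s2)\<^sup>2) + 2 * L * l"
  shows "parab_op A f (\<lambda>w. W w + e * exp (\<Lambda> * snd w) * barrier l (fst w)) p t > 0"
proof -
  define \<kappa> where "\<kappa> = e * exp (\<Lambda> * t)"
  have \<kappa>: "\<kappa> > 0" using e by (simp add: \<kappa>_def)
  let ?V = "\<lambda>w. W w + e * exp (\<Lambda> * snd w) * barrier l (fst w)"
  let ?g = "\<lambda>q. W (q, t)" and ?B = "barrier l p"
  have V: "Ck 2 ?V" by (intro Ck_intros W Ck_time Ck_space Ck_barrier)
  have W1: "Ck (Suc 1) W" using W by (simp add: numeral_2_eq_2)
  have g2: "Ck 2 ?g" and g1: "Ck (Suc 1) ?g" using Ck_slice[OF W] by (simp_all add: numeral_2_eq_2)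
  have "((\<lambda>s. W (p, s) + e * exp (\<Lambda> * s) * ?B) has_real_derivative deriv (\<lambda>s. W (p, s)) t + \<Lambda> * \<kappa> * ?B) (at t)"
    by (rule derivative_eq_intros Ck_time_deriv[OF W1] refl)+ (simp add: \<kappa>_def)
  then have 1: "deriv (\<lambda>s. ?V (p, s)) t = deriv (\<lambda>s. W (p, s)) t + \<Lambda> * \<kappa> * ?B"
    by (simp add: DERIV_imp_deriv)
  have slice: "(\<lambda>q. ?V (q, t)) = (\<lambda>q. 1 * ?g q + \<kappa> * barrier l q)" by (simp add: \<kappa>_def)
  have 2: "gen (\<lambda>q. ?V (q, t)) p = gen ?g p + \<kappa> * gen (barrier l) p"
    unfolding slice gen_linear[OF g2 Ck_barrier] by simp
  have "\<bar>gen (barrier l) p\<bar> \<le> (l\<^sup>2 + 6 * l) * (norm s1)\<^sup>2 * ?B + (l\<^sup>2 + 6 * l) * (norm s2)\<^sup>2 * ?B"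
    unfolding gen_eq_lap
    using DX_DX_barrier_le[OF l, of s1 p] DX_DX_barrier_le[OF l, of s2 p] by linarith
  then have 3: "gen (barrier l) p \<le> (l\<^sup>2 + 6 * l) * ((norm s1)\<^sup>2 + (norm s2)\<^sup>2) * ?B"
    by (simp add: abs_le_iff algebra_simps)
  have X: "\<bar>X1 (barrier l) p\<bar> \<le> l * ?B" "\<bar>X2 (barrier l) p\<bar> \<le> l * ?B"
    using DX_barrier_le[OF l, of "(1, 0)" p] DX_barrier_le[OF l, of "(0, 1)" p]
    by (simp_all add: DX_def norm_prod_def)
  have "hgrad (\<lambda>q. ?V (q, t)) p - hgrad ?g p = \<kappa> *\<^sub>R vector [X1 (barrier l) p, X2 (barrier l) p]"
    unfolding slice hgrad_def X_linear[OF g1 Ck_barrier[of "Suc 0"]]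
    by (simp add: vec_eq_iff forall_2)
  moreover have "norm (vector [X1 (barrier l) p, X2 (barrier l) p] :: real ^ 2) \<le> \<bar>X1 (barrier l) p\<bar> + \<bar>X2 (barrier l) p\<bar>"
    using norm_le_l1_cart[of "vector [X1 (barrier l) p, X2 (barrier l) p] :: real ^ 2"] by (simp add: sum_2)
  ultimately have "norm (hgrad (\<lambda>q. ?V (q, t)) p - hgrad ?g p) \<le> \<kappa> * (2 * l * ?B)"
    using X \<kappa> by (simp add: mult_left_mono)
  from mult_left_mono[OF this L_nonneg] f_lower[of "hgrad ?g p" "hgrad (\<lambda>q. ?V (q, t)) p"]
  have 4: "f (hgrad ?g p) - L * (\<kappa> * (2 * l * ?B)) \<le> f (hgrad (\<lambda>q. ?V (q, t)) p)" by linarith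
  have "\<kappa> * gen (barrier l) p \<le> \<kappa> * ((l\<^sup>2 + 6 * l) * ((norm s1)\<^sup>2 + (norm s2)\<^sup>2) * ?B)"
    using 3 \<kappa> by (intro mult_left_mono) auto
  moreover have "((l\<^sup>2 + 6 * l) * ((norm s1)\<^sup>2 + (norm s2)\<^sup>2) + 2 * L * l) * (\<kappa> * ?B) < \<Lambda> * (\<kappa> * ?B)"
    using \<Lambda> \<kappa> by (intro mult_strict_right_mono) auto
  ultimately have "\<kappa> * gen (barrier l) p + L * (\<kappa> * (2 * l * ?B)) < \<Lambda> * \<kappa> * ?B"
    by (simp add: algebra_simps)
  then show ?thesis unfolding parab_op_eq[OF V] 1 2 using sup 4 by linarith
qed

text \<open>The mollified average plus a small barrier is a strict classical supersolution that lies
  above \<open>u\<close> initially and outside a bounded set, so comparison applies to it. The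
  kernel is chosen after e, through the modulus of continuity; finally e tends to zero.\<close>

lemma below_sym_avg:
  assumes u: "viscosity_subsolution A f u" "viscosity_supersolution A f u" "continuous_on (UNIV \<times> {0..}) u"
    and growth: "exp_growth u" and init: "\<And>p. u (p, 0) \<le> sym_avg h u (p, 0)" and t1: "t1 \<ge> 0"
  shows "u (p1, t1) \<le> sym_avg h u (p1, t1)"
proof -
  \<comment> \<open>Comparison runs to \<open>t1 + 1\<close>, strictly past the time of interest,
    and the kernel looks ahead by a further \<delta> <= 1.\<close>
  define T where "T = t1 + 2"
  have "T + 2 > 0" using t1 by (simp add: T_def)
  from growth[unfolded exp_growth_def, rule_format, OF this] obtain k M
    where k: "k > 0" and M: "M > 0" and g: "\<forall>p. \<forall>t\<in>{0..T + 2}. \<bar>u (p, t)\<bar> \<le> M * exp (k * hgauge p)" by blast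
  have bd: "\<bar>u (p, t)\<bar> \<le> M * barrier k p" if "t \<in> {0..T + 2}" for p t
  proof -
    have "exp (k * hgauge p) \<le> barrier k p"
      unfolding barrier_def using hgauge_le_sgauge[of p] k by simp
    with g[rule_format, OF that, of p] mult_left_mono[OF this, of M] M show ?thesis by linarith
  qed
  have k0: "k \<ge> 0" and M0: "M \<ge> 0" using k M by auto
  obtain m where m: "m \<ge> 1" "\<And>k p. k \<ge> 0 \<Longrightarrow> barrier k (h \<cdot>\<^sub>H p) \<le> barrier (m * k) p"
    "\<And>k p. k \<ge> 0 \<Longrightarrow> barrier k (hinv h \<cdot>\<^sub>H p) \<le> barrier (m * k) p"
    using barrier_translate_ex[of h] by blast
  have mk: "m * k \<ge> 0" "k \<le> m * k" using m(1) k0 mult_right_mono[of 1 m k] by simp_all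
  define w where "w = sym_avg h u"
  have wc: "continuous_on (UNIV \<times> {0..}) w" unfolding w_def by (rule continuous_sym_avg[OF u(3)])
  have wbd: "\<bar>w (q, t)\<bar> \<le> M * barrier (m * k) q" if "t \<in> {0..T + 2}" for q t
    unfolding w_def by (rule sym_avg_bound[OF bd[OF that] m(2,3)[OF k0] M0])
  define l where "l = 4 * (m * k) + 1"
  have l: "4 * (m * k) < l" "l \<ge> 0" using mk by (simp_all add: l_def)
  define \<Lambda> where "\<Lambda> = (l\<^sup>2 + 6 * l) * ((norm s1)\<^sup>2 + (norm s2)\<^sup>2) + 2 * L * l + 1"
  have \<Lambda>0: "\<Lambda> \<ge> 0" unfolding \<Lambda>_def using l(2) L_nonneg by (intro add_nonneg_nonneg mult_nonneg_nonneg) auto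
  \<comment> \<open>The summand 1 is the mollification error at time \<open>t1\<close>, the
    exponential is the barrier added to \<open>W\<close>.\<close>
  have approx: "u (p1, t1) \<le> w (p1, t1) + e * ((1 + 2 * exp (\<Lambda> * t1)) * barrier l p1)" if e: "e > 0" for e
  proof -
    obtain \<delta> where "translation_modulus w (T + 2) l e \<delta>"
      using translation_modulus_exists[OF wc mk(1) l(1) M0 wbd e] ..
    note \<delta> = translation_modulusD[OF this]
    obtain \<psi> where \<psi>: "mollifier \<delta> \<psi>" using mollifier_exists[OF \<delta>(1,2)] ..
    note \<psi>D = mollifierD[OF \<psi>]
    define W where "W = conv \<psi> (clamped (T + 2) w)"
    have cc: "continuous_on UNIV (clamped (T + 2) w)" by (rule continuous_clamped[OF wc])
    have W2: "Ck 2 W" unfolding W_def by (rule Ck_mono[OF Ck_conv[OF \<psi>D(1) cc]]) simp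
    have close: "\<bar>W (p, t) - w (p, t)\<bar> \<le> e * barrier l p" if t: "t \<in> {0..T}" for p t
      unfolding W_def
    proof (rule conv_close[OF \<psi>D(1) cc \<psi>D(2,3)])
      fix v assume v: "\<psi> v \<noteq> 0"
      have t': "t \<in> {0..T + 2}" "t - snd v \<in> {0..T + 2}" "\<bar>t - (t - snd v)\<bar> \<le> \<delta>"
        using t \<psi>D(7,8)[OF v] \<delta>(2) by auto
      from \<delta>(3)[OF \<psi>D(4,5,6)[OF v] t', of p]
      show "\<bar>clamped (T + 2) w (ldiv v (p, t)) - w (p, t)\<bar> \<le> e * barrier l p"
        using t'(2) by (simp add: clamped_def ldiv_def clamp_time_id)
    qed
    have Wlow: "- (M * barrier (4 * (m * k)) p) \<le> W (p, t)" for p t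
    proof -
      have "\<bar>clamped (T + 2) w (q, s)\<bar> \<le> M * barrier (m * k) q" for q s
        unfolding clamped_def fst_conv snd_conv using \<open>T + 2 > 0\<close> by (intro wbd clamp_time_range) simp
      then have "\<bar>W (p, t)\<bar> \<le> (\<integral>v. \<bar>\<psi> v\<bar> \<partial>lborel) * (M * barrier (4 * (m * k)) p)"
        unfolding W_def by (rule conv_bound[OF \<psi>D(1) cc mk(1) M0])
      then show ?thesis using \<psi>D(2,3) by (simp add: abs_le_iff)
    qed
    define V where "V = (\<lambda>v. W v + 2 * e * exp (\<Lambda> * snd v) * barrier l (fst v))"
    have V2: "Ck 2 V" unfolding V_def by (intro Ck_intros W2 Ck_time Ck_space Ck_barrier)
    obtain R where R: "\<And>p. sgauge p > R \<Longrightarrow> (2 * M) * barrier (4 * (m * k)) p < (2 * e) * barrier l p"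
      using barrier_dominates[OF l(1), of "2 * e" "2 * M"] e by auto
    have "u (p1, t1) \<le> V (p1, t1)"
    proof (rule subsolution_compare[OF u(1,3) V2, where a=0 and c="t1 + 1" and K="{p. sgauge p \<le> R}"])
      fix p t assume t: "(0::real) < t" "t < t1 + 1"
      have "gen (\<lambda>q. W (q, t)) p - f (hgrad (\<lambda>q. W (q, t)) p) \<le> deriv (\<lambda>s. W (p, s)) t"
        by (rule mollified_classical_supersolution[OF u(2,3) k0 M0 bd \<psi> _ _ W_def[unfolded w_def]])
          (use t \<delta>(2) in \<open>auto simp: T_def\<close>)
      then show "parab_op A f V p t > 0"
        unfolding V_def by (rule strict_supersolution[OF W2 _ l(2)]) (use e in \<open>simp_all add: \<Lambda>_def\<close>)
    next
      fix p
      have "u (p, 0) \<le> w (p, 0)" using init[of p] by (simp add: w_def)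
      moreover have "w (p, 0) - e * barrier l p \<le> W (p, 0)"
        using close[of 0 p] t1 by (simp add: T_def abs_le_iff)
      moreover have "0 \<le> e * barrier l p" using e by simp
      ultimately show "u (p, 0) \<le> V (p, 0)" unfolding V_def by simp
    next
      show "bounded {p. sgauge p \<le> R}" by (rule sgauge_sublevel_bounded)
      fix p t assume p: "p \<notin> {p. sgauge p \<le> R}" and t: "t \<in> {0..t1 + 1}"
      have "t \<in> {0..T + 2}" using t by (simp add: T_def)
      from bd[OF this, of p] have "u (p, t) \<le> M * barrier k p" by (simp add: abs_le_iff)
      also have "\<dots> \<le> M * barrier (4 * (m * k)) p"
        using mk M0 by (intro mult_left_mono barrier_mono) auto
      finally have 1: "u (p, t) \<le> M * barrier (4 * (m * k)) p" .
      have "(2 * e) * barrier l p \<le> (2 * e) * exp (\<Lambda> * t) * barrier l p"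
      proof (rule mult_right_mono)
        have "1 \<le> exp (\<Lambda> * t)" using \<Lambda>0 t by simp
        then show "2 * e \<le> 2 * e * exp (\<Lambda> * t)" using e by simp
      qed simp
      with 1 Wlow[of p t] R[of p] p show "u (p, t) \<le> V (p, t)" unfolding V_def by simp
    qed (use t1 in auto)
    moreover have "W (p1, t1) \<le> w (p1, t1) + e * barrier l p1"
      using close[of t1 p1] t1 by (simp add: T_def abs_le_iff)
    ultimately show ?thesis unfolding V_def by (simp add: algebra_simps)
  qed
  define D where "D = (1 + 2 * exp (\<Lambda> * t1)) * barrier l p1"
  have D: "D > 0" unfolding D_def by (intro mult_pos_pos add_pos_pos) auto
  have "u (p1, t1) \<le> w (p1, t1)"
  proof (rule field_le_epsilon)
    fix e :: real assume "e > 0"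
    then have "e / D > 0" using D by (rule divide_pos_pos)
    from approx[OF this, folded D_def] D show "u (p1, t1) \<le> w (p1, t1) + e" by simp
  qed
  then show ?thesis by (simp add: w_def)
qed

end

theorem theorem1p3:
  fixes A :: "real ^ 2 ^ 2"
    and f :: "real ^ 2 \<Rightarrow> real"
    and u :: "heis \<times> real \<Rightarrow> real"
    and u0 :: "heis \<Rightarrow> real"
  assumes A_sym: "transpose A = A"
    and A_psd: "\<And>v. v \<bullet> (A *v v) \<ge> 0"
    and f_lipschitz: "\<exists>L. L-lipschitz_on UNIV f"
    and u_cont: "continuous_on (UNIV \<times> {0..}) u"
    and u_sol: "viscosity_solution A f u"
    and u_init: "\<And>p. u (p, 0) = u0 p"
    and u_growth: "exp_growth u"
    and f_concave: "\<And>\<xi> \<eta>. f \<xi> + f \<eta> \<le> 2 * f ((1 / 2) *\<^sub>R (\<xi> + \<eta>))"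
    and u0_convex: "right_inv_h_convex u0"
  shows "\<forall>t\<ge>0. right_inv_h_convex (\<lambda>p. u (p, t))"
proof (intro allI impI)
  fix t :: real assume t: "t \<ge> 0"
  obtain s1 s2 where A: "A $ 1 $ 1 = (fst s1)\<^sup>2 + (fst s2)\<^sup>2" "A $ 1 $ 2 = fst s1 * snd s1 + fst s2 * snd s2"
    "A $ 2 $ 1 = fst s1 * snd s1 + fst s2 * snd s2" "A $ 2 $ 2 = (snd s1)\<^sup>2 + (snd s2)\<^sup>2"
    using psd_factor[OF A_sym A_psd] by blast
  obtain L where L: "L-lipschitz_on UNIV f" using f_lipschitz by blast
  interpret concave_equation s1 s2 A f L
    by unfold_locales (fact A L f_concave)+
  have sol: "viscosity_subsolution A f u" "viscosity_supersolution A f u"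
    using u_sol by (simp_all add: viscosity_solution_def)
  have "2 * u (p, t) \<le> u (hinv h \<cdot>\<^sub>H p, t) + u (h \<cdot>\<^sub>H p, t)" if h: "h \<in> H0" for p h
  proof -
    have "u (q, 0) \<le> sym_avg h u (q, 0)" for q
    proof -
      have "2 * u0 q \<le> u0 (hinv h \<cdot>\<^sub>H q) + u0 (h \<cdot>\<^sub>H q)"
        using u0_convex h unfolding right_inv_h_convex_def by blast
      then show ?thesis unfolding sym_avg_def u_init fst_conv snd_conv by (simp del: hmul.simps hinv.simps)
    qed
    from below_sym_avg[OF sol u_cont u_growth this t, of p] show ?thesis
      by (simp add: sym_avg_def del: hmul.simps hinv.simps)
  qed
  then show "right_inv_h_convex (\<lambda>p. u (p, t))"
    unfolding right_inv_h_convex_def by blast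
qed

end
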